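(* Consider the set of isomorphism classes of four-dimensional binary Lie algebras over $\mathbb{C}$. The graph of primary degenerations between them has exactly the following edges (up to isomorphism): (1) $r_2\oplus r_2\to g_5(0)$, and $r_2\oplus r_2\to g_4(\alpha,0)$ for every $\alpha\in\mathbb{C}$; (2) $sl_2\oplus\mathbb{C}\to g_5(-1)$; (3) $g_5(\alpha)\to g_4(\alpha,\alpha+1)$ for every $\alpha\in\mathbb{C}$, and $g_5(1)\to g_3(2)$; (4) $g_4(\alpha,\beta)\to n_4$ for all $\alpha,\beta\in\mathbb{C}$; $g_4(0,0)\to r_2\oplus\mathbb{C}^2$; and $g_4(1,\beta)\to g_2(\beta)$ for every $\beta\in\mathbb{C}$; (5) $g_6\to r_2\oplus\mathbb{C}^2$; (6) $n_4\to n_3\oplus\mathbb{C}$; (7) $g_3(\beta)\to g_2(\beta)$ for every $\beta\in\mathbb{C}$; (8) $r_2\oplus\mathbb{C}^2\to n_3\oplus\mathbb{C}$; (9) $g_2(\beta)\to n_3\oplus\mathbb{C}$ for every $\beta\in\mathbb{C}$, and $g_2(1)\to g_1$; (10) $n_3\oplus\mathbb{C}\to\mathbb{C}^4$; (11) $g_1\to\mathbb{C}^4$. Thus, for four-dimensional binary Lie algebras $A,B$ one has $A\to B$ if and only if there is a directed path (possibly of length $0$) from the isomorphism class of $A$ to that of $B$ in the directed graph with the edges (1)–(11).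
   Context: All algebras are over $\mathbb{C}$ and not necessarily associative. An algebra is binary Lie (BL) if all its 2-generated subalgebras are Lie algebras; equivalently it satisfies $xy=-yx$ and $J(x,y,xy)=0$, where $J(x,y,z)=(xy)z+(yz)x+(zx)y$. Degeneration: fix an $n$-dimensional vector space $V$. $GL_n(\mathbb{C})$ acts on $\mathrm{Hom}(V\otimes V,V)\cong\mathbb{C}^{n^3}$ by $(g*\mu)(x\otimes y)=g(\mu(g^{-1}x\otimes g^{-1}y))$; orbits $O(\mu)$ correspond to isomorphism classes of $n$-dimensional algebras. If $A,B$ are represented by $\mu,\lambda$, then $A\to B$ ("$A$ degenerates to $B$") means $\lambda\in\overline{O(\mu)}$ (Zariski closure). A degeneration $A\to B$ with $A\not\cong B$ is primary if there is no algebra $C$ with $C\not\cong A$, $C\not\cong B$, $A\to C$ and $C\to B$. Known classification: every four-dimensional BL algebra is isomorphic to one of the following, given in a basis $e_1,\dots,e_4$ (products not listed are zero or follow from anticommutativity; $\alpha,\beta\in\mathbb{C}$): $\mathbb{C}^4$: zero multiplication. $n_3\oplus\mathbb{C}$: $e_1e_2=e_3$. $n_4$: $e_1e_2=e_3$, $e_1e_3=e_4$. $r_2\oplus\mathbb{C}^2$: $e_1e_2=e_2$. $r_2\oplus r_2$: $e_1e_2=e_2$, $e_3e_4=e_4$. $sl_2\oplus\mathbb{C}$: $e_1e_2=e_2$, $e_1e_3=-e_3$, $e_2e_3=e_1$. $g_1$: $e_1e_2=e_2$, $e_1e_3=e_3$, $e_1e_4=e_4$. $g_2(\beta)$: $e_1e_2=e_2$,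 $e_1e_3=e_3$, $e_1e_4=e_3+\beta e_4$. $g_3(\beta)$: $e_1e_2=e_2$, $e_1e_3=e_3$, $e_1e_4=\beta e_4$, $e_2e_3=e_4$. $g_4(\alpha,\beta)$: $e_1e_2=e_2$, $e_1e_3=e_2+\alpha e_3$, $e_1e_4=e_3+\beta e_4$. $g_5(\alpha)$: $e_1e_2=e_2$, $e_1e_3=e_2+\alpha e_3$, $e_1e_4=(\alpha+1)e_4$, $e_2e_3=e_4$. $g_6$: $e_1e_2=e_3$, $e_3e_4=e_3$. The only isomorphisms between these are: $g_4(\alpha_1,\beta_1)\cong g_4(\alpha_2,\beta_2)$ iff the proportions $1:\alpha_1:\beta_1$ and $1:\alpha_2:\beta_2$ coincide after some permutation; and $g_5(\alpha)\cong g_5(\beta)$ iff $\alpha=\beta$ or $\alpha\beta=1$.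
   Formalization: The edge r2⊕r2→g4(α,0) at α=1 is removed from the graph of primary degenerations: g4(1,0)≅g4(0,1), so it factors as r2⊕r2→g5(0)→g4(0,1) and is not primary. The path criterion for A→B is kept with all edges (1)–(11). *)

theory Defs
  imports "HOL-Analysis.Analysis"
begin

text \<open>An algebra on the fixed space \<open>V = complex ^ 'n\<close> is its multiplication map. The scalar
  multiplication is \<open>*s\<close>: the library's \<open>linear\<close> and \<open>bilinear\<close> would only give real linearity.\<close>

type_synonym 'n mult = "complex ^ 'n \<Rightarrow> complex ^ 'n \<Rightarrow> complex ^ 'n"

definition is_algebra :: "'n::finite mult \<Rightarrow> bool" where
  "is_algebra \<mu> \<longleftrightarrow>
     (\<forall>x. Vector_Spaces.linear (*s) (*s) (\<lambda>y. \<mu> x y)) \<and>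
     (\<forall>y. Vector_Spaces.linear (*s) (*s) (\<lambda>x. \<mu> x y))"

definition algebra_iso :: "'n::finite mult \<Rightarrow> 'n mult \<Rightarrow> bool" (infix "\<cong>\<^sub>a" 50) where
  "\<mu> \<cong>\<^sub>a \<nu> \<longleftrightarrow>
     (\<exists>f. Vector_Spaces.linear (*s) (*s) f \<and> bij f \<and> (\<forall>x y. f (\<mu> x y) = \<nu> (f x) (f y)))"

definition iso_class :: "'n::finite mult \<Rightarrow> 'n mult set" where
  "iso_class \<mu> = {\<nu>. is_algebra \<nu> \<and> \<mu> \<cong>\<^sub>a \<nu>}"

subsection \<open>Binary Lie algebras\<close>

definition subalgebra :: "'n::finite mult \<Rightarrow> (complex ^ 'n) set \<Rightarrow> bool" where
  "subalgebra \<mu> U \<longleftrightarrow> vec.subspace U \<and> (\<forall>x\<in>U. \<forall>y\<in>U. \<mu> x y \<in> U)"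

definition jacobian :: "'n::finite mult \<Rightarrow> complex ^ 'n \<Rightarrow> complex ^ 'n \<Rightarrow> complex ^ 'n \<Rightarrow> complex ^ 'n"
  where "jacobian \<mu> x y z = \<mu> (\<mu> x y) z + \<mu> (\<mu> y z) x + \<mu> (\<mu> z x) y"

definition lie_on :: "'n::finite mult \<Rightarrow> (complex ^ 'n) set \<Rightarrow> bool" where
  "lie_on \<mu> U \<longleftrightarrow>
     (\<forall>x\<in>U. \<mu> x x = 0) \<and> (\<forall>x\<in>U. \<forall>y\<in>U. \<forall>z\<in>U. jacobian \<mu> x y z = 0)"

definition binary_lie :: "'n::finite mult \<Rightarrow> bool" where
  "binary_lie \<mu> \<longleftrightarrow> is_algebra \<mu> \<and> (\<forall>x y. lie_on \<mu> (subalgebra \<mu> hull {x, y}))"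

subsection \<open>Degenerations\<close>

definition act :: "complex ^ 'n ^ 'n \<Rightarrow> 'n::finite mult \<Rightarrow> 'n mult" where
  "act g \<mu> = (\<lambda>x y. g *v \<mu> (matrix_inv g *v x) (matrix_inv g *v y))"

definition orbit :: "'n::finite mult \<Rightarrow> 'n mult set" where
  "orbit \<mu> = {act g \<mu> | g. invertible g}"

lemma
  assumes "invertible A"
  shows matrix_inv_right: "A ** matrix_inv A = mat 1"
    and matrix_inv_left: "matrix_inv A ** A = mat 1"
  using someI_ex[OF assms[unfolded invertible_def]] by (simp_all add: matrix_inv_def)

lemma iso_class_eq_orbit:
  assumes "is_algebra \<mu>"
  shows "iso_class \<mu> = orbit \<mu>"
proof (intro equalityI subsetI)
  fix \<nu> assume "\<nu> \<in> iso_class \<mu>"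
  then obtain f where lin: "Vector_Spaces.linear (*s) (*s) f" and bij: "bij f"
    and hom: "\<And>x y. f (\<mu> x y) = \<nu> (f x) (f y)"
    by (auto simp: iso_class_def algebra_iso_def)
  have f: "matrix f *v x = f x" for x
    using lin by (simp add: matrix_works)
  have inv: "invertible (matrix f)"
    unfolding invertible_left_inverse matrix_left_invertible_injective
    using bij by (simp add: bij_def f inj_def)
  then have "f (matrix_inv (matrix f) *v x) = x" for x
    by (simp add: f[symmetric] matrix_vector_mul_assoc matrix_inv_right)
  then have "\<nu> = act (matrix f) \<mu>"
    by (simp add: act_def f hom fun_eq_iff)
  with inv show "\<nu> \<in> orbit \<mu>"
    by (auto simp: orbit_def)
next
  fix \<nu> assume "\<nu> \<in> orbit \<mu>"
  then obtain g where inv: "invertible g" and \<nu>: "\<nu> = act g \<mu>"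
    by (auto simp: orbit_def)
  have lin: "Vector_Spaces.linear (*s) (*s) ((*v) h)" for h :: "complex ^ 'a ^ 'a"
    by (rule matrix_vector_mul_linear_gen)
  have comp: "Vector_Spaces.linear (*s) (*s) (\<lambda>y. g *v h (matrix_inv g *v y))"
    if "Vector_Spaces.linear (*s) (*s) h" for h
    using Vector_Spaces.linear_compose[OF Vector_Spaces.linear_compose[OF lin that] lin]
    by (simp add: o_def)
  have "is_algebra \<nu>"
    using assms by (auto simp: is_algebra_def \<nu> act_def intro!: comp)
  moreover have "\<mu> \<cong>\<^sub>a \<nu>"
    unfolding algebra_iso_def
  proof (intro exI[of _ "(*v) g"] conjI allI)
    show "bij ((*v) g)"
      using inv by (intro o_bij[of "(*v) (matrix_inv g)"])
        (auto simp: fun_eq_iff matrix_vector_mul_assoc matrix_inv_left matrix_inv_right)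
  qed (use lin inv in \<open>simp_all add: \<nu> act_def matrix_vector_mul_assoc matrix_inv_left\<close>)
  ultimately show "\<nu> \<in> iso_class \<mu>"
    by (simp add: iso_class_def)
qed

text \<open>The polynomial functions in the \<open>n\<^sup>3\<close> structure constants, which are the coordinates on
  \<open>Hom(V \<otimes> V, V)\<close>.\<close>

inductive poly_fun :: "('n::finite mult \<Rightarrow> complex) \<Rightarrow> bool" where
  const: "poly_fun (\<lambda>\<mu>. c)"
| coord: "poly_fun (\<lambda>\<mu>. \<mu> (axis i 1) (axis j 1) $ k)"
| add: "poly_fun p \<Longrightarrow> poly_fun q \<Longrightarrow> poly_fun (\<lambda>\<mu>. p \<mu> + q \<mu>)"
| mult: "poly_fun p \<Longrightarrow> poly_fun q \<Longrightarrow> poly_fun (\<lambda>\<mu>. p \<mu> * q \<mu>)"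

definition zariski_closed :: "'n::finite mult set \<Rightarrow> bool" where
  "zariski_closed S \<longleftrightarrow>
     (\<exists>P. (\<forall>p\<in>P. poly_fun p) \<and> S = {\<mu>. is_algebra \<mu> \<and> (\<forall>p\<in>P. p \<mu> = 0)})"

definition degenerates :: "'n::finite mult \<Rightarrow> 'n mult \<Rightarrow> bool" (infix "\<leadsto>" 50) where
  "\<mu> \<leadsto> \<nu> \<longleftrightarrow> \<nu> \<in> zariski_closed hull (orbit \<mu>)"

definition primary_degeneration :: "'n::finite mult \<Rightarrow> 'n mult \<Rightarrow> bool" where
  "primary_degeneration A B \<longleftrightarrow> A \<leadsto> B \<and> \<not> A \<cong>\<^sub>a B \<and>
     \<not> (\<exists>C. is_algebra C \<and> \<not> C \<cong>\<^sub>a A \<and> \<not> C \<cong>\<^sub>a B \<and> A \<leadsto> C \<and> C \<leadsto> B)"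

definition primary_graph :: "(4 mult set \<times> 4 mult set) set" where
  "primary_graph =
     {(iso_class A, iso_class B) | A B. binary_lie A \<and> binary_lie B \<and> primary_degeneration A B}"

subsection \<open>The four-dimensional binary Lie algebras\<close>

text \<open>The index type \<open>4\<close> is the integers modulo 4, so \<open>ee 4\<close> is \<open>ee 0\<close> and
  \<open>ee 1, ee 2, ee 3, ee 4\<close> are the four standard basis vectors.\<close>

abbreviation ee :: "4 \<Rightarrow> complex ^ 4" where
  "ee i \<equiv> axis i 1"

text \<open>The anticommutative algebra with \<open>e\<^sub>i e\<^sub>j = v\<close> for the listed \<open>(i, j, v)\<close>, the
  products that do not follow from these by anticommutativity being zero.\<close>

definition table :: "(4 \<times> 4 \<times> (complex ^ 4)) list \<Rightarrow> 4 mult" where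
  "table ps = (\<lambda>x y. \<Sum>(i, j, v)\<leftarrow>ps. (x $ i * y $ j - x $ j * y $ i) *s v)"

definition C4 :: "4 mult" where
  "C4 = table []"
definition n3_C :: "4 mult" where
  "n3_C = table [(1, 2, ee 3)]"
definition n4 :: "4 mult" where
  "n4 = table [(1, 2, ee 3), (1, 3, ee 4)]"
definition r2_C2 :: "4 mult" where
  "r2_C2 = table [(1, 2, ee 2)]"
definition r2_r2 :: "4 mult" where
  "r2_r2 = table [(1, 2, ee 2), (3, 4, ee 4)]"
definition sl2_C :: "4 mult" where
  "sl2_C = table [(1, 2, ee 2), (1, 3, - ee 3), (2, 3, ee 1)]"
definition g1 :: "4 mult" where
  "g1 = table [(1, 2, ee 2), (1, 3, ee 3), (1, 4, ee 4)]"
definition g2 :: "complex \<Rightarrow> 4 mult" where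
  "g2 \<beta> = table [(1, 2, ee 2), (1, 3, ee 3), (1, 4, ee 3 + \<beta> *s ee 4)]"
definition g3 :: "complex \<Rightarrow> 4 mult" where
  "g3 \<beta> = table [(1, 2, ee 2), (1, 3, ee 3), (1, 4, \<beta> *s ee 4), (2, 3, ee 4)]"
definition g4 :: "complex \<Rightarrow> complex \<Rightarrow> 4 mult" where
  "g4 \<alpha> \<beta> = table [(1, 2, ee 2), (1, 3, ee 2 + \<alpha> *s ee 3), (1, 4, ee 3 + \<beta> *s ee 4)]"
definition g5 :: "complex \<Rightarrow> 4 mult" where
  "g5 \<alpha> = table [(1, 2, ee 2), (1, 3, ee 2 + \<alpha> *s ee 3), (1, 4, (\<alpha> + 1) *s ee 4), (2, 3, ee 4)]"
definition g6 :: "4 mult" where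
  "g6 = table [(1, 2, ee 3), (3, 4, ee 3)]"

inductive listed :: "4 mult \<Rightarrow> 4 mult \<Rightarrow> bool" where
  "listed r2_r2 (g5 0)"
| "listed r2_r2 (g4 \<alpha> 0)"
| "listed sl2_C (g5 (-1))"
| "listed (g5 \<alpha>) (g4 \<alpha> (\<alpha> + 1))"
| "listed (g5 1) (g3 2)"
| "listed (g4 \<alpha> \<beta>) n4"
| "listed (g4 0 0) r2_C2"
| "listed (g4 1 \<beta>) (g2 \<beta>)"
| "listed g6 r2_C2"
| "listed n4 n3_C"
| "listed (g3 \<beta>) (g2 \<beta>)"
| "listed r2_C2 n3_C"
| "listed (g2 \<beta>) n3_C"
| "listed (g2 1) g1"
| "listed n3_C C4"
| "listed g1 C4"

text \<open>One of these edges is a degeneration that is not primary: since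
  \<open>g4 1 0\<close> and \<open>g4 0 1\<close> are isomorphic (the proportions 1:1:0 and 1:0:1 agree up to
  permutation), \<open>r2_r2 \<leadsto> g4 1 0\<close> factors as \<open>r2_r2 \<leadsto> g5 0 \<leadsto> g4 0 1\<close>. It does not change the
  reachability relation of the graph.\<close>

definition listed_edges :: "(4 mult set \<times> 4 mult set) set" where
  "listed_edges = {(iso_class A, iso_class B) | A B. listed A B}"

end

theory Submission
  imports Defs "HOL-Computational_Algebra.Fundamental_Theorem_Algebra"
begin

text \<open>Every identity that holds on an orbit and is polynomial in the structure constants survives
  degeneration. The Lie identity, the dependence of \<open>x, y, xy, x(xy)\<close> or of \<open>x(zw), y(zw)\<close>, the
  dimension of the derived algebra, and the proportions between the traces of the powers of a left
  multiplication (which determine its eigenvalues up to a common factor) exclude all degenerations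
  that do not come from a path; each edge is the limit of an explicit one-parameter family of bases.

  Since the statement quantifies over all binary Lie algebras, their classification is needed too. A
  Lie algebra has an ideal of codimension one on which all left multiplications are traceless: the
  kernel of \<open>x \<mapsto> tr (ad x)\<close>, or, if this form is zero, an ideal given by the fact that a
  four-dimensional unimodular Lie algebra is not perfect. The traceless three-dimensional ideal is
  abelian, Heisenberg, or contains an element acting with eigenvalues \<open>0, 1, -1\<close>. If the algebra is
  not Lie, a nonzero component of the Jacobian is a 3-form with a kernel vector \<open>w\<close>, and the identity
  \<open>J(x, y, xy) = 0\<close> forces \<open>xy = \<lambda>(x) y - \<lambda>(y) x + \<Omega>(x, y) w\<close>.\<close>


text \<open>Closures of orbits are never computed. For each type the closed conditions leave a list
  of candidates with constraints on their parameters, and every candidate left turns out to be the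
  end of a path; the exclusions need not be sharper than that. The delicate point is the parameters:
  an isomorphism may permute and rescale eigenvalues, so they are compared through power sums of
  weights 1, 2, 3 and translated back by Newton's identities. Primality quantifies over arbitrary
  intermediate algebras C. The identity J(x, y, xy) = 0 is closed, so C satisfies it and the
  classification applies to C. A height that drops strictly along every proper degeneration then
  leaves no room for C, except between heights 5 and 3, where the only candidates are the algebras
  \<open>g5\<close>.\<close>

abbreviation lin :: "(complex ^ 'n \<Rightarrow> complex ^ 'n) \<Rightarrow> bool" where
  "lin \<equiv> Vector_Spaces.linear (*s) (*s)"

lemma lin_iff: "lin f \<longleftrightarrow> (\<forall>x y. f (x + y) = f x + f y) \<and> (\<forall>c x. f (c *s x) = c *s f x)"
  by (simp add: Vector_Spaces.linear_iff vec.vector_space_axioms)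

lemma is_algebra_iff:
  "is_algebra \<mu> \<longleftrightarrow>
     (\<forall>x y z. \<mu> x (y + z) = \<mu> x y + \<mu> x z \<and> \<mu> (y + z) x = \<mu> y x + \<mu> z x) \<and>
     (\<forall>c x y. \<mu> x (c *s y) = c *s \<mu> x y \<and> \<mu> (c *s x) y = c *s \<mu> x y)"
  unfolding is_algebra_def lin_iff by auto

context
  fixes \<mu> :: "'n::finite mult"
  assumes alg: "is_algebra \<mu>"
begin

lemma alg_add_right: "\<mu> x (y + z) = \<mu> x y + \<mu> x z"
  and alg_add_left: "\<mu> (y + z) x = \<mu> y x + \<mu> z x"
  and alg_scale_right: "\<mu> x (c *s y) = c *s \<mu> x y"
  and alg_scale_left: "\<mu> (c *s x) y = c *s \<mu> x y"
  using alg by (simp_all add: is_algebra_iff)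

lemma alg_zero_right: "\<mu> x 0 = 0" and alg_zero_left: "\<mu> 0 x = 0"
  using alg_scale_right[of x 0 0] alg_scale_left[of 0 0 x] by simp_all

lemma alg_minus_right: "\<mu> x (- y) = - \<mu> x y" and alg_minus_left: "\<mu> (- x) y = - \<mu> x y"
  using alg_scale_right[of x "-1" y] alg_scale_left[of "-1" x y] by simp_all

lemma alg_diff_right: "\<mu> x (y - z) = \<mu> x y - \<mu> x z"
  and alg_diff_left: "\<mu> (y - z) x = \<mu> y x - \<mu> z x"
  using alg_add_right[of x y "- z"] alg_add_left[of y "- z" x]
  by (simp_all add: alg_minus_right alg_minus_left)

lemma alg_sum_right: "\<mu> x (\<Sum>i\<in>A. f i) = (\<Sum>i\<in>A. \<mu> x (f i))"
  and alg_sum_left: "\<mu> (\<Sum>i\<in>A. f i) x = (\<Sum>i\<in>A. \<mu> (f i) x)"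
  by (induction A rule: infinite_finite_induct)
    (simp_all add: alg_zero_left alg_zero_right alg_add_left alg_add_right)

lemmas alg_simps = alg_add_right alg_add_left alg_scale_right alg_scale_left alg_zero_right
  alg_zero_left alg_minus_right alg_minus_left alg_diff_right alg_diff_left

text \<open>Bilinearity is what lets products of arbitrary vectors, not only of basis vectors, enter
  polynomial invariants.\<close>

lemma alg_expand:
  "\<mu> x y $ k = (\<Sum>i\<in>UNIV. \<Sum>j\<in>UNIV. x $ i * y $ j * \<mu> (axis i 1) (axis j 1) $ k)"
proof -
  have "\<mu> x y = \<mu> (\<Sum>i\<in>UNIV. x $ i *s axis i 1) (\<Sum>j\<in>UNIV. y $ j *s axis j 1)"
    by (simp add: basis_expansion)
  also have "\<dots> = (\<Sum>j\<in>UNIV. \<Sum>i\<in>UNIV. (x $ i * y $ j) *s \<mu> (axis i 1) (axis j 1))"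
    by (simp add: alg_sum_left alg_sum_right alg_simps vec.scale_sum_right mult.commute)
  finally show ?thesis
    by (subst sum.swap) simp
qed

end

subsection \<open>Isomorphism\<close>

lemma iso_refl: "\<mu> \<cong>\<^sub>a \<mu>"
  unfolding algebra_iso_def by (intro exI[of _ id]) (auto simp: lin_iff)

lemma iso_trans: "\<mu> \<cong>\<^sub>a \<nu> \<Longrightarrow> \<nu> \<cong>\<^sub>a \<rho> \<Longrightarrow> \<mu> \<cong>\<^sub>a \<rho>"
  unfolding algebra_iso_def
proof (elim exE conjE)
  fix f g assume "lin f" "lin g" "bij f" "bij g"
    "\<forall>x y. f (\<mu> x y) = \<nu> (f x) (f y)" "\<forall>x y. g (\<nu> x y) = \<rho> (g x) (g y)"
  then show "\<exists>h. lin h \<and> bij h \<and> (\<forall>x y. h (\<mu> x y) = \<rho> (h x) (h y))"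
    by (intro exI[of _ "g \<circ> f"]) (auto simp: lin_iff bij_comp)
qed

lemma iso_sym:
  assumes "\<mu> \<cong>\<^sub>a \<nu>" shows "\<nu> \<cong>\<^sub>a \<mu>"
proof -
  obtain f where f: "lin f" "bij f" "\<And>x y. f (\<mu> x y) = \<nu> (f x) (f y)"
    using assms by (auto simp: algebra_iso_def)
  have inv: "inv f (f x) = x" "f (inv f x) = x" for x
    using f(2) by (simp_all add: bij_is_inj bij_is_surj surj_f_inv_f)
  have inj: "f x = f y \<Longrightarrow> x = y" for x y
    using inv(1) by metis
  have "inv f (x + y) = inv f x + inv f y" "inv f (c *s x) = c *s inv f x" for x y c
    using f(1) by (rule_tac inj, simp add: inv lin_iff)+
  then have "lin (inv f)"
    by (simp add: lin_iff)
  moreover have "inv f (\<nu> x y) = \<mu> (inv f x) (inv f y)" for x y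
    by (rule inj) (simp add: f(3) inv)
  ultimately show ?thesis
    unfolding algebra_iso_def using bij_imp_bij_inv[OF f(2)] by blast
qed

lemma iso_class_eq_iff:
  assumes "is_algebra \<mu>" "is_algebra \<nu>"
  shows "iso_class \<mu> = iso_class \<nu> \<longleftrightarrow> \<mu> \<cong>\<^sub>a \<nu>"
proof
  assume "iso_class \<mu> = iso_class \<nu>"
  moreover have "\<nu> \<in> iso_class \<nu>" using assms by (simp add: iso_class_def iso_refl)
  ultimately show "\<mu> \<cong>\<^sub>a \<nu>" by (auto simp: iso_class_def)
next
  assume "\<mu> \<cong>\<^sub>a \<nu>"
  then show "iso_class \<mu> = iso_class \<nu>"
    unfolding iso_class_def using iso_trans iso_sym by blast
qed

lemma orbit_iff:
  assumes "is_algebra \<mu>"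
  shows "\<nu> \<in> orbit \<mu> \<longleftrightarrow> is_algebra \<nu> \<and> \<mu> \<cong>\<^sub>a \<nu>"
  using iso_class_eq_orbit[OF assms] by (auto simp: iso_class_def)

subsection \<open>Polynomial functions on the variety of algebras\<close>

text \<open>The functions in \<open>poly_fun\<close> live on arbitrary maps \<mu>, where a
  coordinate of \<open>\<mu> x y\<close> is no polynomial in the structure constants. Agreement is
  demanded on algebras only, which suffices because orbits of algebras consist of algebras.\<close>

definition alg_poly :: "('n::finite mult \<Rightarrow> complex) \<Rightarrow> bool" where
  "alg_poly p \<longleftrightarrow> (\<exists>q. poly_fun q \<and> (\<forall>\<mu>. is_algebra \<mu> \<longrightarrow> p \<mu> = q \<mu>))"

definition alg_poly_vec :: "('n::finite mult \<Rightarrow> complex ^ 'n) \<Rightarrow> bool" where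
  "alg_poly_vec F \<longleftrightarrow> (\<forall>k. alg_poly (\<lambda>\<mu>. F \<mu> $ k))"

lemma alg_poly_const: "alg_poly (\<lambda>\<mu>. c)"
  unfolding alg_poly_def using poly_fun.const by blast

lemma alg_poly_poly: "poly_fun p \<Longrightarrow> alg_poly p"
  unfolding alg_poly_def by blast

lemma alg_poly_add: "alg_poly p \<Longrightarrow> alg_poly q \<Longrightarrow> alg_poly (\<lambda>\<mu>. p \<mu> + q \<mu>)"
  unfolding alg_poly_def using poly_fun.add by fastforce

lemma alg_poly_mult: "alg_poly p \<Longrightarrow> alg_poly q \<Longrightarrow> alg_poly (\<lambda>\<mu>. p \<mu> * q \<mu>)"
  unfolding alg_poly_def using poly_fun.mult by fastforce

lemma alg_poly_minus: "alg_poly p \<Longrightarrow> alg_poly (\<lambda>\<mu>. - p \<mu>)"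
  using alg_poly_mult[OF alg_poly_const[of "-1"]] by simp

lemma alg_poly_diff: "alg_poly p \<Longrightarrow> alg_poly q \<Longrightarrow> alg_poly (\<lambda>\<mu>. p \<mu> - q \<mu>)"
  using alg_poly_add[OF _ alg_poly_minus, of p q] by simp

lemma alg_poly_power: "alg_poly p \<Longrightarrow> alg_poly (\<lambda>\<mu>. p \<mu> ^ n)"
  by (induction n) (simp_all add: alg_poly_const alg_poly_mult)

lemma alg_poly_sum: "(\<And>i. i \<in> A \<Longrightarrow> alg_poly (f i)) \<Longrightarrow> alg_poly (\<lambda>\<mu>. \<Sum>i\<in>A. f i \<mu>)"
  by (induction A rule: infinite_finite_induct) (auto intro: alg_poly_add alg_poly_const)

lemma alg_poly_prod: "(\<And>i. i \<in> A \<Longrightarrow> alg_poly (f i)) \<Longrightarrow> alg_poly (\<lambda>\<mu>. \<Prod>i\<in>A. f i \<mu>)"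
  by (induction A rule: infinite_finite_induct) (auto intro: alg_poly_mult alg_poly_const)

lemma alg_poly_vec_const: "alg_poly_vec (\<lambda>\<mu>. v)"
  by (simp add: alg_poly_vec_def alg_poly_const)

lemma alg_poly_vec_add: "alg_poly_vec F \<Longrightarrow> alg_poly_vec G \<Longrightarrow> alg_poly_vec (\<lambda>\<mu>. F \<mu> + G \<mu>)"
  by (simp add: alg_poly_vec_def alg_poly_add)

lemma alg_poly_vec_nth: "alg_poly_vec F \<Longrightarrow> alg_poly (\<lambda>\<mu>. F \<mu> $ k)"
  by (simp add: alg_poly_vec_def)

lemma alg_poly_vec_mult:
  assumes "alg_poly_vec F" "alg_poly_vec G"
  shows "alg_poly_vec (\<lambda>\<mu>. \<mu> (F \<mu>) (G \<mu>))"
  unfolding alg_poly_vec_def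
proof
  fix k
  have "alg_poly (\<lambda>\<mu>. \<Sum>i\<in>UNIV. \<Sum>j\<in>UNIV. F \<mu> $ i * G \<mu> $ j * \<mu> (axis i 1) (axis j 1) $ k)"
    using assms
    by (intro alg_poly_sum alg_poly_mult alg_poly_poly[OF poly_fun.coord])
      (auto simp: alg_poly_vec_def)
  moreover have "\<mu> (F \<mu>) (G \<mu>) $ k
      = (\<Sum>i\<in>UNIV. \<Sum>j\<in>UNIV. F \<mu> $ i * G \<mu> $ j * \<mu> (axis i 1) (axis j 1) $ k)"
    if "is_algebra \<mu>" for \<mu>
    by (rule alg_expand[OF that])
  ultimately show "alg_poly (\<lambda>\<mu>. \<mu> (F \<mu>) (G \<mu>) $ k)"
    unfolding alg_poly_def by fastforce
qed

lemma alg_poly_vec_matrix: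
  assumes "alg_poly_vec F" shows "alg_poly_vec (\<lambda>\<mu>. h *v F \<mu>)"
  using assms unfolding alg_poly_vec_def matrix_vector_mult_def
  by (auto intro!: alg_poly_sum alg_poly_mult alg_poly_const)

lemmas alg_poly_intros = alg_poly_const alg_poly_add alg_poly_mult alg_poly_minus alg_poly_diff
  alg_poly_power alg_poly_sum alg_poly_prod alg_poly_vec_const alg_poly_vec_add alg_poly_vec_nth
  alg_poly_vec_mult

text \<open>For fixed h the action is linear in \<mu>, so polynomials pull back to polynomials;
  transitivity of degeneration rests on this.\<close>

lemma alg_poly_act:
  assumes "poly_fun p" shows "alg_poly (\<lambda>\<mu>. p (act h \<mu>))"
  using assms
proof induction
  case (coord i j k)
  have "alg_poly_vec (\<lambda>\<mu>. h *v \<mu> (matrix_inv h *v axis i 1) (matrix_inv h *v axis j 1))"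
    by (rule alg_poly_vec_matrix[OF alg_poly_vec_mult[OF alg_poly_vec_const alg_poly_vec_const]])
  then show ?case
    by (simp add: act_def alg_poly_vec_def)
qed (auto intro: alg_poly_intros)

subsection \<open>Degeneration\<close>

text \<open>The common zeros of all polynomials vanishing on the orbit form the smallest closed set
  around it, so the hull can be tested by single polynomials.\<close>

lemma degenerates_iff:
  assumes "is_algebra \<mu>"
  shows "\<mu> \<leadsto> \<nu> \<longleftrightarrow>
    is_algebra \<nu> \<and> (\<forall>p. poly_fun p \<longrightarrow> (\<forall>\<rho>\<in>orbit \<mu>. p \<rho> = 0) \<longrightarrow> p \<nu> = 0)"
proof
  let ?Z = "{\<nu>. is_algebra \<nu> \<and> (\<forall>p\<in>{p. poly_fun p \<and> (\<forall>\<rho>\<in>orbit \<mu>. p \<rho> = 0)}. p \<nu> = 0)}"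
  assume "\<mu> \<leadsto> \<nu>"
  moreover have "zariski_closed ?Z"
    unfolding zariski_closed_def
    by (rule exI[of _ "{p. poly_fun p \<and> (\<forall>\<rho>\<in>orbit \<mu>. p \<rho> = 0)}"]) simp
  moreover have "orbit \<mu> \<subseteq> ?Z"
    using assms by (auto simp: orbit_iff)
  ultimately have "\<nu> \<in> ?Z"
    unfolding degenerates_def hull_def by blast
  then show "is_algebra \<nu> \<and> (\<forall>p. poly_fun p \<longrightarrow> (\<forall>\<rho>\<in>orbit \<mu>. p \<rho> = 0) \<longrightarrow> p \<nu> = 0)"
    by blast
next
  assume *: "is_algebra \<nu> \<and> (\<forall>p. poly_fun p \<longrightarrow> (\<forall>\<rho>\<in>orbit \<mu>. p \<rho> = 0) \<longrightarrow> p \<nu> = 0)"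
  show "\<mu> \<leadsto> \<nu>"
    unfolding degenerates_def hull_def
  proof (rule InterI)
    fix S assume "S \<in> {t. zariski_closed t \<and> orbit \<mu> \<subseteq> t}"
    then obtain P where P: "\<forall>p\<in>P. poly_fun p" "S = {\<mu>. is_algebra \<mu> \<and> (\<forall>p\<in>P. p \<mu> = 0)}"
      and sub: "orbit \<mu> \<subseteq> S"
      by (auto simp: zariski_closed_def)
    have "p \<nu> = 0" if "p \<in> P" for p
    proof -
      have "\<forall>\<rho>\<in>orbit \<mu>. p \<rho> = 0"
        using sub P(2) that by (metis (mono_tags, lifting) mem_Collect_eq subsetD)
      then show ?thesis
        using * P(1) that by (elim conjE allE[of _ p]) simp
    qed
    then show "\<nu> \<in> S"
      using * P(2) by simp
  qed
qed

lemma degenerates_algebra: "is_algebra \<mu> \<Longrightarrow> \<mu> \<leadsto> \<nu> \<Longrightarrow> is_algebra \<nu>"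
  by (simp add: degenerates_iff)

lemma degenerates_alg_poly:
  assumes "is_algebra \<mu>" "\<mu> \<leadsto> \<nu>" "alg_poly p"
    and van: "\<And>\<rho>. is_algebra \<rho> \<Longrightarrow> \<mu> \<cong>\<^sub>a \<rho> \<Longrightarrow> p \<rho> = 0"
  shows "p \<nu> = 0"
proof -
  obtain q where q: "poly_fun q" "\<And>\<rho>. is_algebra \<rho> \<Longrightarrow> p \<rho> = q \<rho>"
    using assms(3) by (auto simp: alg_poly_def)
  have "\<forall>\<rho>\<in>orbit \<mu>. q \<rho> = 0"
    using van q(2) by (auto simp: orbit_iff[OF assms(1)])
  then show ?thesis
    using assms(1,2) q by (auto simp: degenerates_iff)
qed

lemma iso_degenerates: "is_algebra \<mu> \<Longrightarrow> is_algebra \<nu> \<Longrightarrow> \<mu> \<cong>\<^sub>a \<nu> \<Longrightarrow> \<mu> \<leadsto> \<nu>"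
  by (simp add: degenerates_iff orbit_iff)

text \<open>If p vanishes on the orbit of \<mu>, so does its pullback along \<open>act h\<close>,
  because the orbit is stable under h. Hence the pullback vanishes at \<nu>, and p vanishes on the
  whole orbit of \<nu>.\<close>

lemma degenerates_trans:
  assumes alg: "is_algebra \<mu>" and "\<mu> \<leadsto> \<nu>" "\<nu> \<leadsto> \<rho>"
  shows "\<mu> \<leadsto> \<rho>"
proof -
  have nu: "is_algebra \<nu>"
    using assms degenerates_algebra by blast
  have "p \<rho> = 0" if p: "poly_fun p" and van: "\<And>\<sigma>. \<sigma> \<in> orbit \<mu> \<Longrightarrow> p \<sigma> = 0" for p
  proof -
    have "p (act h \<nu>) = 0" if inv: "invertible h" for h
    proof (rule degenerates_alg_poly[OF alg \<open>\<mu> \<leadsto> \<nu>\<close> alg_poly_act[OF p]])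
      fix \<sigma> assume \<sigma>: "is_algebra \<sigma>" "\<mu> \<cong>\<^sub>a \<sigma>"
      then have "act h \<sigma> \<in> orbit \<sigma>"
        using inv by (auto simp: orbit_def)
      then have "act h \<sigma> \<in> orbit \<mu>"
        using \<sigma> alg iso_trans by (auto simp: orbit_iff)
      then show "p (act h \<sigma>) = 0" by (rule van)
    qed
    then have "\<forall>\<sigma>\<in>orbit \<nu>. p \<sigma> = 0"
      by (auto simp: orbit_def)
    then show ?thesis
      using \<open>\<nu> \<leadsto> \<rho>\<close> nu p by (simp add: degenerates_iff)
  qed
  then show ?thesis
    using assms nu by (simp add: degenerates_iff)
qed

text \<open>Limits in the ordinary topology lie in the Zariski closure: a polynomial that vanishes
  along the family for t \<noteq> 0 vanishes at 0 by continuity.\<close>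

lemma degenerates_limit:
  fixes F :: "complex \<Rightarrow> 'n::finite mult"
  assumes "is_algebra \<mu>" "\<And>t. is_algebra (F t)" "\<And>t. t \<noteq> 0 \<Longrightarrow> \<mu> \<cong>\<^sub>a F t"
    and cont: "\<And>i j k. isCont (\<lambda>t. F t (axis i 1) (axis j 1) $ k) 0"
  shows "\<mu> \<leadsto> F 0"
proof -
  have "p (F 0) = 0" if p: "poly_fun p" and van: "\<forall>\<rho>\<in>orbit \<mu>. p \<rho> = 0" for p
  proof -
    have "isCont (\<lambda>t. p (F t)) 0"
      using p by induction (auto intro!: continuous_intros cont)
    moreover have "\<forall>\<^sub>F t in at 0. p (F t) = 0"
      using van assms(1-3) by (auto simp: eventually_at_filter orbit_iff)
    ultimately show ?thesis
      by (metis isCont_def tendsto_eventually tendsto_unique trivial_limit_at)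
  qed
  then show ?thesis
    using assms(1,2) by (simp add: degenerates_iff)
qed

subsection \<open>Four-dimensional anticommutative algebras\<close>

lemma ee_nth [simp]:
  "ee 1 $ 1 = 1" "ee 1 $ 2 = 0" "ee 1 $ 3 = 0" "ee 1 $ 4 = 0"
  "ee 2 $ 1 = 0" "ee 2 $ 2 = 1" "ee 2 $ 3 = 0" "ee 2 $ 4 = 0"
  "ee 3 $ 1 = 0" "ee 3 $ 2 = 0" "ee 3 $ 3 = 1" "ee 3 $ 4 = 0"
  "ee 4 $ 1 = 0" "ee 4 $ 2 = 0" "ee 4 $ 3 = 0" "ee 4 $ 4 = 1"
  by (simp_all add: axis_def)

lemma vec4_eq_iff:
  fixes x y :: "complex ^ 4"
  shows "x = y \<longleftrightarrow> x $ 1 = y $ 1 \<and> x $ 2 = y $ 2 \<and> x $ 3 = y $ 3 \<and> x $ 4 = y $ 4"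
  by (simp add: vec_eq_iff forall_4)

lemma table_simps:
  "table [] x y = 0"
  "table ((i, j, v) # ps) x y = (x $ i * y $ j - x $ j * y $ i) *s v + table ps x y"
  by (simp_all add: table_def)

lemma table_algebra: "is_algebra (table ps)"
proof (induction ps)
  case (Cons p ps)
  then show ?case
    by (cases p) (auto simp: is_algebra_iff table_simps vec_eq_iff algebra_simps)
qed (simp add: is_algebra_iff table_simps)

lemma table_self: "table ps x x = 0"
  by (induction ps) (auto simp: table_simps)

definition alg4 ::
  "complex ^ 4 \<Rightarrow> complex ^ 4 \<Rightarrow> complex ^ 4 \<Rightarrow> complex ^ 4 \<Rightarrow> complex ^ 4 \<Rightarrow> complex ^ 4 \<Rightarrow> 4 mult"
  where "alg4 a b c d e f =
    table [(1, 2, a), (1, 3, b), (1, 4, c), (2, 3, d), (2, 4, e), (3, 4, f)]"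

lemma alg4_apply:
  "alg4 a b c d e f x y =
     (x $ 1 * y $ 2 - x $ 2 * y $ 1) *s a + (x $ 1 * y $ 3 - x $ 3 * y $ 1) *s b +
     (x $ 1 * y $ 4 - x $ 4 * y $ 1) *s c + (x $ 2 * y $ 3 - x $ 3 * y $ 2) *s d +
     (x $ 2 * y $ 4 - x $ 4 * y $ 2) *s e + (x $ 3 * y $ 4 - x $ 4 * y $ 3) *s f"
  by (simp add: alg4_def table_simps add.assoc)

lemma alg4_algebra: "is_algebra (alg4 a b c d e f)" and alg4_self: "alg4 a b c d e f x x = 0"
  by (simp_all add: alg4_def table_algebra table_self)

lemma anticomm:
  assumes "is_algebra \<mu>" "\<And>x. \<mu> x x = 0"
  shows "\<mu> x y = - \<mu> y x"
proof -
  have "0 = \<mu> (x + y) (x + y)"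
    by (simp only: assms(2))
  also have "\<dots> = \<mu> x x + \<mu> x y + (\<mu> y x + \<mu> y y)"
    by (simp only: alg_add_left[OF assms(1)] alg_add_right[OF assms(1)] add_ac)
  finally have "\<mu> x y + \<mu> y x = 0"
    by (simp add: assms(2))
  then show ?thesis
    by (simp add: eq_neg_iff_add_eq_0)
qed

section \<open>Structure constants with respect to an arbitrary basis\<close>

definition comb ::
  "complex ^ 4 \<Rightarrow> complex ^ 4 \<Rightarrow> complex ^ 4 \<Rightarrow> complex ^ 4 \<Rightarrow> complex ^ 4 \<Rightarrow> complex ^ 4" where
  "comb a b c d x = x $ 1 *s a + x $ 2 *s b + x $ 3 *s c + x $ 4 *s d"

definition basis4 :: "complex ^ 4 \<Rightarrow> complex ^ 4 \<Rightarrow> complex ^ 4 \<Rightarrow> complex ^ 4 \<Rightarrow> bool" where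
  "basis4 a b c d \<longleftrightarrow> (\<forall>x. comb a b c d x = 0 \<longrightarrow> x = 0)"

lemma lin_comb: "lin (comb a b c d)"
  by (auto simp: lin_iff comb_def vec_eq_iff algebra_simps)

lemma basis4_bij: "basis4 a b c d \<Longrightarrow> bij (comb a b c d)"
  unfolding basis4_def bij_def
  using vec.linear_inj_iff_eq_0[OF lin_comb] vec.linear_inj_imp_surj[OF lin_comb] by blast

lemma comb_surj: "basis4 a b c d \<Longrightarrow> \<exists>x. v = comb a b c d x"
  using basis4_bij by (metis bij_pointE)

lemma alg_comb:
  assumes "is_algebra \<mu>" "\<And>x. \<mu> x x = 0"
  shows "\<mu> (comb u v w z x) (comb u v w z y) =
     (x $ 1 * y $ 2 - x $ 2 * y $ 1) *s \<mu> u v + (x $ 1 * y $ 3 - x $ 3 * y $ 1) *s \<mu> u w +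
     (x $ 1 * y $ 4 - x $ 4 * y $ 1) *s \<mu> u z + (x $ 2 * y $ 3 - x $ 3 * y $ 2) *s \<mu> v w +
     (x $ 2 * y $ 4 - x $ 4 * y $ 2) *s \<mu> v z + (x $ 3 * y $ 4 - x $ 4 * y $ 3) *s \<mu> w z"
proof -
  note ac = anticomm[OF assms, of v u] anticomm[OF assms, of w u] anticomm[OF assms, of z u]
    anticomm[OF assms, of w v] anticomm[OF assms, of z v] anticomm[OF assms, of z w]
  show ?thesis
    unfolding comb_def by (simp add: alg_simps[OF assms(1)] assms(2) ac vec_eq_iff algebra_simps)
qed

lemma alg4_hom:
  assumes "is_algebra \<mu>" "\<And>x. \<mu> x x = 0"
    and "\<mu> u v = comb u v w z a" "\<mu> u w = comb u v w z b" "\<mu> u z = comb u v w z c"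
    "\<mu> v w = comb u v w z d" "\<mu> v z = comb u v w z e" "\<mu> w z = comb u v w z f"
  shows "comb u v w z (alg4 a b c d e f x y) = \<mu> (comb u v w z x) (comb u v w z y)"
  unfolding alg_comb[OF assms(1,2)] assms(3-)
  by (simp add: alg4_apply comb_def vec_eq_iff algebra_simps)

lemma alg4_iso:
  assumes "is_algebra \<mu>" "\<And>x. \<mu> x x = 0" "basis4 u v w z"
    and "\<mu> u v = comb u v w z a" "\<mu> u w = comb u v w z b" "\<mu> u z = comb u v w z c"
    "\<mu> v w = comb u v w z d" "\<mu> v z = comb u v w z e" "\<mu> w z = comb u v w z f"
  shows "\<mu> \<cong>\<^sub>a alg4 a b c d e f"
proof (rule iso_sym)
  have "comb u v w z (alg4 a b c d e f x y) = \<mu> (comb u v w z x) (comb u v w z y)" for x y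
    using alg4_hom[of \<mu>] assms by blast
  then show "alg4 a b c d e f \<cong>\<^sub>a \<mu>"
    unfolding algebra_iso_def using lin_comb basis4_bij[OF assms(3)] by blast
qed

lemma iso_alg4:
  assumes "is_algebra \<mu>" "\<And>x. \<mu> x x = 0" "basis4 u v w z"
  obtains a b c d e f where "\<mu> \<cong>\<^sub>a alg4 a b c d e f"
    and "\<mu> u v = comb u v w z a" "\<mu> u w = comb u v w z b" "\<mu> u z = comb u v w z c"
    "\<mu> v w = comb u v w z d" "\<mu> v z = comb u v w z e" "\<mu> w z = comb u v w z f"
proof -
  obtain a where a: "\<mu> u v = comb u v w z a"
    using comb_surj[OF assms(3), of "\<mu> u v"] by (elim exE)
  obtain b where b: "\<mu> u w = comb u v w z b"
    using comb_surj[OF assms(3), of "\<mu> u w"] by (elim exE)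
  obtain c where c: "\<mu> u z = comb u v w z c"
    using comb_surj[OF assms(3), of "\<mu> u z"] by (elim exE)
  obtain d where d: "\<mu> v w = comb u v w z d"
    using comb_surj[OF assms(3), of "\<mu> v w"] by (elim exE)
  obtain e where e: "\<mu> v z = comb u v w z e"
    using comb_surj[OF assms(3), of "\<mu> v z"] by (elim exE)
  obtain f where f: "\<mu> w z = comb u v w z f"
    using comb_surj[OF assms(3), of "\<mu> w z"] by (elim exE)
  have "\<mu> \<cong>\<^sub>a alg4 a b c d e f"
    by (rule alg4_iso) (fact assms a b c d e f)+
  from that[OF this a b c d e f] show thesis .
qed

lemma types_alg4:
  "C4 = alg4 0 0 0 0 0 0"
  "n3_C = alg4 (ee 3) 0 0 0 0 0"
  "n4 = alg4 (ee 3) (ee 4) 0 0 0 0"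
  "r2_C2 = alg4 (ee 2) 0 0 0 0 0"
  "r2_r2 = alg4 (ee 2) 0 0 0 0 (ee 4)"
  "sl2_C = alg4 (ee 2) (- ee 3) 0 (ee 1) 0 0"
  "g1 = alg4 (ee 2) (ee 3) (ee 4) 0 0 0"
  "g2 \<beta> = alg4 (ee 2) (ee 3) (ee 3 + \<beta> *s ee 4) 0 0 0"
  "g3 \<beta> = alg4 (ee 2) (ee 3) (\<beta> *s ee 4) (ee 4) 0 0"
  "g4 \<alpha> \<beta> = alg4 (ee 2) (ee 2 + \<alpha> *s ee 3) (ee 3 + \<beta> *s ee 4) 0 0 0"
  "g5 \<alpha> = alg4 (ee 2) (ee 2 + \<alpha> *s ee 3) ((\<alpha> + 1) *s ee 4) (ee 4) 0 0"
  "g6 = alg4 (ee 3) 0 0 0 0 (ee 3)"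
  unfolding C4_def n3_C_def n4_def r2_C2_def r2_r2_def sl2_C_def g1_def g2_def g3_def g4_def g5_def
    g6_def
  by (simp_all add: fun_eq_iff table_simps alg4_apply vec4_eq_iff)

lemma types_algebra:
  "is_algebra C4" "is_algebra n3_C" "is_algebra n4" "is_algebra r2_C2" "is_algebra r2_r2"
  "is_algebra sl2_C" "is_algebra g1" "is_algebra (g2 \<beta>)" "is_algebra (g3 \<beta>)"
  "is_algebra (g4 \<alpha> \<beta>)" "is_algebra (g5 \<alpha>)" "is_algebra g6"
  by (simp_all only: types_alg4 alg4_algebra)

text \<open>The moving basis may become dependent at t = 0; only its structure constants
  \<open>a t\<close>, ..., \<open>f t\<close> need a limit there.\<close>

lemma alg4_limit:
  fixes u v w z a b c d e f :: "complex \<Rightarrow> complex ^ 4"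
  assumes "is_algebra \<mu>" "\<And>x. \<mu> x x = 0"
    and "\<And>t. t \<noteq> 0 \<Longrightarrow> basis4 (u t) (v t) (w t) (z t)"
    and "\<And>t. t \<noteq> 0 \<Longrightarrow> \<mu> (u t) (v t) = comb (u t) (v t) (w t) (z t) (a t)"
    and "\<And>t. t \<noteq> 0 \<Longrightarrow> \<mu> (u t) (w t) = comb (u t) (v t) (w t) (z t) (b t)"
    and "\<And>t. t \<noteq> 0 \<Longrightarrow> \<mu> (u t) (z t) = comb (u t) (v t) (w t) (z t) (c t)"
    and "\<And>t. t \<noteq> 0 \<Longrightarrow> \<mu> (v t) (w t) = comb (u t) (v t) (w t) (z t) (d t)"
    and "\<And>t. t \<noteq> 0 \<Longrightarrow> \<mu> (v t) (z t) = comb (u t) (v t) (w t) (z t) (e t)"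
    and "\<And>t. t \<noteq> 0 \<Longrightarrow> \<mu> (w t) (z t) = comb (u t) (v t) (w t) (z t) (f t)"
    and cont: "\<And>k. isCont (\<lambda>t. a t $ k) 0" "\<And>k. isCont (\<lambda>t. b t $ k) 0"
      "\<And>k. isCont (\<lambda>t. c t $ k) 0" "\<And>k. isCont (\<lambda>t. d t $ k) 0"
      "\<And>k. isCont (\<lambda>t. e t $ k) 0" "\<And>k. isCont (\<lambda>t. f t $ k) 0"
  shows "\<mu> \<leadsto> alg4 (a 0) (b 0) (c 0) (d 0) (e 0) (f 0)"
proof (rule degenerates_limit[where \<mu> = \<mu>, OF assms(1), where F = "\<lambda>t. alg4 (a t) (b t) (c t) (d t) (e t) (f t)"])
  fix t :: complex assume t: "t \<noteq> 0"
  show "\<mu> \<cong>\<^sub>a alg4 (a t) (b t) (c t) (d t) (e t) (f t)"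
    by (rule alg4_iso, rule assms(1), rule assms(2), rule assms(3)[OF t], rule assms(4)[OF t],
        rule assms(5)[OF t], rule assms(6)[OF t], rule assms(7)[OF t], rule assms(8)[OF t],
        rule assms(9)[OF t])
next
  fix i j k
  show "isCont (\<lambda>t. alg4 (a t) (b t) (c t) (d t) (e t) (f t) (ee i) (ee j) $ k) 0"
    unfolding alg4_apply vector_add_component vector_smult_component
    by (intro isCont_add isCont_mult continuous_const cont)
qed (rule alg4_algebra)

lemmas alg4_limit' = alg4_limit[OF alg4_algebra alg4_self]
lemmas alg4_iso' = alg4_iso[OF alg4_algebra alg4_self]
lemmas alg4_compute = alg4_apply basis4_def comb_def vec4_eq_iff

subsection \<open>Companion forms\<close>

text \<open>In \<open>companion s1 s2 s3\<close> the element \<open>e\<^sub>1\<close> acts on an abelian ideal by the companion matrix of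
  \<open>t\<^sup>3 - s1 t\<^sup>2 + s2 t - s3\<close>; \<open>heisenberg_companion m1 m2\<close> has a Heisenberg ideal instead, and \<open>e\<^sub>1\<close> acts on it modulo
  its centre by the companion matrix of \<open>t\<^sup>2 - m1 t + m2\<close>. In these forms an isomorphism that
  permutes or rescales the eigenvalues is a mere rescaling of the coefficients.\<close>

definition companion :: "complex \<Rightarrow> complex \<Rightarrow> complex \<Rightarrow> 4 mult" where
  "companion s1 s2 s3 = alg4 (ee 3) (ee 4) (s3 *s ee 2 - s2 *s ee 3 + s1 *s ee 4) 0 0 0"

definition heisenberg_companion :: "complex \<Rightarrow> complex \<Rightarrow> 4 mult" where
  "heisenberg_companion m1 m2 = alg4 (ee 3) (m1 *s ee 3 - m2 *s ee 2) (m1 *s ee 4) (ee 4) 0 0"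

text \<open>Here y is a cyclic vector for the left multiplication by x on the abelian ideal spanned
  by y, xy, x(xy), and \<open>s1\<close>, \<open>s2\<close>, \<open>s3\<close> are the elementary
  symmetric functions of its eigenvalues there.\<close>

lemma iso_companion:
  assumes "is_algebra \<mu>" "\<And>x. \<mu> x x = 0" "basis4 x y (\<mu> x y) (\<mu> x (\<mu> x y))"
    and "\<mu> x (\<mu> x (\<mu> x y)) = s3 *s y - s2 *s \<mu> x y + s1 *s \<mu> x (\<mu> x y)"
    and "\<mu> y (\<mu> x y) = 0" "\<mu> y (\<mu> x (\<mu> x y)) = 0" "\<mu> (\<mu> x y) (\<mu> x (\<mu> x y)) = 0"
  shows "\<mu> \<cong>\<^sub>a companion s1 s2 s3"
  unfolding companion_def
  by (rule alg4_iso, rule assms(1), rule assms(2), rule assms(3)) (simp_all add: assms(4-) comb_def)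

lemma iso_heisenberg_companion:
  assumes "is_algebra \<mu>" "\<And>x. \<mu> x x = 0" "basis4 x y (\<mu> x y) (\<mu> y (\<mu> x y))"
    and "\<mu> x (\<mu> x y) = m1 *s \<mu> x y - m2 *s y" "\<mu> x (\<mu> y (\<mu> x y)) = m1 *s \<mu> y (\<mu> x y)"
    and "\<mu> y (\<mu> y (\<mu> x y)) = 0" "\<mu> (\<mu> x y) (\<mu> y (\<mu> x y)) = 0"
  shows "\<mu> \<cong>\<^sub>a heisenberg_companion m1 m2"
  unfolding heisenberg_companion_def
  by (rule alg4_iso, rule assms(1), rule assms(2), rule assms(3)) (simp_all add: assms(4-) comb_def)

lemmas iso_companion' = iso_companion[OF alg4_algebra alg4_self]
lemmas iso_heisenberg_companion' = iso_heisenberg_companion[OF alg4_algebra alg4_self]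

text \<open>Replacing e1 by l e1 multiplies the three roots by l, hence their elementary symmetric
  functions by the first three powers of l.\<close>

lemma companion_scale:
  assumes "l \<noteq> 0" shows "companion s1 s2 s3 \<cong>\<^sub>a companion (l * s1) (l ^ 2 * s2) (l ^ 3 * s3)"
  unfolding companion_def[of s1 s2 s3] by (rule iso_companion'[where x = "l *s ee 1" and y = "ee 2"])
    (use assms in \<open>auto simp: alg4_compute power2_eq_square power3_eq_cube\<close>)

lemma heisenberg_companion_scale:
  assumes "l \<noteq> 0" shows "heisenberg_companion m1 m2 \<cong>\<^sub>a heisenberg_companion (l * m1) (l ^ 2 * m2)"
  unfolding heisenberg_companion_def[of m1 m2] by (rule iso_heisenberg_companion'[where x = "l *s ee 1" and y = "ee 2"])
    (use assms in \<open>auto simp: alg4_compute power2_eq_square\<close>)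

text \<open>On the ideal, e1 is triangular with diagonal 1, a, b and with entries 1 next to the
  diagonal, so e4 is cyclic whatever the parameters are. The symmetry of the coefficients in 1, a, b
  accounts for the permutations of the proportion.\<close>

lemma g4_companion: "g4 a b \<cong>\<^sub>a companion (1 + a + b) (a + b + a * b) (a * b)"
  unfolding types_alg4
  by (rule iso_companion'[where x = "ee 1" and y = "ee 4"])
    (auto simp: alg4_compute algebra_simps)

lemma g5_heisenberg_companion: "g5 a \<cong>\<^sub>a heisenberg_companion (1 + a) a"
  unfolding types_alg4
  by (rule iso_heisenberg_companion'[where x = "ee 1" and y = "ee 3"])
    (auto simp: alg4_compute algebra_simps)

lemma companion_0: "companion 0 0 0 = n4"
  by (simp add: companion_def types_alg4)

lemma companion_algebra: "is_algebra (companion s1 s2 s3)"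
  by (simp add: companion_def alg4_algebra)

subsection \<open>The listed degenerations\<close>

text \<open>Shrinking the ideal spanned by e2, e3, e4 by a factor t keeps the action of e1 and
  multiplies the products inside the ideal by t. In the limit the ideal is abelian.\<close>

lemma alg4_contract:
  assumes "a $ 1 = 0" "b $ 1 = 0" "c $ 1 = 0" "d $ 1 = 0" "e $ 1 = 0" "f $ 1 = 0"
  shows "alg4 a b c d e f \<leadsto> alg4 a b c 0 0 0"
proof -
  \<comment> \<open>The zero factors stay unreduced so that each limit is visibly the value at 0 of
    a coefficient such as \<open>t *s d\<close>. The explicit limits below use the same
    device.\<close>
  have "alg4 a b c d e f \<leadsto> alg4 a b c (0 *s d) (0 *s e) (0 *s f)"
    unfolding types_alg4
    by (rule alg4_limit'[where u = "\<lambda>t. ee 1" and v = "\<lambda>t. t *s ee 2" and w = "\<lambda>t. t *s ee 3"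
          and z = "\<lambda>t. t *s ee 4"])
      (auto simp: alg4_algebra alg4_self alg4_compute assms)
  then show ?thesis by simp
qed

lemma degenerates_iso:
  "is_algebra \<mu> \<Longrightarrow> is_algebra \<rho> \<Longrightarrow> \<mu> \<leadsto> \<nu> \<Longrightarrow> \<nu> \<cong>\<^sub>a \<rho> \<Longrightarrow> \<mu> \<leadsto> \<rho>"
  by (meson degenerates_algebra degenerates_trans iso_degenerates)

lemma iso_degenerates_trans:
  "is_algebra \<mu> \<Longrightarrow> is_algebra \<nu> \<Longrightarrow> \<mu> \<cong>\<^sub>a \<nu> \<Longrightarrow> \<nu> \<leadsto> \<rho> \<Longrightarrow> \<mu> \<leadsto> \<rho>"
  by (meson degenerates_trans iso_degenerates)

text \<open>Any x outside the ideal spanned by y, xy, x(xy) can play the part of e1 in the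
  contraction. So an edge to \<open>g4\<close> only needs an x with the right eigenvalues and a
  cyclic vector.\<close>

lemma contract_companion:
  assumes "is_algebra \<mu>" "\<And>x. \<mu> x x = 0" "basis4 x y (\<mu> x y) (\<mu> x (\<mu> x y))"
    and "\<mu> x (\<mu> x (\<mu> x y)) = s3 *s y - s2 *s \<mu> x y + s1 *s \<mu> x (\<mu> x y)"
    and "\<mu> y (\<mu> x y) = comb x y (\<mu> x y) (\<mu> x (\<mu> x y)) d" "d $ 1 = 0"
    and "\<mu> y (\<mu> x (\<mu> x y)) = comb x y (\<mu> x y) (\<mu> x (\<mu> x y)) e" "e $ 1 = 0"
    and "\<mu> (\<mu> x y) (\<mu> x (\<mu> x y)) = comb x y (\<mu> x y) (\<mu> x (\<mu> x y)) f" "f $ 1 = 0"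
  shows "\<mu> \<leadsto> companion s1 s2 s3"
proof -
  have "\<mu> \<cong>\<^sub>a alg4 (ee 3) (ee 4) (s3 *s ee 2 - s2 *s ee 3 + s1 *s ee 4) d e f"
    by (rule alg4_iso, rule assms(1), rule assms(2), rule assms(3)) (simp_all add: assms(4-) comb_def)
  moreover have "alg4 (ee 3) (ee 4) (s3 *s ee 2 - s2 *s ee 3 + s1 *s ee 4) d e f \<leadsto> companion s1 s2 s3"
    unfolding companion_def by (rule alg4_contract) (use assms in auto)
  ultimately show ?thesis
    using iso_degenerates_trans[OF assms(1) alg4_algebra] by blast
qed

lemmas contract_companion' = contract_companion[OF alg4_algebra alg4_self]

lemma deg_r2_r2_g5: "r2_r2 \<leadsto> g5 0"
proof -
  have "r2_r2 \<leadsto> alg4 (ee 2) (ee 2) (ee 4) (ee 4) 0 (- (0::complex) *s ee 4)"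
    unfolding types_alg4
    \<comment> \<open>In this basis all products are those of \<open>g5 0\<close> for every t,
      except that the last two vectors multiply to - t times the fourth.\<close>
    by (rule alg4_limit'[where u = "\<lambda>t. ee 1 + ee 3" and v = "\<lambda>t. ee 2 + ee 4"
          and w = "\<lambda>t. ee 2 + ee 4 - t *s ee 3" and z = "\<lambda>t. t *s ee 4" and f = "\<lambda>t. - t *s ee 4"])
      (auto simp: alg4_compute)
  then show ?thesis by (simp add: types_alg4)
qed

lemma deg_sl2_C_g5: "sl2_C \<leadsto> g5 (-1)"
proof -
  have "sl2_C \<leadsto> alg4 (ee 2) (ee 2 - ee 3) 0 (ee 4) ((- ((0::complex)^2)) *s ee 2)
      (((0::complex)^2) *s (ee 3 - ee 2))"
    unfolding types_alg4
    \<comment> \<open>The weights t, t, t^2 turn e2, e3, e1 into a Heisenberg algebra in the limit.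
      The central e4 keeps the first vector independent of the fourth, and the half of e2 produces
      the summand e2 of e1 e3 in \<open>g5 (-1)\<close>.\<close>
    by (rule alg4_limit'[where u = "\<lambda>t. ee 1 + ee 4" and v = "\<lambda>t. t *s ee 2"
          and w = "\<lambda>t. t *s (ee 3 + (1/2) *s ee 2)" and z = "\<lambda>t. (t^2) *s ee 1"
          and e = "\<lambda>t. (- (t^2)) *s ee 2" and f = "\<lambda>t. (t^2) *s (ee 3 - ee 2)"])
      (auto simp: alg4_compute field_simps power2_eq_square)
  then show ?thesis by (simp add: types_alg4)
qed

lemma deg_g5_g4: "g5 a \<leadsto> g4 a (a + 1)"
proof (rule degenerates_iso[OF _ _ _ iso_sym[OF g4_companion]])
  show "g5 a \<leadsto> companion (1 + a + (a + 1)) (a + (a + 1) + a * (a + 1)) (a * (a + 1))"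
    unfolding types_alg4
    \<comment> \<open>Adding e3 to e1 couples e2 with e4, so that e3 is cyclic for every a. The
      vector \<open>a *s ee 2 - (1 + a) *s ee 3 + ee 4\<close> holds the coordinates of - e4 = (L -
      1)(L - a) y, where L is the left multiplication by x.\<close>
    by (rule contract_companion'[where x = "ee 1 + ee 3" and y = "ee 3"
          and d = "a *s ee 2 - (1 + a) *s ee 3 + ee 4"
          and e = "(1 + a) *s (a *s ee 2 - (1 + a) *s ee 3 + ee 4)"
          and f = "a *s (a *s ee 2 - (1 + a) *s ee 3 + ee 4)"])
      (auto simp: alg4_compute algebra_simps)
qed (rule types_algebra)+

lemma deg_g5_g3: "g5 1 \<leadsto> g3 2"
proof -
  have "g5 1 \<leadsto> alg4 (ee 2) ((0::complex) *s ee 2 + ee 3) (2 *s ee 4) (ee 4) 0 0"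
    unfolding types_alg4
    by (rule alg4_limit'[where u = "\<lambda>t. ee 1" and v = "\<lambda>t. ee 2"
          and w = "\<lambda>t. t *s ee 3" and z = "\<lambda>t. t *s ee 4" and b = "\<lambda>t. t *s ee 2 + ee 3"])
      (auto simp: alg4_compute)
  then show ?thesis by (simp add: types_alg4)
qed

text \<open>Rescaling e1 by t sends all eigenvalues to 0, while the companion form keeps its cyclic
  vector. The limit is the regular nilpotent action, that is \<open>companion 0 0 0\<close>.\<close>

lemma deg_g4_n4: "g4 a b \<leadsto> n4"
proof -
  define s1 s2 s3 where "s1 = 1 + a + b" and "s2 = a + b + a * b" and "s3 = a * b"
  have "companion s1 s2 s3 \<leadsto> alg4 (ee 3) (ee 4)
      ((((0::complex)^3) * s3) *s ee 2 - ((0^2) * s2) *s ee 3 + (0 * s1) *s ee 4) 0 0 0"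
    unfolding companion_def by (rule alg4_limit'[where u = "\<lambda>t. t *s ee 1" and v = "\<lambda>t. ee 2"
          and w = "\<lambda>t. t *s ee 3" and z = "\<lambda>t. (t^2) *s ee 4"
          and c = "\<lambda>t. ((t^3) * s3) *s ee 2 - ((t^2) * s2) *s ee 3 + (t * s1) *s ee 4"])
      (auto simp: alg4_compute power2_eq_square power3_eq_cube)
  then have "companion s1 s2 s3 \<leadsto> n4" by (simp add: types_alg4)
  moreover have "g4 a b \<cong>\<^sub>a companion s1 s2 s3"
    unfolding s1_def s2_def s3_def by (rule g4_companion)
  ultimately show ?thesis
    using iso_degenerates_trans[OF types_algebra(10) companion_algebra] by blast
qed

lemma deg_g4_r2_C2: "g4 0 0 \<leadsto> r2_C2"
proof -
  have "g4 0 0 \<leadsto> alg4 (ee 2) 0 ((0::complex) *s ee 3) 0 0 0"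
    unfolding types_alg4
    \<comment> \<open>The vectors e4 - e2 and e3 - e2 form a Jordan chain of e1 for the eigenvalue
      0; scaling its top by t breaks the block in the limit.\<close>
    by (rule alg4_limit'[where u = "\<lambda>t. ee 1" and v = "\<lambda>t. ee 2"
          and w = "\<lambda>t. ee 3 - ee 2" and z = "\<lambda>t. t *s (ee 4 - ee 2)" and c = "\<lambda>t. t *s ee 3"])
      (auto simp: alg4_compute)
  then show ?thesis by (simp add: types_alg4)
qed

lemma deg_g4_g2: "g4 1 b \<leadsto> g2 b"
proof -
  have "g4 1 b \<leadsto> alg4 (ee 2) ((0::complex) *s ee 2 + ee 3) (ee 3 + b *s ee 4) 0 0 0"
    unfolding types_alg4
    by (rule alg4_limit'[where u = "\<lambda>t. ee 1" and v = "\<lambda>t. ee 2"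
          and w = "\<lambda>t. t *s ee 3" and z = "\<lambda>t. t *s ee 4" and b = "\<lambda>t. t *s ee 2 + ee 3"])
      (auto simp: alg4_compute)
  then show ?thesis by (simp add: types_alg4)
qed

lemma deg_g6_r2_C2: "g6 \<leadsto> r2_C2"
proof -
  have "g6 \<leadsto> alg4 (ee 2) 0 0 0 0 ((0::complex) *s ee 2)"
    unfolding types_alg4
    by (rule alg4_limit'[where u = "\<lambda>t. - ee 4" and v = "\<lambda>t. ee 3"
          and w = "\<lambda>t. t *s ee 1" and z = "\<lambda>t. ee 2" and f = "\<lambda>t. t *s ee 2"])
      (auto simp: alg4_compute)
  then show ?thesis by (simp add: types_alg4)
qed

lemma deg_n4_n3_C: "n4 \<leadsto> n3_C"
proof -
  have "n4 \<leadsto> alg4 (ee 3) ((0::complex) *s ee 4) 0 0 0 0"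
    unfolding types_alg4
    by (rule alg4_limit'[where u = "\<lambda>t. ee 1" and v = "\<lambda>t. t *s ee 2"
          and w = "\<lambda>t. t *s ee 3" and z = "\<lambda>t. ee 4" and b = "\<lambda>t. t *s ee 4"])
      (auto simp: alg4_compute)
  then show ?thesis by (simp add: types_alg4)
qed

text \<open>The element e1 + e2 fixes (1 - b) e3 + e4 and sends e3 to e3 + e4. So it already acts on
  the ideal as e1 does in \<open>g2 b\<close>, and contracting the ideal finishes.\<close>

lemma deg_g3_g2: "g3 b \<leadsto> g2 b"
proof -
  let ?d = "(1 - b) *s (ee 3 - (1 - b) *s ee 4)"
  have "g3 b \<cong>\<^sub>a alg4 (ee 2) (ee 3) (ee 3 + b *s ee 4) ?d (ee 3 - (1 - b) *s ee 4) 0"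
    unfolding types_alg4
    by (rule alg4_iso'[where u = "ee 1 + ee 2" and v = "ee 2" and w = "(1 - b) *s ee 3 + ee 4"
          and z = "ee 3"])
      (auto simp: alg4_compute algebra_simps)
  moreover have "alg4 (ee 2) (ee 3) (ee 3 + b *s ee 4) ?d (ee 3 - (1 - b) *s ee 4) 0 \<leadsto> g2 b"
    unfolding types_alg4 by (rule alg4_contract) auto
  ultimately show ?thesis
    using iso_degenerates_trans[OF types_algebra(9) alg4_algebra] by blast
qed

lemma deg_r2_C2_n3_C: "r2_C2 \<leadsto> n3_C"
proof -
  have "r2_C2 \<leadsto> alg4 (ee 3) ((0::complex) *s ee 3) 0 0 0 0"
    unfolding types_alg4
    by (rule alg4_limit'[where u = "\<lambda>t. t *s ee 1" and v = "\<lambda>t. ee 2 + ee 3"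
          and w = "\<lambda>t. t *s ee 2" and z = "\<lambda>t. ee 4" and b = "\<lambda>t. t *s ee 3"])
      (auto simp: alg4_compute)
  then show ?thesis by (simp add: types_alg4)
qed

lemma deg_g2_n3_C: "g2 b \<leadsto> n3_C"
proof -
  have "g2 b \<leadsto> alg4 (ee 3) (((0::complex) * (1 + b)) *s ee 3 - ((0^2) * b) *s ee 2) ((0::complex) *s ee 4) 0 0 0"
    unfolding types_alg4
    by (rule alg4_limit'[where u = "\<lambda>t. t *s ee 1" and v = "\<lambda>t. ee 4"
          and w = "\<lambda>t. t *s (ee 3 + b *s ee 4)" and z = "\<lambda>t. ee 2"
          and b = "\<lambda>t. (t * (1 + b)) *s ee 3 - ((t^2) * b) *s ee 2" and c = "\<lambda>t. t *s ee 4"])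
      (auto simp: alg4_compute algebra_simps power2_eq_square)
  then show ?thesis by (simp add: types_alg4)
qed

lemma deg_g2_g1: "g2 1 \<leadsto> g1"
proof -
  have "g2 1 \<leadsto> alg4 (ee 2) (ee 3) ((0::complex) *s ee 3 + ee 4) 0 0 0"
    unfolding types_alg4
    by (rule alg4_limit'[where u = "\<lambda>t. ee 1" and v = "\<lambda>t. ee 2"
          and w = "\<lambda>t. ee 3" and z = "\<lambda>t. t *s ee 4" and c = "\<lambda>t. t *s ee 3 + ee 4"])
      (auto simp: alg4_compute)
  then show ?thesis by (simp add: types_alg4)
qed

lemma deg_n3_C_C4: "n3_C \<leadsto> C4"
proof -
  have "n3_C \<leadsto> alg4 ((0::complex) *s ee 3) 0 0 0 0 0"
    unfolding types_alg4
    by (rule alg4_limit'[where u = "\<lambda>t. ee 1" and v = "\<lambda>t. t *s ee 2"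
          and w = "\<lambda>t. ee 3" and z = "\<lambda>t. ee 4" and a = "\<lambda>t. t *s ee 3"])
      (auto simp: alg4_compute)
  then show ?thesis by (simp add: types_alg4)
qed

lemma deg_g1_C4: "g1 \<leadsto> C4"
proof -
  have "g1 \<leadsto> alg4 ((0::complex) *s ee 2) ((0::complex) *s ee 3) ((0::complex) *s ee 4) 0 0 0"
    unfolding types_alg4
    by (rule alg4_limit'[where u = "\<lambda>t. t *s ee 1" and v = "\<lambda>t. ee 2"
          and w = "\<lambda>t. ee 3" and z = "\<lambda>t. ee 4" and a = "\<lambda>t. t *s ee 2"
          and b = "\<lambda>t. t *s ee 3" and c = "\<lambda>t. t *s ee 4"])
      (auto simp: alg4_compute)
  then show ?thesis by (simp add: types_alg4)
qed

lemma g4_swap: "g4 a b \<cong>\<^sub>a g4 b a"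
  using iso_trans[OF g4_companion[of a b]] iso_sym[OF g4_companion[of b a]] by (simp add: ac_simps)

lemma deg_r2_r2_g4: "r2_r2 \<leadsto> g4 a 0"
proof (cases "a = 1")
  case True
  have "r2_r2 \<leadsto> g4 0 (0 + 1)"
    by (rule degenerates_trans[OF types_algebra(5) deg_r2_r2_g5 deg_g5_g4])
  then show ?thesis
    using degenerates_iso[OF _ _ _ g4_swap[of 0 1]] True by (simp add: types_algebra)
next
  case False
  \<comment> \<open>For a = 1 the basis chosen below collapses, since xy and x(xy) coincide; that
    case went through \<open>g5 0\<close> instead.\<close>
  have zero1: "p = 0" if "p + q = 0" "- p = a * q" for p q
  proof -
    have "(a - 1) * p = 0" using that by algebra
    then show ?thesis using False by simp
  qed
  have zero2: "q = 0" if "p + q = 0" "- p = q * a" for p q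
  proof -
    have "(a - 1) * q = 0" using that by algebra
    then show ?thesis using False by simp
  qed
  show ?thesis
  proof (rule degenerates_iso[OF _ _ _ iso_sym[OF g4_companion]])
    show "r2_r2 \<leadsto> companion (1 + a + 0) (a + 0 + a * 0) (a * 0)"
      unfolding types_alg4
    \<comment> \<open>Here xy = e2 - e4 and x(xy) = e2 - a e4, so x acts with eigenvalues 1, a, 0.
      The coordinates \<open>d\<close> and \<open>e\<close> represent - e4 and - a e4.\<close>
    by (rule contract_companion'[where x = "ee 1 + a *s ee 3 + ee 4" and y = "ee 2 + ee 3"
          and d = "(1 / (1 - a)) *s (ee 3 - ee 4)" and e = "(a / (1 - a)) *s (ee 3 - ee 4)" and f = 0])
       (use False in \<open>auto simp: alg4_compute divide_simps\<close>,
         ((rule zero1; assumption) | (rule zero2; assumption) | (simp add: algebra_simps))+)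
  qed (rule types_algebra)+
qed

subsection \<open>Closed isomorphism invariants\<close>

lemma iso_hom:
  assumes "\<mu> \<cong>\<^sub>a \<rho>"
  shows "\<exists>f. lin f \<and> bij f \<and> (\<forall>x y. f (\<rho> x y) = \<mu> (f x) (f y))"
  using iso_sym[OF assms] by (auto simp: algebra_iso_def)

lemma lin_0: "lin f \<Longrightarrow> f 0 = 0" and lin_add: "lin f \<Longrightarrow> f (x + y) = f x + f y"
  using vec.linear_0 vec.linear_add by blast+

lemma lin_bij_eq_0: "lin f \<Longrightarrow> bij f \<Longrightarrow> f x = 0 \<Longrightarrow> x = 0"
  by (metis bij_is_inj injD lin_0)

lemma basis4_hom:
  assumes "lin f" "bij f" "basis4 a b c d" shows "basis4 (f a) (f b) (f c) (f d)"
proof -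
  have "comb (f a) (f b) (f c) (f d) x = f (comb a b c d x)" for x
    using assms(1) by (simp add: comb_def lin_iff)
  then show ?thesis
    using assms by (auto simp: basis4_def dest: lin_bij_eq_0)
qed

definition mat4 :: "complex ^ 4 \<Rightarrow> complex ^ 4 \<Rightarrow> complex ^ 4 \<Rightarrow> complex ^ 4 \<Rightarrow> complex ^ 4 ^ 4" where
  "mat4 a b c d = (\<chi> i j. if j = 1 then a $ i else if j = 2 then b $ i else if j = 3 then c $ i
     else d $ i)"

lemma basis4_iff_det: "basis4 a b c d \<longleftrightarrow> det (mat4 a b c d) \<noteq> 0"
proof -
  have "mat4 a b c d *v x = comb a b c d x" for x
    by (simp add: vec4_eq_iff matrix_vector_mult_def mat4_def comb_def sum_4 mult.commute)
  then show ?thesis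
    by (simp add: basis4_def invertible_det_nz[symmetric] invertible_left_inverse
        matrix_left_invertible_ker)
qed

lemma alg_poly_det:
  assumes "alg_poly_vec a" "alg_poly_vec b" "alg_poly_vec c" "alg_poly_vec d"
  shows "alg_poly (\<lambda>\<mu>. det (mat4 (a \<mu>) (b \<mu>) (c \<mu>) (d \<mu>)))"
proof -
  have "alg_poly (\<lambda>\<mu>. mat4 (a \<mu>) (b \<mu>) (c \<mu>) (d \<mu>) $ i $ j)" for i j
    using assms
    by (cases "j = 1"; cases "j = 2"; cases "j = 3") (simp_all add: mat4_def alg_poly_vec_def)
  then show ?thesis
    unfolding det_def by (intro alg_poly_sum alg_poly_mult alg_poly_prod alg_poly_const)
qed

text \<open>Dependence is the vanishing of a determinant, hence polynomial. The isomorphism f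
  transports the vectors into \<mu>, so that every later check is a computation in \<mu>
  alone.\<close>

lemma dependent_closed:
  assumes "is_algebra \<mu>" "\<mu> \<leadsto> \<nu>"
    and "alg_poly_vec a" "alg_poly_vec b" "alg_poly_vec c" "alg_poly_vec d"
    and "\<And>\<rho> f. lin f \<Longrightarrow> bij f \<Longrightarrow> (\<And>x y. f (\<rho> x y) = \<mu> (f x) (f y)) \<Longrightarrow>
      \<not> basis4 (f (a \<rho>)) (f (b \<rho>)) (f (c \<rho>)) (f (d \<rho>))"
  shows "\<not> basis4 (a \<nu>) (b \<nu>) (c \<nu>) (d \<nu>)"
proof -
  have "det (mat4 (a \<nu>) (b \<nu>) (c \<nu>) (d \<nu>)) = 0"
  proof (rule degenerates_alg_poly[OF assms(1,2) alg_poly_det[OF assms(3-6)]])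
    fix \<rho> assume "\<mu> \<cong>\<^sub>a \<rho>"
    obtain f where f: "lin f" "bij f" "\<And>x y. f (\<rho> x y) = \<mu> (f x) (f y)"
      using iso_hom[OF \<open>\<mu> \<cong>\<^sub>a \<rho>\<close>] by (elim exE conjE) (simp only:)
    show "det (mat4 (a \<rho>) (b \<rho>) (c \<rho>) (d \<rho>)) = 0"
      using assms(7)[OF f] basis4_hom[OF f(1,2)] basis4_iff_det by blast
  qed
  then show ?thesis
    by (simp add: basis4_iff_det)
qed

lemma vec_identity_closed:
  assumes "is_algebra \<mu>" "\<mu> \<leadsto> \<nu>" "alg_poly_vec a"
    and "\<And>\<rho> f. lin f \<Longrightarrow> bij f \<Longrightarrow> (\<And>x y. f (\<rho> x y) = \<mu> (f x) (f y)) \<Longrightarrow> f (a \<rho>) = 0"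
  shows "a \<nu> = 0"
proof -
  have "a \<nu> $ k = 0" for k
  proof (rule degenerates_alg_poly[OF assms(1,2) alg_poly_vec_nth[OF assms(3)]])
    fix \<rho> assume "\<mu> \<cong>\<^sub>a \<rho>"
    obtain f where f: "lin f" "bij f" "\<And>x y. f (\<rho> x y) = \<mu> (f x) (f y)"
      using iso_hom[OF \<open>\<mu> \<cong>\<^sub>a \<rho>\<close>] by (elim exE conjE) (simp only:)
    then show "a \<rho> $ k = 0"
      using assms(4)[OF f] lin_bij_eq_0[OF f(1,2)] by (simp add: vec_eq_iff)
  qed
  then show ?thesis by (simp add: vec_eq_iff)
qed

lemmas alg_poly_vec_intros = alg_poly_vec_mult alg_poly_vec_add alg_poly_vec_const

definition lie :: "'n::finite mult \<Rightarrow> bool" where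
  "lie \<mu> \<longleftrightarrow> (\<forall>x. \<mu> x x = 0) \<and> (\<forall>x y z. jacobian \<mu> x y z = 0)"

text \<open>The definition through generated subalgebras is not visibly polynomial. These identities
  are, so they survive degeneration; the classification starts from them.\<close>

definition binary_lie_id :: "'n::finite mult \<Rightarrow> bool" where
  "binary_lie_id \<mu> \<longleftrightarrow> (\<forall>x. \<mu> x x = 0) \<and> (\<forall>x y. jacobian \<mu> x y (\<mu> x y) = 0)"

section \<open>Polynomial identities\<close>

context
  fixes \<mu> \<nu> :: "'n::finite mult"
  assumes alg: "is_algebra \<mu>" and deg: "\<mu> \<leadsto> \<nu>"
begin

lemma self_closed: "(\<And>x. \<mu> x x = 0) \<Longrightarrow> \<nu> x x = 0"
  by (rule vec_identity_closed[OF alg deg, where a = "\<lambda>\<mu>. \<mu> x x"]) (auto intro: alg_poly_vec_intros)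

lemma jacobian_closed: "(\<And>x y z. jacobian \<mu> x y z = 0) \<Longrightarrow> jacobian \<nu> x y z = 0"
  by (rule vec_identity_closed[OF alg deg, where a = "\<lambda>\<mu>. jacobian \<mu> x y z"])
    (auto simp: jacobian_def lin_add intro!: alg_poly_vec_intros)

lemma jacobian_binary_closed:
  "(\<And>x y. jacobian \<mu> x y (\<mu> x y) = 0) \<Longrightarrow> jacobian \<nu> x y (\<nu> x y) = 0"
  by (rule vec_identity_closed[OF alg deg, where a = "\<lambda>\<mu>. jacobian \<mu> x y (\<mu> x y)"])
    (auto simp: jacobian_def lin_add intro!: alg_poly_vec_intros)

lemma lie_closed: "lie \<mu> \<Longrightarrow> lie \<nu>"
  using self_closed jacobian_closed by (auto simp: lie_def)

lemma binary_lie_id_closed: "binary_lie_id \<mu> \<Longrightarrow> binary_lie_id \<nu>"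
  using self_closed jacobian_binary_closed by (auto simp: binary_lie_id_def)

lemma nilpotent2_closed: "(\<And>x y z. \<mu> x (\<mu> y z) = 0) \<Longrightarrow> \<nu> x (\<nu> y z) = 0"
  by (rule vec_identity_closed[OF alg deg, where a = "\<lambda>\<mu>. \<mu> x (\<mu> y z)"]) (auto intro!: alg_poly_vec_intros)

lemma engel3_closed: "(\<And>x y. \<mu> x (\<mu> x (\<mu> x y)) = 0) \<Longrightarrow> \<nu> x (\<nu> x (\<nu> x y)) = 0"
  by (rule vec_identity_closed[OF alg deg, where a = "\<lambda>\<mu>. \<mu> x (\<mu> x (\<mu> x y))"])
    (auto intro!: alg_poly_vec_intros)

lemma zero_closed: "(\<And>x y. \<mu> x y = 0) \<Longrightarrow> \<nu> x y = 0"
  by (rule vec_identity_closed[OF alg deg, where a = "\<lambda>\<mu>. \<mu> x y"]) (auto intro!: alg_poly_vec_intros)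

lemma solvable3_closed:
  "(\<And>x y z w u v. \<mu> (\<mu> (\<mu> x y) (\<mu> z w)) (\<mu> u v) = 0) \<Longrightarrow> \<nu> (\<nu> (\<nu> x y) (\<nu> z w)) (\<nu> u v) = 0"
  by (rule vec_identity_closed[OF alg deg, where a = "\<lambda>\<mu>. \<mu> (\<mu> (\<mu> x y) (\<mu> z w)) (\<mu> u v)"])
    (auto intro!: alg_poly_vec_intros)

end

section \<open>Dependence conditions\<close>

context
  fixes \<mu> \<nu> :: "4 mult"
  assumes alg: "is_algebra \<mu>" and deg: "\<mu> \<leadsto> \<nu>"
begin

lemma irregular_closed:
  "(\<And>x y. \<not> basis4 x y (\<mu> x y) (\<mu> x (\<mu> x y))) \<Longrightarrow> \<not> basis4 x y (\<nu> x y) (\<nu> x (\<nu> x y))"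
  by (rule dependent_closed[OF alg deg, where a = "\<lambda>\<mu>. x" and b = "\<lambda>\<mu>. y" and
        c = "\<lambda>\<mu>. \<mu> x y" and d = "\<lambda>\<mu>. \<mu> x (\<mu> x y)"]) (auto intro!: alg_poly_vec_intros)

text \<open>Dependence of two vectors is expressed as the failure of every completion to a basis, so
  that the four-vector determinant applies. The condition says that all left multiplications agree
  up to scalars at each product.\<close>

lemma parallel_closed:
  "(\<And>x y z w u v. \<not> basis4 (\<mu> x (\<mu> z w)) (\<mu> y (\<mu> z w)) u v) \<Longrightarrow>
    \<not> basis4 (\<nu> x (\<nu> z w)) (\<nu> y (\<nu> z w)) u v"
  by (rule dependent_closed[OF alg deg, where a = "\<lambda>\<mu>. \<mu> x (\<mu> z w)" and
        b = "\<lambda>\<mu>. \<mu> y (\<mu> z w)" and c = "\<lambda>\<mu>. u" and d = "\<lambda>\<mu>. v"]) (auto intro!: alg_poly_vec_intros)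

lemma derived1_closed:
  "(\<And>x y z w u v. \<not> basis4 (\<mu> x y) (\<mu> z w) u v) \<Longrightarrow> \<not> basis4 (\<nu> x y) (\<nu> z w) u v"
  by (rule dependent_closed[OF alg deg, where a = "\<lambda>\<mu>. \<mu> x y" and
        b = "\<lambda>\<mu>. \<mu> z w" and c = "\<lambda>\<mu>. u" and d = "\<lambda>\<mu>. v"]) (auto intro!: alg_poly_vec_intros)

lemma derived2_closed:
  "(\<And>x y z w u v p. \<not> basis4 (\<mu> x y) (\<mu> z w) (\<mu> u v) p) \<Longrightarrow>
    \<not> basis4 (\<nu> x y) (\<nu> z w) (\<nu> u v) p"
  by (rule dependent_closed[OF alg deg, where a = "\<lambda>\<mu>. \<mu> x y" and
        b = "\<lambda>\<mu>. \<mu> z w" and c = "\<lambda>\<mu>. \<mu> u v" and d = "\<lambda>\<mu>. p"]) (auto intro!: alg_poly_vec_intros)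

lemma planar_closed:
  "(\<And>x y v. \<not> basis4 x y (\<mu> x y) v) \<Longrightarrow> \<not> basis4 x y (\<nu> x y) v"
  by (rule dependent_closed[OF alg deg, where a = "\<lambda>\<mu>. x" and b = "\<lambda>\<mu>. y" and
        c = "\<lambda>\<mu>. \<mu> x y" and d = "\<lambda>\<mu>. v"]) (auto intro!: alg_poly_vec_intros)

end

subsection \<open>Traces of powers of left multiplications\<close>

definition tr :: "(complex ^ 'n::finite \<Rightarrow> complex ^ 'n) \<Rightarrow> complex" where
  "tr A = (\<Sum>i\<in>UNIV. A (axis i 1) $ i)"

lemma tr_trace: "tr A = trace (matrix A)"
  by (simp add: tr_def trace_def matrix_def)

lemma tr_conj:
  assumes "lin A" "lin f" "bij f" "\<And>x. f (B x) = A (f x)"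
  shows "tr B = tr A"
proof -
  have inv: "inv f (f x) = x" "f (inv f x) = x" for x
    using assms(3) by (simp_all add: bij_is_inj bij_is_surj surj_f_inv_f)
  have B: "B = inv f \<circ> (A \<circ> f)"
    using assms(4) inv(1) by (metis (no_types, lifting) comp_apply ext)
  have lin_inv: "lin (inv f)"
  proof -
    have "inv f (x + y) = inv f x + inv f y" "inv f (c *s x) = c *s inv f x" for x y c
      using assms(2) inv by (metis lin_iff)+
    then show ?thesis by (simp add: lin_iff)
  qed
  have "lin (A \<circ> f)"
    using assms(1,2) by (simp add: lin_iff)
  then have "tr B = trace (matrix (inv f) ** (matrix A ** matrix f))"
    unfolding B tr_trace using assms(1,2) lin_inv by (simp add: matrix_compose_gen)
  also have "\<dots> = trace ((matrix A ** matrix f) ** matrix (inv f))"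
    by (rule trace_mul_sym)
  also have "\<dots> = trace (matrix A ** matrix (f \<circ> inv f))"
    using assms(2) lin_inv by (simp add: matrix_compose_gen matrix_mul_assoc)
  also have "f \<circ> inv f = id"
    using inv(2) by auto
  finally show ?thesis
    by (simp add: tr_trace matrix_id_mat_1 del: id_apply)
qed

definition tr1 :: "'n::finite mult \<Rightarrow> complex ^ 'n \<Rightarrow> complex" where
  "tr1 \<mu> x = tr (\<lambda>y. \<mu> x y)"
definition tr2 :: "'n::finite mult \<Rightarrow> complex ^ 'n \<Rightarrow> complex" where
  "tr2 \<mu> x = tr (\<lambda>y. \<mu> x (\<mu> x y))"
definition tr3 :: "'n::finite mult \<Rightarrow> complex ^ 'n \<Rightarrow> complex" where
  "tr3 \<mu> x = tr (\<lambda>y. \<mu> x (\<mu> x (\<mu> x y)))"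

lemma tr_hom:
  assumes "is_algebra \<mu>" "lin f" "bij f" "\<And>x y. f (\<rho> x y) = \<mu> (f x) (f y)"
  shows "tr1 \<rho> x = tr1 \<mu> (f x)" "tr2 \<rho> x = tr2 \<mu> (f x)" "tr3 \<rho> x = tr3 \<mu> (f x)"
  unfolding tr1_def tr2_def tr3_def
  by (rule tr_conj[OF _ assms(2,3)]; simp add: lin_iff alg_simps[OF assms(1)] assms(4))+

lemma alg_poly_tr:
  "alg_poly (\<lambda>\<mu>. tr1 \<mu> x)" "alg_poly (\<lambda>\<mu>. tr2 \<mu> x)" "alg_poly (\<lambda>\<mu>. tr3 \<mu> x)"
  unfolding tr1_def tr2_def tr3_def tr_def
  by (intro alg_poly_sum alg_poly_vec_nth alg_poly_vec_intros)+

text \<open>These are the relations between triples of weights 1, 2, 3. A nonzero \<sigma>1 gives l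
  by division. If \<sigma>1 = 0, the second entry fixes l up to sign and the third decides the sign;
  if only \<sigma>3 is left, any cube root serves.\<close>

lemma weighted_proportional:
  fixes \<sigma>1 \<sigma>2 \<sigma>3 \<tau>1 \<tau>2 \<tau>3 :: complex
  assumes "\<sigma>1 ^ 2 * \<tau>2 = \<sigma>2 * \<tau>1 ^ 2" "\<sigma>1 ^ 3 * \<tau>3 = \<sigma>3 * \<tau>1 ^ 3"
    "\<sigma>2 ^ 3 * \<tau>3 ^ 2 = \<sigma>3 ^ 2 * \<tau>2 ^ 3" "\<sigma>1 \<noteq> 0 \<or> \<sigma>2 \<noteq> 0 \<or> \<sigma>3 \<noteq> 0"
  shows "\<exists>l. \<tau>1 = l * \<sigma>1 \<and> \<tau>2 = l ^ 2 * \<sigma>2 \<and> \<tau>3 = l ^ 3 * \<sigma>3"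
proof -
  consider "\<sigma>1 \<noteq> 0" | "\<sigma>1 = 0" "\<sigma>2 \<noteq> 0" | "\<sigma>1 = 0" "\<sigma>2 = 0" "\<sigma>3 \<noteq> 0"
    using assms(4) by blast
  then show ?thesis
  proof cases
    case 1
    then show ?thesis
      using assms(1,2) by (intro exI[of _ "\<tau>1 / \<sigma>1"]) (auto simp: field_simps)
  next
    case 2
    define l where "l = csqrt (\<tau>2 / \<sigma>2)"
    have \<tau>2: "\<tau>2 = l ^ 2 * \<sigma>2"
      using 2 by (simp add: l_def)
    have "\<sigma>2 ^ 3 * \<tau>3 ^ 2 = \<sigma>2 ^ 3 * (l ^ 3 * \<sigma>3) ^ 2"
      using assms(3) \<tau>2 by algebra
    then have "\<tau>3 ^ 2 = (l ^ 3 * \<sigma>3) ^ 2"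
      using 2 by simp
    then consider "\<tau>3 = l ^ 3 * \<sigma>3" | "\<tau>3 = (- l) ^ 3 * \<sigma>3"
      by (auto simp: power2_eq_iff)
    moreover have "\<tau>1 = 0"
      using assms(1) 2 by simp
    ultimately show ?thesis
      using \<tau>2 2 by cases (auto intro: exI[of _ l] exI[of _ "- l"])
  next
    case 3
    obtain l where l: "l ^ 3 = \<tau>3 / \<sigma>3"
      by (metis exists_complex_root zero_neq_numeral)
    then show ?thesis
      using 3 assms by (intro exI[of _ l]) auto
  qed
qed

text \<open>The triples obtained from \<sigma> with some factor l are cut out by three weighted
  homogeneous equations. In this way a condition with an existential quantifier passes to
  limits.\<close>

lemma trace_closed:
  assumes "is_algebra \<mu>" "\<mu> \<leadsto> \<nu>" "\<sigma>1 \<noteq> 0 \<or> \<sigma>2 \<noteq> 0 \<or> \<sigma>3 \<noteq> 0"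
    and "\<And>x. \<exists>l. tr1 \<mu> x = l * \<sigma>1 \<and> tr2 \<mu> x = l ^ 2 * \<sigma>2 \<and> tr3 \<mu> x = l ^ 3 * \<sigma>3"
  shows "\<exists>l. tr1 \<nu> x = l * \<sigma>1 \<and> tr2 \<nu> x = l ^ 2 * \<sigma>2 \<and> tr3 \<nu> x = l ^ 3 * \<sigma>3"
proof (rule weighted_proportional[OF _ _ _ assms(3)])
  have *: "p \<nu> = q \<nu>" if "alg_poly p" "alg_poly q"
    and "\<And>\<rho> l. tr1 \<rho> x = l * \<sigma>1 \<Longrightarrow> tr2 \<rho> x = l ^ 2 * \<sigma>2 \<Longrightarrow> tr3 \<rho> x = l ^ 3 * \<sigma>3 \<Longrightarrow> p \<rho> = q \<rho>"
    for p q
  proof -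
    have "p \<nu> - q \<nu> = 0"
    proof (rule degenerates_alg_poly[OF assms(1,2) alg_poly_diff[OF that(1,2)]])
      fix \<rho> assume "\<mu> \<cong>\<^sub>a \<rho>"
      obtain f where f: "lin f" "bij f" "\<And>x y. f (\<rho> x y) = \<mu> (f x) (f y)"
        using iso_hom[OF \<open>\<mu> \<cong>\<^sub>a \<rho>\<close>] by (elim exE conjE) (simp only:)
      obtain l where l: "tr1 \<mu> (f x) = l * \<sigma>1" "tr2 \<mu> (f x) = l ^ 2 * \<sigma>2"
        "tr3 \<mu> (f x) = l ^ 3 * \<sigma>3"
        using assms(4)[of "f x"] by blast
      have "p \<rho> = q \<rho>"
        using that(3)[of \<rho> l] l
          tr_hom[where \<mu> = \<mu> and f = f and \<rho> = \<rho> and x = x, OF assms(1) f] by simp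
      then show "p \<rho> - q \<rho> = 0" by simp
    qed
    then show ?thesis by simp
  qed
  show "\<sigma>1 ^ 2 * tr2 \<nu> x = \<sigma>2 * tr1 \<nu> x ^ 2"
    by (rule *) (auto intro!: alg_poly_mult alg_poly_power alg_poly_const alg_poly_tr simp: algebra_simps)
  show "\<sigma>1 ^ 3 * tr3 \<nu> x = \<sigma>3 * tr1 \<nu> x ^ 3"
    by (rule *) (auto intro!: alg_poly_mult alg_poly_power alg_poly_const alg_poly_tr simp: algebra_simps)
  show "\<sigma>2 ^ 3 * tr3 \<nu> x ^ 2 = \<sigma>3 ^ 2 * tr2 \<nu> x ^ 3"
    by (rule *) (auto intro!: alg_poly_mult alg_poly_power alg_poly_const alg_poly_tr
        simp: power_mult_distrib power_mult[symmetric])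
qed

subsection \<open>Invariants of the types\<close>

text \<open>Names for the types with their parameters, so that functions and case distinctions on
  types are possible. Different names may denote isomorphic algebras, such as \<open>G4' a b\<close>
  and \<open>G4' b a\<close>.\<close>

datatype kind = C4' | N3' | N4' | R2' | RR' | SL' | G1' | G2' complex | G3' complex
  | G4' complex complex | G5' complex | G6'

fun rep :: "kind \<Rightarrow> 4 mult" where
  "rep C4' = C4" | "rep N3' = n3_C" | "rep N4' = n4" | "rep R2' = r2_C2" | "rep RR' = r2_r2"
| "rep SL' = sl2_C" | "rep G1' = g1" | "rep (G2' b) = g2 b" | "rep (G3' b) = g3 b"
| "rep (G4' a b) = g4 a b" | "rep (G5' a) = g5 a" | "rep G6' = g6"

lemma rep_algebra: "is_algebra (rep t)"
  by (cases t) (simp_all add: types_algebra)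

lemma rep_self: "rep t x x = 0"
  by (cases t) (simp_all only: rep.simps types_alg4 alg4_self)

lemma rep_lie:
  assumes "\<And>b. t = G3' b \<Longrightarrow> b = 2" "t \<noteq> G6'" shows "lie (rep t)"
  unfolding lie_def
proof (intro conjI allI)
  show "jacobian (rep t) x y z = 0" for x y z
    using assms by (cases t) (auto simp: jacobian_def types_alg4 alg4_apply vec4_eq_iff algebra_simps)
qed (rule rep_self)

lemma lie_rep: "lie (rep t) \<Longrightarrow> (\<forall>b. t = G3' b \<longrightarrow> b = 2) \<and> t \<noteq> G6'"
proof (cases t)
  case (G3' b)
  assume "lie (rep t)"
  then have "jacobian (g3 b) (ee 1) (ee 2) (ee 3) $ 4 = 0" by (simp add: lie_def G3')
  then have "b = 2" by (simp add: jacobian_def types_alg4 alg4_apply)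
  then show ?thesis using G3' by simp
next
  case G6'
  assume "lie (rep t)"
  then have "jacobian g6 (ee 1) (ee 2) (ee 4) $ 3 = 0" by (simp add: lie_def G6')
  then show ?thesis by (simp add: jacobian_def types_alg4 alg4_apply)
qed auto

lemma rep_regular:
  assumes "\<And>x y. \<not> basis4 x y (rep t x y) (rep t x (rep t x y))"
  shows "case t of N4' \<Rightarrow> False | RR' \<Rightarrow> False | SL' \<Rightarrow> False | G4' a b \<Rightarrow> False | G5' a \<Rightarrow> False
    | _ \<Rightarrow> True"
proof (cases t)
  case N4'
  have "basis4 (ee 1) (ee 2) (rep t (ee 1) (ee 2)) (rep t (ee 1) (rep t (ee 1) (ee 2)))"
    by (auto simp: N4' types_alg4 alg4_compute)
  then show ?thesis using assms by blast
next
  case (G4' a b)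
  have "basis4 (ee 1) (ee 4) (rep t (ee 1) (ee 4)) (rep t (ee 1) (rep t (ee 1) (ee 4)))"
    by (auto simp: G4' types_alg4 alg4_compute)
  then show ?thesis using assms by blast
next
  case (G5' a)
  let ?x = "ee 1 + ee 3" and ?y = "ee 3"
  have "basis4 ?x ?y (rep t ?x ?y) (rep t ?x (rep t ?x ?y))"
    by (auto simp: G5' types_alg4 alg4_compute)
  then show ?thesis using assms by blast
next
  case RR'
  \<comment> \<open>The factor 2 gives e2 and e4 different eigenvalues, so that xy and x(xy) are
    independent.\<close>
  let ?x = "ee 1 + 2 *s ee 3" and ?y = "ee 2 + ee 3 + ee 4"
  have "basis4 ?x ?y (rep t ?x ?y) (rep t ?x (rep t ?x ?y))"
    by (auto simp: RR' types_alg4 alg4_compute) algebra+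
  then show ?thesis using assms by blast
next
  case SL'
  let ?x = "ee 1 + ee 4" and ?y = "ee 1 + ee 2 + ee 3"
  have "basis4 ?x ?y (rep t ?x ?y) (rep t ?x (rep t ?x ?y))"
    by (auto simp: SL' types_alg4 alg4_compute)
  then show ?thesis using assms by blast
qed simp_all

lemma rep_parallel:
  assumes "\<And>x y z w u v. \<not> basis4 (rep t x (rep t z w)) (rep t y (rep t z w)) u v"
  shows "case t of RR' \<Rightarrow> False | SL' \<Rightarrow> False | G3' b \<Rightarrow> False | G5' a \<Rightarrow> False | _ \<Rightarrow> True"
proof (cases t)
  case (G5' a)
  have "basis4 (rep t (ee 1) (rep t (ee 1) (ee 2))) (rep t (ee 3) (rep t (ee 1) (ee 2))) (ee 1) (ee 3)"
    by (auto simp: G5' types_alg4 alg4_compute)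
  then show ?thesis using assms by blast
next
  case (G3' a)
  have "basis4 (rep t (ee 1) (rep t (ee 1) (ee 2))) (rep t (ee 3) (rep t (ee 1) (ee 2))) (ee 1) (ee 3)"
    by (auto simp: G3' types_alg4 alg4_compute)
  then show ?thesis using assms by blast
next
  case RR'
  let ?z = "ee 1 + ee 3" and ?w = "ee 2 + ee 4"
  have "basis4 (rep t (ee 1) (rep t ?z ?w)) (rep t (ee 3) (rep t ?z ?w)) (ee 1) (ee 3)"
    by (auto simp: RR' types_alg4 alg4_compute)
  then show ?thesis using assms by blast
next
  case SL'
  have "basis4 (rep t (ee 1) (rep t (ee 1) (ee 2))) (rep t (ee 3) (rep t (ee 1) (ee 2))) (ee 3) (ee 4)"
    by (auto simp: SL' types_alg4 alg4_compute)
  then show ?thesis using assms by blast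
qed simp_all

lemma rep_derived1:
  assumes "\<And>x y z w u v. \<not> basis4 (rep t x y) (rep t z w) u v"
  shows "t = C4' \<or> t = N3' \<or> t = R2' \<or> t = G6'"
proof (cases t)
  case N4'
  have "basis4 (rep t (ee 1) (ee 2)) (rep t (ee 1) (ee 3)) (ee 1) (ee 2)"
    by (auto simp: N4' types_alg4 alg4_compute)
  then show ?thesis using assms by blast
next
  case G1'
  have "basis4 (rep t (ee 1) (ee 2)) (rep t (ee 1) (ee 3)) (ee 1) (ee 4)"
    by (auto simp: G1' types_alg4 alg4_compute)
  then show ?thesis using assms by blast
next
  case (G2' b)
  have "basis4 (rep t (ee 1) (ee 2)) (rep t (ee 1) (ee 3)) (ee 1) (ee 4)"
    by (auto simp: G2' types_alg4 alg4_compute)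
  then show ?thesis using assms by blast
next
  case (G3' b)
  have "basis4 (rep t (ee 1) (ee 2)) (rep t (ee 1) (ee 3)) (ee 1) (ee 4)"
    by (auto simp: G3' types_alg4 alg4_compute)
  then show ?thesis using assms by blast
next
  case (G4' a b)
  have "basis4 (rep t (ee 1) (ee 2)) (rep t (ee 1) (ee 4)) (ee 1) (ee 4)"
    by (auto simp: G4' types_alg4 alg4_compute)
  then show ?thesis using assms by blast
next
  case (G5' a)
  have "basis4 (rep t (ee 1) (ee 2)) (rep t (ee 2) (ee 3)) (ee 1) (ee 3)"
    by (auto simp: G5' types_alg4 alg4_compute)
  then show ?thesis using assms by blast
next
  case RR'
  have "basis4 (rep t (ee 1) (ee 2)) (rep t (ee 3) (ee 4)) (ee 1) (ee 3)"
    by (auto simp: RR' types_alg4 alg4_compute)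
  then show ?thesis using assms by blast
next
  case SL'
  have "basis4 (rep t (ee 1) (ee 2)) (rep t (ee 1) (ee 3)) (ee 1) (ee 4)"
    by (auto simp: SL' types_alg4 alg4_compute)
  then show ?thesis using assms by blast
qed simp_all

lemma rep_derived2:
  assumes "\<And>x y z w u v p. \<not> basis4 (rep t x y) (rep t z w) (rep t u v) p"
  shows "case t of G1' \<Rightarrow> False | SL' \<Rightarrow> False | G2' b \<Rightarrow> b = 0 | G3' b \<Rightarrow> False
    | G4' a b \<Rightarrow> a * b = 0 | G5' a \<Rightarrow> a = 0 | _ \<Rightarrow> True"
proof (cases t)
  case G1'
  have "basis4 (rep t (ee 1) (ee 2)) (rep t (ee 1) (ee 3)) (rep t (ee 1) (ee 4)) (ee 1)"
    by (auto simp: G1' types_alg4 alg4_compute)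
  then show ?thesis using assms by blast
next
  case (G2' b)
  have "basis4 (rep t (ee 1) (ee 2)) (rep t (ee 1) (ee 3)) (rep t (ee 1) (ee 4)) (ee 1)" if "b \<noteq> 0"
    using that by (auto simp: G2' types_alg4 alg4_compute)
  then show ?thesis using assms G2' by auto
next
  case (G3' b)
  have "basis4 (rep t (ee 1) (ee 2)) (rep t (ee 1) (ee 3)) (rep t (ee 2) (ee 3)) (ee 1)"
    by (auto simp: G3' types_alg4 alg4_compute)
  then show ?thesis using assms by blast
next
  case (G4' a b)
  have "basis4 (rep t (ee 1) (ee 2)) (rep t (ee 1) (ee 3)) (rep t (ee 1) (ee 4)) (ee 1)" if "a * b \<noteq> 0"
    using that by (auto simp: G4' types_alg4 alg4_compute)
  then show ?thesis using assms G4' by (cases "a * b = 0") auto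
next
  case (G5' a)
  have "basis4 (rep t (ee 1) (ee 2)) (rep t (ee 1) (ee 3)) (rep t (ee 2) (ee 3)) (ee 1)" if "a \<noteq> 0"
    using that by (auto simp: G5' types_alg4 alg4_compute)
  then show ?thesis using assms G5' by auto
next
  case SL'
  have "basis4 (rep t (ee 1) (ee 2)) (rep t (ee 1) (ee 3)) (rep t (ee 2) (ee 3)) (ee 4)"
    by (auto simp: SL' types_alg4 alg4_compute)
  then show ?thesis using assms by blast
qed simp_all

lemma rep_planar:
  assumes "\<And>x y v. \<not> basis4 x y (rep t x y) v"
  shows "t = C4' \<or> t = G1'"
proof (cases t)
  case N3'
  have "basis4 (ee 1) (ee 2) (rep t (ee 1) (ee 2)) (ee 4)"
    by (auto simp: N3' types_alg4 alg4_compute)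
  then show ?thesis using assms by blast
next
  case N4'
  have "basis4 (ee 1) (ee 2) (rep t (ee 1) (ee 2)) (ee 4)"
    by (auto simp: N4' types_alg4 alg4_compute)
  then show ?thesis using assms by blast
next
  case R2'
  have "basis4 (ee 1) (ee 2 + ee 3) (rep t (ee 1) (ee 2 + ee 3)) (ee 4)"
    by (auto simp: R2' types_alg4 alg4_compute)
  then show ?thesis using assms by blast
next
  case RR'
  have "basis4 (ee 1) (ee 2 + ee 3) (rep t (ee 1) (ee 2 + ee 3)) (ee 4)"
    by (auto simp: RR' types_alg4 alg4_compute)
  then show ?thesis using assms by blast
next
  case SL'
  have "basis4 (ee 2) (ee 3) (rep t (ee 2) (ee 3)) (ee 4)"
    by (auto simp: SL' types_alg4 alg4_compute)
  then show ?thesis using assms by blast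
next
  case (G2' b)
  have "basis4 (ee 1) (ee 2 + ee 4) (rep t (ee 1) (ee 2 + ee 4)) (ee 4)"
    by (auto simp: G2' types_alg4 alg4_compute)
  then show ?thesis using assms by blast
next
  case (G3' b)
  have "basis4 (ee 2) (ee 3) (rep t (ee 2) (ee 3)) (ee 1)"
    by (auto simp: G3' types_alg4 alg4_compute)
  then show ?thesis using assms by blast
next
  case (G4' a b)
  have "basis4 (ee 1) (ee 4) (rep t (ee 1) (ee 4)) (ee 2)"
    by (auto simp: G4' types_alg4 alg4_compute)
  then show ?thesis using assms by blast
next
  case (G5' a)
  have "basis4 (ee 2) (ee 3) (rep t (ee 2) (ee 3)) (ee 1)"
    by (auto simp: G5' types_alg4 alg4_compute)
  then show ?thesis using assms by blast
next
  case G6'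
  have "basis4 (ee 1) (ee 2) (rep t (ee 1) (ee 2)) (ee 4)"
    by (auto simp: G6' types_alg4 alg4_compute)
  then show ?thesis using assms by blast
qed simp_all

lemma rep_nilpotent2:
  assumes "\<And>x y z. rep t x (rep t y z) = 0"
  shows "t = C4' \<or> t = N3'"
proof -
  have "rep t (ee 1) (rep t (ee 1) (ee 2)) = 0" "rep t (ee 4) (rep t (ee 3) (ee 4)) = 0"
    by (rule assms)+
  then show ?thesis
    by (cases t) (simp_all add: types_alg4 alg4_compute)
qed

lemma rep_engel3:
  assumes "\<And>x y. rep t x (rep t x (rep t x y)) = 0"
  shows "t = C4' \<or> t = N3' \<or> t = N4'"
proof -
  have "rep t (ee 1) (rep t (ee 1) (rep t (ee 1) (ee 2))) = 0"
    "rep t (ee 4) (rep t (ee 4) (rep t (ee 4) (ee 3))) = 0"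
    by (rule assms)+
  then show ?thesis
    by (cases t) (simp_all add: types_alg4 alg4_compute)
qed

lemma rep_zero:
  assumes "\<And>x y. rep t x y = 0"
  shows "t = C4'"
proof -
  have "rep t (ee 1) (ee 2) = 0"
    by (rule assms)+
  then show ?thesis
    by (cases t) (simp_all add: types_alg4 alg4_compute)
qed

lemma rep_solvable3:
  assumes "\<And>x y z w u v. rep t (rep t (rep t x y) (rep t z w)) (rep t u v) = 0"
  shows "t \<noteq> SL'"
proof
  assume "t = SL'"
  moreover have "rep t (rep t (rep t (ee 1) (ee 2)) (rep t (ee 1) (ee 3))) (rep t (ee 1) (ee 2)) = 0"
    by (rule assms)
  ultimately show False
    by (simp add: types_alg4 alg4_compute)
qed

text \<open>These are the power sums of the eigenvalues of the left multiplication by x; in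
  \<open>g4 a b\<close>, for instance, the eigenvalues are 0 and 1, a, b times
  \<open>x $ 1\<close>.\<close>

lemma rep_traces:
  "tr1 (rep t) x = (case t of R2' \<Rightarrow> x $ 1 | RR' \<Rightarrow> x $ 1 + x $ 3 | G1' \<Rightarrow> 3 * x $ 1
     | G2' b \<Rightarrow> (2 + b) * x $ 1 | G3' b \<Rightarrow> (2 + b) * x $ 1 | G4' a b \<Rightarrow> (1 + a + b) * x $ 1
     | G5' a \<Rightarrow> (2 + 2 * a) * x $ 1 | G6' \<Rightarrow> - x $ 4 | _ \<Rightarrow> 0)"
  "tr2 (rep t) x = (case t of R2' \<Rightarrow> x $ 1 ^ 2 | RR' \<Rightarrow> x $ 1 ^ 2 + x $ 3 ^ 2
     | SL' \<Rightarrow> 2 * x $ 1 ^ 2 + 4 * x $ 2 * x $ 3 | G1' \<Rightarrow> 3 * x $ 1 ^ 2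
     | G2' b \<Rightarrow> (2 + b ^ 2) * x $ 1 ^ 2 | G3' b \<Rightarrow> (2 + b ^ 2) * x $ 1 ^ 2
     | G4' a b \<Rightarrow> (1 + a ^ 2 + b ^ 2) * x $ 1 ^ 2
     | G5' a \<Rightarrow> (1 + a ^ 2 + (a + 1) ^ 2) * x $ 1 ^ 2 | G6' \<Rightarrow> x $ 4 ^ 2 | _ \<Rightarrow> 0)"
  "tr3 (rep t) x = (case t of R2' \<Rightarrow> x $ 1 ^ 3 | RR' \<Rightarrow> x $ 1 ^ 3 + x $ 3 ^ 3
     | G1' \<Rightarrow> 3 * x $ 1 ^ 3
     | G2' b \<Rightarrow> (2 + b ^ 3) * x $ 1 ^ 3 | G3' b \<Rightarrow> (2 + b ^ 3) * x $ 1 ^ 3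
     | G4' a b \<Rightarrow> (1 + a ^ 3 + b ^ 3) * x $ 1 ^ 3
     | G5' a \<Rightarrow> (1 + a ^ 3 + (a + 1) ^ 3) * x $ 1 ^ 3 | G6' \<Rightarrow> - (x $ 4 ^ 3) | _ \<Rightarrow> 0)"
  unfolding tr1_def tr2_def tr3_def tr_def sum_4
  by (cases t; simp add: types_alg4 alg4_apply power2_eq_square power3_eq_cube algebra_simps)+

subsection \<open>Proportional eigenvalue triples\<close>

text \<open>Up to a permutation, \<open>1 : a : b\<close> and \<open>1 : c : d\<close> are the same proportion; stated through
  power sums because these are what the traces provide.\<close>

definition proportional :: "complex \<Rightarrow> complex \<Rightarrow> complex \<Rightarrow> complex \<Rightarrow> bool" where
  "proportional a b c d \<longleftrightarrow> (\<exists>l. l \<noteq> 0 \<and> 1 + c + d = l * (1 + a + b) \<and>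
     1 + c ^ 2 + d ^ 2 = l ^ 2 * (1 + a ^ 2 + b ^ 2) \<and> 1 + c ^ 3 + d ^ 3 = l ^ 3 * (1 + a ^ 3 + b ^ 3))"

text \<open>By Newton's identities, vanishing power sums would make the elementary symmetric
  functions of 1, a, b vanish, so that all three numbers would be 0.\<close>

lemma power_sums_nonzero:
  fixes a b :: complex
  shows "1 + a + b \<noteq> 0 \<or> 1 + a ^ 2 + b ^ 2 \<noteq> 0 \<or> 1 + a ^ 3 + b ^ 3 \<noteq> 0"
proof (rule ccontr)
  assume "\<not> ?thesis"
  then have *: "1 + a + b = 0" "1 + a ^ 2 + b ^ 2 = 0" "1 + a ^ 3 + b ^ 3 = 0" by auto
  have "(6::complex) * (a * b) = 0" "2 * (a + b + a * b) = 0" using * by algebra+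
  then have "(1::complex) = 0" using *(1) by simp algebra
  then show False by simp
qed

lemma proportionalI:
  assumes "\<exists>l. 1 + c + d = l * (1 + a + b) \<and> 1 + c ^ 2 + d ^ 2 = l ^ 2 * (1 + a ^ 2 + b ^ 2) \<and>
     1 + c ^ 3 + d ^ 3 = l ^ 3 * (1 + a ^ 3 + b ^ 3)"
  shows "proportional a b c d"
proof -
  obtain l where l: "1 + c + d = l * (1 + a + b)" "1 + c ^ 2 + d ^ 2 = l ^ 2 * (1 + a ^ 2 + b ^ 2)"
     "1 + c ^ 3 + d ^ 3 = l ^ 3 * (1 + a ^ 3 + b ^ 3)"
    using assms by blast
  then have "l \<noteq> 0"
    using power_sums_nonzero[of c d] by auto
  with l show ?thesis
    unfolding proportional_def by blast
qed

text \<open>Newton's identities, with denominators 2 and 6, turn power sums into elementary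
  symmetric functions. The polynomial identity in t then identifies the roots with multiplicities
  when t is set to suitable values.\<close>

lemma proportional_poly:
  assumes "proportional a b c d"
  shows "\<exists>l. l \<noteq> 0 \<and> 1 + c + d = l * (1 + a + b) \<and>
    c + d + c * d = l ^ 2 * (a + b + a * b) \<and> c * d = l ^ 3 * (a * b) \<and>
    (\<forall>t. (t - 1) * (t - c) * (t - d) = (t - l) * (t - l * a) * (t - l * b))"
proof -
  obtain l where l: "l \<noteq> 0" "1 + c + d = l * (1 + a + b)"
    "1 + c ^ 2 + d ^ 2 = l ^ 2 * (1 + a ^ 2 + b ^ 2)" "1 + c ^ 3 + d ^ 3 = l ^ 3 * (1 + a ^ 3 + b ^ 3)"
    using assms by (auto simp: proportional_def)
  have "2 * (c + d + c * d) = 2 * (l ^ 2 * (a + b + a * b))"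
    using l(2,3) by algebra
  then have 2: "c + d + c * d = l ^ 2 * (a + b + a * b)"
    by (subst (asm) mult_cancel_left) simp
  have "6 * (c * d) = 6 * (l ^ 3 * (a * b))"
    using l(2-4) by algebra
  then have 3: "c * d = l ^ 3 * (a * b)"
    by (subst (asm) mult_cancel_left) simp
  have "(t - 1) * (t - c) * (t - d) = (t - l) * (t - l * a) * (t - l * b)" for t
    using l(2) 2 3 by algebra
  with l 2 3 show ?thesis by blast
qed

lemma proportional_g4:
  assumes "proportional a b c d" shows "g4 a b \<cong>\<^sub>a g4 c d"
proof -
  obtain l where "l \<noteq> 0" "1 + c + d = l * (1 + a + b)"
    "c + d + c * d = l ^ 2 * (a + b + a * b)" "c * d = l ^ 3 * (a * b)"
    using proportional_poly[OF assms] by blast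
  then have "companion (1 + a + b) (a + b + a * b) (a * b) \<cong>\<^sub>a companion (1 + c + d) (c + d + c * d) (c * d)"
    using companion_scale by simp
  then show ?thesis
    using iso_trans[OF g4_companion[of a b]] iso_trans[OF _ iso_sym[OF g4_companion[of c d]]] by blast
qed

text \<open>The triple 1, a, a + 1 has sum 2 (1 + a), so its first two symmetric functions determine
  1 + a and a up to the weights 1 and 2. This is the rescaling of a Heisenberg companion
  form.\<close>

lemma proportional_g5:
  assumes "proportional a (a + 1) c (c + 1)" shows "g5 a \<cong>\<^sub>a g5 c"
proof -
  obtain l where l: "l \<noteq> 0" "1 + c + (c + 1) = l * (1 + a + (a + 1))"
    "c + (c + 1) + c * (c + 1) = l ^ 2 * (a + (a + 1) + a * (a + 1))"
    using proportional_poly[OF assms] by blast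
  have "2 * (1 + c) = 2 * (l * (1 + a))" using l(2) by algebra
  then have 1: "1 + c = l * (1 + a)"
    by (subst (asm) mult_cancel_left) simp
  have 2: "c = l ^ 2 * a" using 1 l(3) by algebra
  have "heisenberg_companion (1 + a) a \<cong>\<^sub>a heisenberg_companion (1 + c) c"
    using heisenberg_companion_scale[OF l(1), of "1 + a" a] by (simp only: 1 2[symmetric])
  then show ?thesis
    using iso_trans[OF g5_heisenberg_companion[of a]] iso_trans[OF _ iso_sym[OF g5_heisenberg_companion[of c]]] by blast
qed

lemma proportional_1_1:
  assumes "proportional 1 b 1 c" shows "c = b"
proof -
  obtain l where l: "l \<noteq> 0" "1 + 1 + c = l * (1 + 1 + b)"
    and p: "\<And>t. (t - 1) * (t - 1) * (t - c) = (t - l) * (t - l * 1) * (t - l * b)"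
    using proportional_poly[OF assms] by blast
  show ?thesis
  proof (cases "l = 1")
    case True
    then show ?thesis using l by simp
  next
    case False
    then have "c = l" "l * b = 1"
      using p[of l] p[of 1] by auto
    then have "2 + l = 2 * l + 1" using l(2) by (simp add: algebra_simps)
    then have "l = 1" by simp
    with False show ?thesis by simp
  qed
qed

lemma not_proportional_1_0: "\<not> proportional 1 b 0 0"
proof
  assume "proportional 1 b 0 0"
  then obtain l where l: "l \<noteq> 0"
    and p: "\<And>t. (t - 1) * (t - 0) * (t - 0) = (t - l) * (t - l * 1) * (t - l * b)"
    using proportional_poly by blast
  have "l = 1" using p[of l] l by simp
  moreover from this have "b = 0" using p[of 0] by simp
  ultimately show False using p[of 2] by simp
qed

text \<open>This keeps \<open>r2_C2\<close> and \<open>r2_r2\<close> from lying below any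
  \<open>g5 a\<close>.\<close>

lemma not_proportional_sum_0: "\<not> proportional a (a + 1) 0 0"
proof
  assume "proportional a (a + 1) 0 0"
  then obtain l where l: "l \<noteq> 0"
    and p: "\<And>t. (t - 1) * (t - 0) * (t - 0) = (t - l) * (t - l * a) * (t - l * (a + 1))"
    using proportional_poly by blast
  have l1: "l = 1" using p[of l] l by simp
  then have "a * (a + 1) = 0" using p[of 0] by algebra
  then have "a = 0 \<or> a + 1 = 0" by (simp only: mult_eq_0_iff)
  then show False
  proof
    assume "a = 0" then show False using p[of 2] l1 by simp
  next
    assume "a + 1 = 0"
    then have "a = -1" by algebra
    then show False using p[of "-1"] l1 by simp
  qed
qed

lemma proportional_sum_1_2:
  assumes "proportional a (a + 1) 1 2" shows "a = 1"
proof -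
  obtain l where l: "l \<noteq> 0" "1 + 1 + 2 = l * (1 + a + (a + 1))"
    "1 + 2 + 1 * 2 = l ^ 2 * (a + (a + 1) + a * (a + 1))"
    using proportional_poly[OF assms] by blast
  have "2 * 2 = 2 * (l * (1 + a))" using l(2) by algebra
  then have 1: "l * (1 + a) = 2"
    by (subst (asm) mult_cancel_left) simp
  have "l ^ 2 * (a + (a + 1) + a * (a + 1)) = 5"
    unfolding l(3)[symmetric] by simp
  moreover have "l ^ 2 * a = l ^ 2 * (a + (a + 1) + a * (a + 1)) - (l * (1 + a)) ^ 2"
    by (simp add: power2_eq_square algebra_simps)
  ultimately have 2: "l ^ 2 * a = 1" by (simp only: 1) simp
  \<comment> \<open>The numbers l and l a have sum 2 and product 1, so both equal the double root 1
    of T^2 - 2 T + 1.\<close>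
  have "(l - 1) ^ 2 = l ^ 2 - l * 2 + 1"
    by (simp add: power2_eq_square algebra_simps)
  also have "\<dots> = l ^ 2 - l * (l * (1 + a)) + l ^ 2 * a"
    by (simp only: 1 2)
  finally have "(l - 1) ^ 2 = 0"
    by (simp add: power2_eq_square algebra_simps)
  then show ?thesis using 1 by simp
qed

subsection \<open>Degenerations between the types\<close>

lemmas types_traces =
  rep_traces[of "C4'", unfolded rep.simps kind.case]
  rep_traces[of "N3'", unfolded rep.simps kind.case]
  rep_traces[of "N4'", unfolded rep.simps kind.case]
  rep_traces[of "R2'", unfolded rep.simps kind.case]
  rep_traces[of "RR'", unfolded rep.simps kind.case]
  rep_traces[of "SL'", unfolded rep.simps kind.case]
  rep_traces[of "G1'", unfolded rep.simps kind.case]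
  rep_traces[of "G2' b", unfolded rep.simps kind.case]
  rep_traces[of "G3' b", unfolded rep.simps kind.case]
  rep_traces[of "G4' a b", unfolded rep.simps kind.case]
  rep_traces[of "G5' a", unfolded rep.simps kind.case]
  rep_traces[of "G6'", unfolded rep.simps kind.case]
  for a b

section \<open>Criteria for linear dependence\<close>

lemma not_basis4I:
  assumes "p *s a + q *s b + r *s c + s *s d = 0" "p \<noteq> 0 \<or> q \<noteq> 0 \<or> r \<noteq> 0 \<or> s \<noteq> 0"
  shows "\<not> basis4 a b c d"
proof
  assume "basis4 a b c d"
  moreover have "comb a b c d (p *s ee 1 + q *s ee 2 + r *s ee 3 + s *s ee 4) = 0"
    using assms(1) by (simp add: comb_def)
  ultimately have "p *s ee 1 + q *s ee 2 + r *s ee 3 + s *s ee 4 = 0"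
    by (simp only: basis4_def)
  then show False
    using assms(2) by (simp add: vec4_eq_iff)
qed

lemma not_basis4_parallel: "\<not> basis4 (p *s w) (q *s w) u v"
proof (cases "p = 0 \<and> q = 0")
  case True
  then show ?thesis by (intro not_basis4I[of 1 _ 0 _ 0 _ 0]) auto
next
  case False
  then show ?thesis
    by (intro not_basis4I[of q _ "- p" _ 0 _ 0]) (auto simp: vec4_eq_iff mult.commute)
qed

lemma not_basis4_functional:
  assumes "\<phi> \<noteq> 0" "\<And>v. v \<in> {a, b, c, d} \<Longrightarrow> (\<Sum>i\<in>UNIV. \<phi> $ i * v $ i) = 0"
  shows "\<not> basis4 a b c d"
proof
  assume b: "basis4 a b c d"
  have "\<phi> $ k = 0" for k
  proof -
    obtain x where x: "axis k 1 = comb a b c d x"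
      using comb_surj[OF b, of "axis k 1"] by blast
    have "(\<Sum>i\<in>UNIV. \<phi> $ i * comb a b c d x $ i) =
        x $ 1 * (\<Sum>i\<in>UNIV. \<phi> $ i * a $ i) + x $ 2 * (\<Sum>i\<in>UNIV. \<phi> $ i * b $ i) +
        x $ 3 * (\<Sum>i\<in>UNIV. \<phi> $ i * c $ i) + x $ 4 * (\<Sum>i\<in>UNIV. \<phi> $ i * d $ i)"
      by (simp add: comb_def sum_4 algebra_simps)
    also have "\<dots> = 0"
      using assms(2)[of a] assms(2)[of b] assms(2)[of c] assms(2)[of d] by simp
    finally have "(\<Sum>i\<in>UNIV. \<phi> $ i * axis k 1 $ i) = 0"
      by (simp only: x)
    then show ?thesis by (simp add: axis_def if_distrib cong: if_cong)
  qed
  then show False using assms(1) by (simp add: vec_eq_iff)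
qed

section \<open>Candidates below each type\<close>

lemma deg_from_C4:
  assumes "C4 \<leadsto> rep t" shows "t = C4'"
  by (rule rep_zero, rule zero_closed[OF types_algebra(1) assms])
    (simp add: types_alg4 alg4_apply)

lemma deg_from_n3_C:
  assumes "n3_C \<leadsto> rep t" shows "t = C4' \<or> t = N3'"
  by (rule rep_nilpotent2, rule nilpotent2_closed[OF types_algebra(2) assms])
    (simp add: types_alg4 alg4_compute)

lemma deg_from_n4:
  assumes "n4 \<leadsto> rep t" shows "t = C4' \<or> t = N3' \<or> t = N4'"
  by (rule rep_engel3, rule engel3_closed[OF types_algebra(3) assms])
    (simp add: types_alg4 alg4_compute)

lemma deg_from_g1:
  assumes "g1 \<leadsto> rep t" shows "t = C4' \<or> t = G1'"
proof (rule rep_planar, rule planar_closed[OF types_algebra(7) assms])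
  fix x y v
  show "\<not> basis4 x y (g1 x y) v"
    by (rule not_basis4I[of "- (y $ 1)" _ "x $ 1" _ "-1" _ 0])
      (simp_all add: types_alg4 alg4_compute algebra_simps)
qed

lemma deg_from_r2_C2:
  assumes "r2_C2 \<leadsto> rep t" shows "t = C4' \<or> t = N3' \<or> t = R2'"
proof -
  have "r2_C2 x y = (x $ 1 * y $ 2 - x $ 2 * y $ 1) *s ee 2" for x y
    by (simp add: types_alg4 alg4_apply)
  then have "\<not> basis4 (r2_C2 x y) (r2_C2 z w) u v" for x y z w u v
    by (simp only: not_basis4_parallel not_False_eq_True)
  then have "t = C4' \<or> t = N3' \<or> t = R2' \<or> t = G6'"
    by (intro rep_derived1) (rule derived1_closed[OF types_algebra(4) assms])
  moreover have "lie (rep t)"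
    using lie_closed[OF types_algebra(4) assms] rep_lie[of R2'] by simp
  then have "t \<noteq> G6'"
    using lie_rep by blast
  ultimately show ?thesis by blast
qed

lemma deg_from_g6:
  assumes "g6 \<leadsto> rep t" shows "t = C4' \<or> t = N3' \<or> t = R2' \<or> t = G6'"
proof -
  have "g6 x y = (x $ 1 * y $ 2 - x $ 2 * y $ 1 + x $ 3 * y $ 4 - x $ 4 * y $ 3) *s ee 3" for x y
    by (simp add: types_alg4 alg4_apply vec4_eq_iff)
  then have "\<not> basis4 (g6 x y) (g6 z w) u v" for x y z w u v
    by (simp only: not_basis4_parallel not_False_eq_True)
  then show ?thesis
    by (intro rep_derived1) (rule derived1_closed[OF types_algebra(12) assms])
qed

lemma deg_from_r2_r2:
  assumes "r2_r2 \<leadsto> rep t"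
  shows "case t of C4' \<Rightarrow> True | N3' \<Rightarrow> True | N4' \<Rightarrow> True | R2' \<Rightarrow> True | RR' \<Rightarrow> True
    | G2' b \<Rightarrow> b = 0 | G4' a b \<Rightarrow> a * b = 0 | G5' a \<Rightarrow> a = 0 | _ \<Rightarrow> False"
proof -
  have "\<not> basis4 (r2_r2 x y) (r2_r2 z w) (r2_r2 u v) p" for x y z w u v p
  proof -
    \<comment> \<open>The derived algebra is spanned by e2 and e4. The form \<phi> kills both, and
      also p; the default \<open>ee 1\<close> serves a p without components along e1 and e3.\<close>
    define \<phi> where "\<phi> = (if p $ 1 = 0 \<and> p $ 3 = 0 then ee 1 else p $ 3 *s ee 1 - p $ 1 *s ee 3)"
    have "\<phi> \<noteq> 0"
      by (auto simp: \<phi>_def vec4_eq_iff)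
    then show ?thesis
      by (rule not_basis4_functional)
        (auto simp: \<phi>_def types_alg4 alg4_apply sum_4)
  qed
  then have "case t of G1' \<Rightarrow> False | SL' \<Rightarrow> False | G2' b \<Rightarrow> b = 0 | G3' b \<Rightarrow> False
    | G4' a b \<Rightarrow> a * b = 0 | G5' a \<Rightarrow> a = 0 | _ \<Rightarrow> True"
    by (intro rep_derived2) (rule derived2_closed[OF types_algebra(5) assms])
  moreover have "lie (rep t)"
    using lie_closed[OF types_algebra(5) assms] rep_lie[of RR'] by simp
  then have "t \<noteq> G6'"
    using lie_rep by blast
  ultimately show ?thesis by (cases t) auto
qed

text \<open>The nonzero eigenvalues of a left multiplication in sl2 are opposite to each other, so
  the traces of the first and third power vanish. For a triple with sum 0 the third power sum is
  three times the product, whence the condition a b = 0.\<close>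

lemma deg_from_sl2_C:
  assumes "sl2_C \<leadsto> rep t"
  shows "case t of C4' \<Rightarrow> True | N3' \<Rightarrow> True | N4' \<Rightarrow> True | SL' \<Rightarrow> True
    | G4' a b \<Rightarrow> 1 + a + b = 0 \<and> a * b = 0 | G5' a \<Rightarrow> a = -1 | _ \<Rightarrow> False"
proof -
  have "\<exists>l. tr1 (rep t) (ee 1) = l * 0 \<and> tr2 (rep t) (ee 1) = l ^ 2 * 1 \<and> tr3 (rep t) (ee 1) = l ^ 3 * 0"
  proof (rule trace_closed[OF types_algebra(6) assms])
    fix x :: "complex ^ 4"
    have "(csqrt (tr2 sl2_C x)) ^ 2 = tr2 sl2_C x" by simp
    then show "\<exists>l. tr1 sl2_C x = l * 0 \<and> tr2 sl2_C x = l ^ 2 * 1 \<and> tr3 sl2_C x = l ^ 3 * 0"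
      using rep_traces[of SL' x] by (intro exI[of _ "csqrt (tr2 sl2_C x)"]) simp
  qed simp
  then have tr: "tr1 (rep t) (ee 1) = 0" "tr3 (rep t) (ee 1) = 0" by auto
  have "lie (rep t)"
    using lie_closed[OF types_algebra(6) assms] rep_lie[of SL'] by simp
  then have lie: "t \<noteq> G6'" "\<And>b. t = G3' b \<Longrightarrow> b = 2"
    using lie_rep by blast+
  show ?thesis
  proof (cases t)
    case (G2' b)
    then have "2 + b = 0" "2 + b ^ 3 = 0" using tr by (auto simp: types_traces)
    then have "(6::complex) = 0" by algebra
    then show ?thesis by simp
  next
    case (G4' a b)
    then have s: "1 + a + b = 0" "1 + a ^ 3 + b ^ 3 = 0" using tr by (auto simp: types_traces)
    then have "3 * (a * b) = 0" by algebra
    then show ?thesis using G4' s by simp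
  next
    case (G5' a)
    then have "2 * (1 + a) = 0" using tr(1) by (simp add: types_traces algebra_simps)
    then show ?thesis using G5' by (simp add: add_eq_0_iff)
  qed (use tr lie in \<open>auto simp: types_traces\<close>)
qed

text \<open>The candidates that the invariants leave below \<open>g4 a b\<close>, all of which are
  reachable by \<open>below_g4_reach\<close>. The same predicate serves \<open>g5 a\<close> with b =
  a + 1.\<close>

definition below_g4 :: "complex \<Rightarrow> complex \<Rightarrow> kind \<Rightarrow> bool" where
  "below_g4 a b t \<longleftrightarrow> (case t of C4' \<Rightarrow> True | N3' \<Rightarrow> True | N4' \<Rightarrow> True | R2' \<Rightarrow> proportional a b 0 0
     | G1' \<Rightarrow> proportional a b 1 1 | G2' c \<Rightarrow> proportional a b 1 c | G4' c d \<Rightarrow> proportional a b c d | _ \<Rightarrow> False)"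

lemma trace_proportional:
  assumes "is_algebra \<mu>" "\<mu> \<leadsto> rep t"
    and "\<And>x. \<exists>l. tr1 \<mu> x = l * (1 + a + b) \<and> tr2 \<mu> x = l ^ 2 * (1 + a ^ 2 + b ^ 2) \<and>
      tr3 \<mu> x = l ^ 3 * (1 + a ^ 3 + b ^ 3)"
  shows "case t of C4' \<Rightarrow> True | N3' \<Rightarrow> True | N4' \<Rightarrow> True | SL' \<Rightarrow> True | R2' \<Rightarrow> proportional a b 0 0
     | RR' \<Rightarrow> proportional a b 0 0 | G6' \<Rightarrow> proportional a b 0 0
     | G1' \<Rightarrow> proportional a b 1 1 | G2' c \<Rightarrow> proportional a b 1 c | G3' c \<Rightarrow> proportional a b 1 c | G4' c d \<Rightarrow> proportional a b c d
     | G5' c \<Rightarrow> proportional a b c (c + 1)"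
proof -
  have *: "\<exists>l. tr1 (rep t) x = l * (1 + a + b) \<and> tr2 (rep t) x = l ^ 2 * (1 + a ^ 2 + b ^ 2) \<and>
      tr3 (rep t) x = l ^ 3 * (1 + a ^ 3 + b ^ 3)" for x
    by (rule trace_closed[OF assms(1,2) power_sums_nonzero assms(3)])
  show ?thesis
    \<comment> \<open>The vector \<open>- ee 4\<close> is for \<open>G6'\<close>, whose traces
      involve only the fourth coordinate, with a sign.\<close>
    using *[of "ee 1"] *[of "- ee 4"]
    by (cases t; simp add: types_traces; intro proportionalI; simp add: ac_simps)
qed

text \<open>Products lie in an abelian ideal, on which x acts as \<open>x $ 1\<close> times e1. So
  all left multiplications are parallel there, which excludes the types with a richer action; the
  traces compare the parameters.\<close>

lemma deg_from_g4:
  assumes "g4 a b \<leadsto> rep t" shows "below_g4 a b t"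
proof -
  have "\<not> basis4 (g4 a b x (g4 a b z w)) (g4 a b y (g4 a b z w)) u v" for x y z w u v
  proof -
    define k where "k = g4 a b (ee 1) (g4 a b z w)"
    have "g4 a b x (g4 a b z w) = x $ 1 *s k" "g4 a b y (g4 a b z w) = y $ 1 *s k"
      by (simp_all add: k_def types_alg4 alg4_apply vec4_eq_iff algebra_simps)
    then show ?thesis by (simp add: not_basis4_parallel)
  qed
  then have 1: "case t of RR' \<Rightarrow> False | SL' \<Rightarrow> False | G3' b \<Rightarrow> False | G5' a \<Rightarrow> False | _ \<Rightarrow> True"
    by (intro rep_parallel) (rule parallel_closed[OF types_algebra(10) assms])
  have "lie (rep t)"
    using lie_closed[OF types_algebra(10) assms] rep_lie[of "G4' a b"] by simp
  then have "t \<noteq> G6'"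
    using lie_rep by blast
  moreover have "\<exists>l. tr1 (g4 a b) x = l * (1 + a + b) \<and> tr2 (g4 a b) x = l ^ 2 * (1 + a ^ 2 + b ^ 2) \<and>
      tr3 (g4 a b) x = l ^ 3 * (1 + a ^ 3 + b ^ 3)" for x
    using rep_traces[of "G4' a b" x] by (intro exI[of _ "x $ 1"]) (simp add: mult.commute)
  note trace_proportional[OF types_algebra(10) assms this]
  ultimately show ?thesis
    using 1 unfolding below_g4_def by (cases t) auto
qed

text \<open>The parallel condition fails for \<open>g5\<close> itself. Solvability excludes
  \<open>sl2_C\<close>, and the Lie identity leaves only \<open>g3 2\<close> among the
  \<open>g3\<close>, which the traces then tie to a = 1.\<close>

lemma deg_from_g5:
  assumes "g5 a \<leadsto> rep t"
  shows "(\<exists>c. t = G5' c \<and> proportional a (a + 1) c (c + 1)) \<or> (t = G3' 2 \<and> a = 1) \<or> below_g4 a (a + 1) t"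
proof -
  have "lie (rep t)"
    using lie_closed[OF types_algebra(11) assms] rep_lie[of "G5' a"] by simp
  then have "t \<noteq> G6'" "\<And>b. t = G3' b \<Longrightarrow> b = 2"
    using lie_rep by blast+
  moreover have "\<exists>l. tr1 (g5 a) x = l * (1 + a + (a + 1)) \<and>
      tr2 (g5 a) x = l ^ 2 * (1 + a ^ 2 + (a + 1) ^ 2) \<and>
      tr3 (g5 a) x = l ^ 3 * (1 + a ^ 3 + (a + 1) ^ 3)" for x
    using rep_traces[of "G5' a" x] by (intro exI[of _ "x $ 1"]) (simp add: algebra_simps)
  note trace_proportional[OF types_algebra(11) assms this]
  moreover have "g5 a (g5 a (g5 a x y) (g5 a z w)) (g5 a u v) = 0" for x y z w u v
    by (simp add: types_alg4 alg4_apply vec4_eq_iff)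
  then have "t \<noteq> SL'"
    by (intro rep_solvable3) (rule solvable3_closed[OF types_algebra(11) assms])
  ultimately show ?thesis
    using not_proportional_sum_0[of a] proportional_sum_1_2[of a] unfolding below_g4_def by (cases t) auto
qed

lemma deg_from_g2:
  assumes "g2 b \<leadsto> rep t"
  shows "t = C4' \<or> t = N3' \<or> t = G2' b \<or> (t = G1' \<and> b = 1)"
proof -
  have "lie (rep t)"
    using lie_closed[OF types_algebra(8) assms] rep_lie[of "G2' b"] by simp
  then have "t \<noteq> G6'" "\<And>b. t = G3' b \<Longrightarrow> b = 2"
    using lie_rep by blast+
  moreover have "\<exists>l. tr1 (g2 b) x = l * (1 + 1 + b) \<and> tr2 (g2 b) x = l ^ 2 * (1 + 1 ^ 2 + b ^ 2) \<and>
      tr3 (g2 b) x = l ^ 3 * (1 + 1 ^ 3 + b ^ 3)" for x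
    using rep_traces[of "G2' b" x] by (intro exI[of _ "x $ 1"]) (simp add: algebra_simps)
  note trace_proportional[OF types_algebra(8) assms this]
  moreover have "\<not> basis4 (g2 b x (g2 b z w)) (g2 b y (g2 b z w)) u v" for x y z w u v
  proof -
    define k where "k = g2 b (ee 1) (g2 b z w)"
    have "g2 b x (g2 b z w) = x $ 1 *s k" "g2 b y (g2 b z w) = y $ 1 *s k"
      by (simp_all add: k_def types_alg4 alg4_apply vec4_eq_iff algebra_simps)
    then show ?thesis by (simp add: not_basis4_parallel)
  qed
  then have "case t of RR' \<Rightarrow> False | SL' \<Rightarrow> False | G3' b \<Rightarrow> False | G5' a \<Rightarrow> False | _ \<Rightarrow> True"
    by (intro rep_parallel) (rule parallel_closed[OF types_algebra(8) assms])
  moreover have "\<not> basis4 x y (g2 b x y) (g2 b x (g2 b x y))" for x y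
    \<comment> \<open>With L the left multiplication by x and x1 its first coordinate, (L - x1)(L -
      b x1) vanishes on the ideal. Applied to \<open>x $ 1 *s y - y $ 1 *s x\<close>, a vector of
      the ideal, it yields x1 times this relation.\<close>
    by (rule not_basis4I[of "- (x $ 1 * y $ 1 * b)" _ "x $ 1 ^ 2 * b" _ "- (x $ 1 * (1 + b))" _ 1])
      (simp_all add: types_alg4 alg4_apply vec4_eq_iff algebra_simps power2_eq_square)
  then have "case t of N4' \<Rightarrow> False | RR' \<Rightarrow> False | SL' \<Rightarrow> False | G4' a b \<Rightarrow> False
      | G5' a \<Rightarrow> False | _ \<Rightarrow> True"
    by (intro rep_regular) (rule irregular_closed[OF types_algebra(8) assms])
  ultimately show ?thesis
    using not_proportional_1_0[of b] proportional_1_1[of b] by (cases t) auto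
qed

lemma deg_from_g3:
  assumes "g3 b \<leadsto> rep t"
  shows "t = C4' \<or> t = N3' \<or> t = G2' b \<or> t = G3' b \<or> (t = G1' \<and> b = 1)"
proof -
  have "\<exists>l. tr1 (g3 b) x = l * (1 + 1 + b) \<and> tr2 (g3 b) x = l ^ 2 * (1 + 1 ^ 2 + b ^ 2) \<and>
      tr3 (g3 b) x = l ^ 3 * (1 + 1 ^ 3 + b ^ 3)" for x
    using rep_traces[of "G3' b" x] by (intro exI[of _ "x $ 1"]) (simp add: algebra_simps)
  note trace_proportional[OF types_algebra(9) assms this]
  moreover have "\<not> basis4 x y (g3 b x y) (g3 b x (g3 b x y))" for x y
    by (rule not_basis4I[of "- (x $ 1 * y $ 1 * b)" _ "x $ 1 ^ 2 * b" _ "- (x $ 1 * (1 + b))" _ 1])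
      (simp_all add: types_alg4 alg4_apply vec4_eq_iff algebra_simps power2_eq_square)
  then have "case t of N4' \<Rightarrow> False | RR' \<Rightarrow> False | SL' \<Rightarrow> False | G4' a b \<Rightarrow> False
      | G5' a \<Rightarrow> False | _ \<Rightarrow> True"
    by (intro rep_regular) (rule irregular_closed[OF types_algebra(9) assms])
  ultimately show ?thesis
    using not_proportional_1_0[of b] proportional_1_1[of b] by (cases t) auto
qed

subsection \<open>Algebras with an ideal of codimension one\<close>

definition classified :: "4 mult \<Rightarrow> bool" where
  "classified \<mu> \<longleftrightarrow> (\<exists>t. \<mu> \<cong>\<^sub>a rep t)"

lemma classified_iso: "\<mu> \<cong>\<^sub>a \<nu> \<Longrightarrow> classified \<nu> \<Longrightarrow> classified \<mu>"
  unfolding classified_def using iso_trans by blast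

lemma classifiedI: "\<mu> \<cong>\<^sub>a rep t \<Longrightarrow> classified \<mu>"
  unfolding classified_def by blast

lemma quadratic_roots:
  fixes p q :: complex
  obtains a b where "a + b = p" "a * b = q"
proof -
  define s where "s = csqrt (p ^ 2 - 4 * q)"
  have "s ^ 2 = p ^ 2 - 4 * q" by (simp add: s_def)
  then have "(p + s) / 2 * ((p - s) / 2) = q"
    by (simp add: field_simps power2_eq_square)
  moreover have "(p + s) / 2 + (p - s) / 2 = p" by (simp add: field_simps)
  ultimately show thesis using that by blast
qed

lemma cubic_roots:
  fixes s1 s2 s3 :: complex
  obtains a b c where "a + b + c = s1" "a * b + b * c + a * c = s2" "a * b * c = s3"
proof -
  have "\<not> constant (poly [:- s3, s2, - s1, 1:])"
    by (simp add: constant_degree)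
  then obtain a where "poly [:- s3, s2, - s1, 1:] a = 0"
    using fundamental_theorem_of_algebra by blast
  then have a: "a * (s2 - a * (s1 - a)) = s3"
    by (simp add: algebra_simps)
  obtain b c where bc: "b + c = s1 - a" "b * c = s2 - a * (s1 - a)"
    by (rule quadratic_roots)
  have "a + b + c = s1" using bc(1) by (simp add: algebra_simps)
  moreover have "a * b + b * c + a * c = s2" using bc by algebra
  moreover have "a * b * c = s3" using a bc(2) by (simp add: mult.assoc)
  ultimately show thesis by (rule that)
qed

text \<open>The characteristic polynomial splits. A nonzero root can be scaled to 1, which gives a
  \<open>g4\<close>; without one the action is nilpotent.\<close>

lemma companion_classified: "classified (companion s1 s2 s3)"
proof -
  obtain a b c where s: "a + b + c = s1" "a * b + b * c + a * c = s2" "a * b * c = s3"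
    by (rule cubic_roots)
  have *: "classified (companion s1 s2 s3)"
    if "r \<noteq> 0" "s1 = r + p + q" "s2 = r * p + p * q + r * q" "s3 = r * p * q" for p q r
  proof (rule classifiedI[where t = "G4' (p / r) (q / r)"])
    have "s1 = r * (1 + p / r + q / r)" "s2 = r ^ 2 * (p / r + q / r + p / r * (q / r))"
      "s3 = r ^ 3 * (p / r * (q / r))"
      using that by (simp_all add: field_simps power2_eq_square power3_eq_cube)
    then have "companion (1 + p / r + q / r) (p / r + q / r + p / r * (q / r)) (p / r * (q / r)) \<cong>\<^sub>a companion s1 s2 s3"
      by (simp only: companion_scale[OF \<open>r \<noteq> 0\<close>])
    then have "g4 (p / r) (q / r) \<cong>\<^sub>a companion s1 s2 s3"
      using iso_trans[OF g4_companion[of "p / r" "q / r"]] by blast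
    then show "companion s1 s2 s3 \<cong>\<^sub>a rep (G4' (p / r) (q / r))"
      by (simp add: iso_sym)
  qed
  consider "a \<noteq> 0" | "b \<noteq> 0" | "c \<noteq> 0" | "a = 0" "b = 0" "c = 0" by blast
  then show ?thesis
  proof cases
    case 1 then show ?thesis using *[of a b c] s by auto
  next
    case 2 then show ?thesis using *[of b a c] s by (auto simp: algebra_simps)
  next
    case 3 then show ?thesis using *[of c a b] s by (auto simp: algebra_simps)
  next
    case 4
    then have "companion s1 s2 s3 = n4" using s companion_0 by auto
    then show ?thesis using iso_refl[of n4] by (intro classifiedI[where t = N4']) simp
  qed
qed

lemma heisenberg_companion_classified: "classified (heisenberg_companion m1 m2)"
proof -
  obtain a b where m: "a + b = m1" "a * b = m2"
    by (rule quadratic_roots)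
  have *: "classified (heisenberg_companion m1 m2)" if "r \<noteq> 0" "m1 = r + p" "m2 = r * p" for p r
  proof (rule classifiedI[where t = "G5' (p / r)"])
    have "m1 = r * (1 + p / r)" "m2 = r ^ 2 * (p / r)"
      using that by (simp_all add: field_simps power2_eq_square)
    then have "heisenberg_companion (1 + p / r) (p / r) \<cong>\<^sub>a heisenberg_companion m1 m2"
      by (simp only: heisenberg_companion_scale[OF \<open>r \<noteq> 0\<close>])
    then have "g5 (p / r) \<cong>\<^sub>a heisenberg_companion m1 m2"
      using iso_trans[OF g5_heisenberg_companion[of "p / r"]] by blast
    then show "heisenberg_companion m1 m2 \<cong>\<^sub>a rep (G5' (p / r))"
      by (simp add: iso_sym)
  qed
  consider "a \<noteq> 0" | "b \<noteq> 0" | "a = 0" "b = 0" by blast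
  then show ?thesis
  proof cases
    case 1 then show ?thesis using *[of a b] m by auto
  next
    case 2 then show ?thesis using *[of b a] m by (auto simp: algebra_simps)
  next
    case 3
    have "heisenberg_companion 0 0 \<cong>\<^sub>a rep N4'"
      unfolding heisenberg_companion_def rep.simps types_alg4
      by (rule alg4_iso'[where u = "ee 2" and v = "ee 1" and w = "- ee 3" and z = "- ee 4"])
        (auto simp: alg4_compute)
    then show ?thesis using 3 m by (intro classifiedI[where t = N4']) auto
  qed
qed

definition det3 :: "complex ^ 4 \<Rightarrow> complex ^ 4 \<Rightarrow> complex ^ 4 \<Rightarrow> complex" where
  "det3 u v w = u $ 2 * (v $ 3 * w $ 4 - v $ 4 * w $ 3) - u $ 3 * (v $ 2 * w $ 4 - v $ 4 * w $ 2)
     + u $ 4 * (v $ 2 * w $ 3 - v $ 3 * w $ 2)"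

lemma basis4_det3:
  assumes "u $ 1 = 0" "v $ 1 = 0" "w $ 1 = 0" "det3 u v w \<noteq> 0"
  shows "basis4 (ee 1) u v w"
  unfolding basis4_def
proof (intro allI impI)
  fix x assume *: "comb (ee 1) u v w x = 0"
  have 1: "x $ 1 = 0" and e: "x $ 2 * u $ 2 + x $ 3 * v $ 2 + x $ 4 * w $ 2 = 0"
    "x $ 2 * u $ 3 + x $ 3 * v $ 3 + x $ 4 * w $ 3 = 0"
    "x $ 2 * u $ 4 + x $ 3 * v $ 4 + x $ 4 * w $ 4 = 0"
    using * assms(1-3) by (simp_all add: comb_def vec4_eq_iff)
  have "x $ 2 * det3 u v w = 0" "x $ 3 * det3 u v w = 0" "x $ 4 * det3 u v w = 0"
    using e unfolding det3_def by algebra+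
  then show "x = 0"
    using 1 assms(4) by (simp add: vec4_eq_iff)
qed

section \<open>Extensions of an abelian ideal\<close>

context
  fixes a b c :: "complex ^ 4"
  assumes K: "a $ 1 = 0" "b $ 1 = 0" "c $ 1 = 0"
begin

lemma abelian_cyclic:
  fixes y :: "complex ^ 4"
  defines "\<mu> \<equiv> alg4 a b c 0 0 0"
  assumes "y $ 1 = 0" "det3 y (\<mu> (ee 1) y) (\<mu> (ee 1) (\<mu> (ee 1) y)) \<noteq> 0"
  shows "classified \<mu>"
proof -
  have in_K: "\<mu> x z $ 1 = 0" for x z
    by (simp add: \<mu>_def alg4_apply K)
  have basis: "basis4 (ee 1) y (\<mu> (ee 1) y) (\<mu> (ee 1) (\<mu> (ee 1) y))"
    by (rule basis4_det3) (use assms in_K in auto)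
  obtain s where s: "\<mu> (ee 1) (\<mu> (ee 1) (\<mu> (ee 1) y))
      = comb (ee 1) y (\<mu> (ee 1) y) (\<mu> (ee 1) (\<mu> (ee 1) y)) s"
    using comb_surj[OF basis] by blast
  have "comb (ee 1) y (\<mu> (ee 1) y) (\<mu> (ee 1) (\<mu> (ee 1) y)) s $ 1 = 0"
    unfolding s[symmetric] by (rule in_K)
  then have "s $ 1 = 0"
    by (simp add: comb_def in_K assms(2))
  then have s': "\<mu> (ee 1) (\<mu> (ee 1) (\<mu> (ee 1) y))
      = s $ 2 *s y - (- s $ 3) *s \<mu> (ee 1) y + s $ 4 *s \<mu> (ee 1) (\<mu> (ee 1) y)"
    unfolding s comb_def by (simp add: vec4_eq_iff)
  have zero: "\<mu> p q = 0" if "p $ 1 = 0" "q $ 1 = 0" for p q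
    using that by (simp add: \<mu>_def alg4_apply)
  have "\<mu> \<cong>\<^sub>a companion (s $ 4) (- s $ 3) (s $ 2)"
    by (rule iso_companion[where \<mu> = \<mu> and x = "ee 1" and y = y, OF _ _ basis s'])
      (simp_all add: zero in_K assms(2), simp_all add: \<mu>_def alg4_algebra alg4_self)
  then show ?thesis
    by (rule classified_iso[OF _ companion_classified])
qed

end

text \<open>Without a cyclic vector the action of e1 on the ideal has a repeated eigenvalue r with
  two independent eigenvectors, and a third eigenvalue b. The cases depend on which of r and b
  vanish.\<close>

lemma abelian_noncyclic:
  assumes K: "c $ 1 = 0" "d $ 1 = 0"
  shows "classified (alg4 (ee 3) c d 0 0 0)" (is "classified ?\<mu>")
proof (cases "\<exists>y. y $ 1 = 0 \<and> det3 y (?\<mu> (ee 1) y) (?\<mu> (ee 1) (?\<mu> (ee 1) y)) \<noteq> 0")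
  case True
  then show ?thesis
    using abelian_cyclic[of "ee 3" c d] K by auto
next
  case False
  then have nc: "det3 y (?\<mu> (ee 1) y) (?\<mu> (ee 1) (?\<mu> (ee 1) y)) = 0" if "y $ 1 = 0" for y
    using that by blast
  have c4: "c $ 4 = 0"
    using nc[of "ee 2"] by (simp add: det3_def alg4_apply K)
  define p q r s t where "p = c $ 3" and "q = c $ 2" and "r = d $ 4" and "s = d $ 2" and "t = d $ 3"
  have c: "c = q *s ee 2 + p *s ee 3" and d: "d = s *s ee 2 + t *s ee 3 + r *s ee 4"
    using c4 K by (simp_all add: vec4_eq_iff p_def q_def r_def s_def t_def)
  \<comment> \<open>For y = e4 - t e2 the part along e3 cancels: e1 y = r y + (s + r t) e2. So y is
    cyclic unless s + r t = 0, and then it is an eigenvector for r.\<close>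
  have "(s + r * t) ^ 2 = 0"
    using nc[of "ee 4 - t *s ee 2"]
    by (simp add: det3_def alg4_apply c d power2_eq_square algebra_simps)
  then have s: "s = - (r * t)"
    by (simp add: add_eq_0_iff2)
  \<comment> \<open>Adding e2 to this eigenvector, the lack of a cyclic vector forces r to be an
    eigenvalue on the span of e2 and e3 too; b is the other eigenvalue there.\<close>
  have q: "q = r * r - r * p"
    using nc[of "ee 4 + (1 - t) *s ee 2"]
    by (simp add: det3_def alg4_apply c d s) algebra
  define b where "b = p - r"
  have c': "c = (- (r * b)) *s ee 2 + (r + b) *s ee 3" and d': "d = (- (r * t)) *s ee 2 + t *s ee 3 + r *s ee 4"
    by (simp_all add: c d s q b_def algebra_simps)
  consider "r \<noteq> 0" | "r = 0" "b \<noteq> 0" | "r = 0" "b = 0" by blast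
  then show ?thesis
  proof cases
    case 1
    have "?\<mu> \<cong>\<^sub>a rep (G2' (b / r))"
      unfolding rep.simps types_alg4 c' d'
      by (rule alg4_iso'[where u = "(1 / r) *s ee 1" and v = "ee 4 - t *s ee 2"
            and w = "(1 / r) *s ee 3 - (b / r) *s ee 2" and z = "ee 2"])
        (use 1 in \<open>auto simp: alg4_compute field_simps\<close>)
    then show ?thesis by (rule classifiedI)
  next
    case 2
    have "?\<mu> \<cong>\<^sub>a rep R2'"
      unfolding rep.simps types_alg4 c' d'
      by (rule alg4_iso'[where u = "(1 / b) *s ee 1" and v = "ee 3"
            and w = "ee 2 - (1 / b) *s ee 3" and z = "ee 4 - t *s ee 2"])
        (use 2 in \<open>auto simp: alg4_compute field_simps\<close>)
    then show ?thesis by (rule classifiedI)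
  next
    case 3
    have "?\<mu> \<cong>\<^sub>a rep N3'"
      unfolding rep.simps types_alg4 c' d'
      by (rule alg4_iso'[where u = "ee 1" and v = "ee 2"
            and w = "ee 3" and z = "ee 4 - t *s ee 2"])
        (use 3 in \<open>auto simp: alg4_compute field_simps\<close>)
    then show ?thesis by (rule classifiedI)
  qed
qed

text \<open>Either some y is independent of e1 y, and a basis with e1 e2 = e3 exists, or every
  vector of the ideal is an eigenvector, so that e1 acts as a scalar.\<close>

lemma abelian_classified:
  assumes K: "a $ 1 = 0" "b $ 1 = 0" "c $ 1 = 0"
  shows "classified (alg4 a b c 0 0 0)" (is "classified ?\<mu>")
proof -
  have *: "classified ?\<mu>" if "y $ 1 = 0" "z $ 1 = 0" "det3 y (?\<mu> (ee 1) y) z \<noteq> 0" for y z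
  proof -
    have in_K: "?\<mu> x z $ 1 = 0" for x z
      by (simp add: alg4_apply K)
    have zero: "?\<mu> p q = 0" if "p $ 1 = 0" "q $ 1 = 0" for p q
      using that by (simp add: alg4_apply)
    have basis: "basis4 (ee 1) y (?\<mu> (ee 1) y) z"
      by (rule basis4_det3) (use that in_K in auto)
    obtain d where d: "?\<mu> (ee 1) (?\<mu> (ee 1) y) = comb (ee 1) y (?\<mu> (ee 1) y) z d"
      using comb_surj[OF basis] by blast
    obtain e where e: "?\<mu> (ee 1) z = comb (ee 1) y (?\<mu> (ee 1) y) z e"
      using comb_surj[OF basis] by blast
    have "comb (ee 1) y (?\<mu> (ee 1) y) z d $ 1 = 0" "comb (ee 1) y (?\<mu> (ee 1) y) z e $ 1 = 0"
      unfolding d[symmetric] e[symmetric] by (rule in_K)+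
    then have de: "d $ 1 = 0" "e $ 1 = 0"
      by (simp_all add: comb_def in_K that(1,2))
    have "?\<mu> \<cong>\<^sub>a alg4 (ee 3) d e 0 0 0"
      by (rule alg4_iso[OF alg4_algebra alg4_self basis _ d e])
        (simp_all add: zero in_K that(1,2), simp_all add: comb_def)
    then show ?thesis
      by (rule classified_iso) (rule abelian_noncyclic[OF de])
  qed
  show ?thesis
  proof (rule ccontr)
    assume "\<not> ?thesis"
    then have n: "det3 y (?\<mu> (ee 1) y) z = 0" if "y $ 1 = 0" "z $ 1 = 0" for y z
      using that * by blast
    have "a $ 3 = 0" "a $ 4 = 0" "b $ 2 = 0" "b $ 4 = 0" "c $ 2 = 0" "c $ 3 = 0"
      using n[of "ee 2" "ee 4"] n[of "ee 2" "ee 3"] n[of "ee 3" "ee 4"] n[of "ee 3" "ee 2"]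
        n[of "ee 4" "ee 3"] n[of "ee 4" "ee 2"]
      by (simp_all add: det3_def alg4_apply)
    moreover from this have "a $ 2 = b $ 3" "a $ 2 = c $ 4"
      using n[of "ee 2 + ee 3" "ee 4"] n[of "ee 2 + ee 4" "ee 3"]
      by (simp_all add: det3_def alg4_apply)
    ultimately have abc: "a = (a $ 2) *s ee 2" "b = (a $ 2) *s ee 3" "c = (a $ 2) *s ee 4"
      using K by (simp_all add: vec4_eq_iff)
    define m where "m = a $ 2"
    note abc = abc[folded m_def]
    have "classified ?\<mu>"
    proof (cases "m = 0")
      case True
      then have "?\<mu> = rep C4'" using abc by (simp add: types_alg4)
      then show ?thesis using classifiedI iso_refl by metis
    next
      case False
      have "?\<mu> \<cong>\<^sub>a rep G1'"
        unfolding rep.simps types_alg4 abc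
        by (rule alg4_iso'[where u = "(1 / m) *s ee 1" and v = "ee 2" and w = "ee 3" and z = "ee 4"])
          (use False in \<open>auto simp: alg4_compute\<close>)
      then show ?thesis by (rule classifiedI)
    qed
    with \<open>\<not> ?thesis\<close> show False by blast
  qed
qed

text \<open>The Jacobi identity makes e1 act on the centre by the trace of its action on the
  quotient. If that action is not scalar, it has a cyclic vector and the companion form applies; the
  scalar actions give \<open>n3_C\<close> and \<open>g3 2\<close>.\<close>

lemma heisenberg_classified:
  assumes K: "a $ 1 = 0" "b $ 1 = 0" "c $ 1 = 0" and lie: "lie (alg4 a b c (ee 4) 0 0)"
  shows "classified (alg4 a b c (ee 4) 0 0)"
proof -
  have J: "jacobian (alg4 a b c (ee 4) 0 0) (ee 1) (ee 2) (ee 3) = 0"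
    using lie by (simp add: lie_def)
  define p q r s where "p = a $ 2" and "q = a $ 3" and "r = b $ 2" and "s = b $ 3"
  have c: "c = (p + s) *s ee 4"
    using J K unfolding p_def s_def by (simp add: jacobian_def alg4_apply vec4_eq_iff algebra_simps)
  define \<nu> where "\<nu> = alg4 (p *s ee 2 + q *s ee 3) (r *s ee 2 + s *s ee 3) ((p + s) *s ee 4) (ee 4) 0 0"
  have iso: "alg4 a b c (ee 4) 0 0 \<cong>\<^sub>a \<nu>"
    unfolding \<nu>_def c
    \<comment> \<open>Inner derivations by e2 and e3 remove the components of e1 e2 and e1 e3 along
      the centre e4.\<close>
    by (rule alg4_iso'[where u = "ee 1 - b $ 4 *s ee 2 + a $ 4 *s ee 3" and v = "ee 2" and w = "ee 3" and z = "ee 4"])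
      (auto simp: alg4_compute K p_def q_def r_def s_def)
  have "classified \<nu>"
  proof -
    have cyclic: "classified \<nu>" if "y = k *s ee 2 + l *s ee 3"
      "k * (k * q + l * s) - l * (k * p + l * r) \<noteq> 0" for y k l
    proof -
      have "\<nu> \<cong>\<^sub>a heisenberg_companion (p + s) (p * s - q * r)"
        unfolding \<nu>_def
      proof (rule iso_heisenberg_companion'[where x = "ee 1" and y = y], goal_cases)
        case 1
        have "basis4 (ee 1) y ((k * p + l * r) *s ee 2 + (k * q + l * s) *s ee 3)
            ((k * (k * q + l * s) - l * (k * p + l * r)) *s ee 4)"
          by (rule basis4_det3) (use that in \<open>auto simp: det3_def\<close>)
        then show ?case
          by (simp add: alg4_apply that(1) algebra_simps)
      qed (simp_all add: alg4_compute that(1) algebra_simps)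
      then show ?thesis by (rule classified_iso[OF _ heisenberg_companion_classified])
    qed
    consider "q \<noteq> 0" | "r \<noteq> 0" | "p \<noteq> s" | "q = 0" "r = 0" "p = s" "p = 0"
      | "q = 0" "r = 0" "p = s" "p \<noteq> 0" by blast
    then show ?thesis
    proof cases
      case 1 then show ?thesis using cyclic[of _ 1 0] by simp
    next
      case 2 then show ?thesis using cyclic[of _ 0 1] by simp
    next
      case 3
      show ?thesis
      proof (cases "q = 0 \<and> r = 0")
        case True then show ?thesis using cyclic[of _ 1 1] 3 by simp
      next
        case False then show ?thesis using cyclic[of _ 1 0] cyclic[of _ 0 1] by auto
      qed
    next
      case 4
      have "\<nu> \<cong>\<^sub>a rep N3'"
        unfolding \<nu>_def rep.simps types_alg4
        by (rule alg4_iso'[where u = "ee 2" and v = "ee 3" and w = "ee 4" and z = "ee 1"])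
          (use 4 in \<open>auto simp: alg4_compute\<close>)
      then show ?thesis by (rule classifiedI)
    next
      case 5
      have "\<nu> \<cong>\<^sub>a rep (G3' 2)"
        unfolding \<nu>_def rep.simps types_alg4
        by (rule alg4_iso'[where u = "(1 / p) *s ee 1" and v = "ee 2" and w = "ee 3" and z = "ee 4"])
          (use 5 in \<open>auto simp: alg4_compute\<close>)
      then show ?thesis by (rule classifiedI)
    qed
  qed
  then show ?thesis by (rule classified_iso[OF iso])
qed

text \<open>Modulo inner derivations e1 acts as a scalar m on e3 and e4, and the Jacobi identity
  gives k m = 0. A nonzero k yields \<open>sl2_C\<close> and a nonzero m yields
  \<open>r2_r2\<close>; otherwise e2 acts on an abelian ideal with eigenvalues 0, 1, -1.\<close>

lemma semisimple_classified:
  assumes K: "a $ 1 = 0" "b $ 1 = 0" "c $ 1 = 0" and lie: "lie (alg4 a b c (ee 3) (- ee 4) (k *s ee 2))"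
  shows "classified (alg4 a b c (ee 3) (- ee 4) (k *s ee 2))" (is "classified ?\<mu>")
proof -
  have J: "jacobian ?\<mu> (ee 1) (ee 2) (ee 3) = 0" "jacobian ?\<mu> (ee 1) (ee 2) (ee 4) = 0"
    "jacobian ?\<mu> (ee 1) (ee 3) (ee 4) = 0"
    using lie by (simp_all add: lie_def)
  note J' = J[unfolded jacobian_def alg4_apply vec4_eq_iff, simplified, simplified K, simplified]
  define s t v w where "s = a $ 3" and "t = a $ 4" and "v = b $ 3" and "w = c $ 4"
  have a: "a = s *s ee 3 + t *s ee 4" and b: "b = (- (t * k)) *s ee 2 + v *s ee 3"
    and c: "c = (- (s * k)) *s ee 2 + w *s ee 4" and k: "k * (v + w) = 0"
    using J' K unfolding s_def t_def v_def w_def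
    by (simp_all add: vec4_eq_iff algebra_simps)
  define m where "m = (v + w) / 2"
  have km: "k * m = 0" using k by (simp add: m_def)
  have iso: "?\<mu> \<cong>\<^sub>a alg4 0 (m *s ee 3) (m *s ee 4) (ee 3) (- ee 4) (k *s ee 2)"
    unfolding a b c
    by (rule alg4_iso'[where u = "ee 1 - ((v - w) / 2) *s ee 2 + s *s ee 3 - t *s ee 4" and v = "ee 2"
          and w = "ee 3" and z = "ee 4"])
      (auto simp: alg4_compute m_def field_simps)
  consider "k \<noteq> 0" "m = 0" | "k = 0" "m \<noteq> 0" | "k = 0" "m = 0" using km by auto
  then have "classified (alg4 0 (m *s ee 3) (m *s ee 4) (ee 3) (- ee 4) (k *s ee 2))"
  proof cases
    case 1
    have "alg4 0 (m *s ee 3) (m *s ee 4) (ee 3) (- ee 4) (k *s ee 2) \<cong>\<^sub>a rep SL'"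
      unfolding rep.simps types_alg4
      by (rule alg4_iso'[where u = "ee 2" and v = "(1 / k) *s ee 3" and w = "ee 4" and z = "ee 1"])
        (use 1 in \<open>auto simp: alg4_compute\<close>)
    then show ?thesis by (rule classifiedI)
  next
    case 2
    have "alg4 0 (m *s ee 3) (m *s ee 4) (ee 3) (- ee 4) (k *s ee 2) \<cong>\<^sub>a rep RR'"
      unfolding rep.simps types_alg4
      by (rule alg4_iso'[where u = "(1 / (2 * m)) *s ee 1 + (1/2) *s ee 2" and v = "ee 3"
            and w = "(1 / (2 * m)) *s ee 1 - (1/2) *s ee 2" and z = "ee 4"])
        (use 2 in \<open>auto simp: alg4_compute field_simps\<close>)
    then show ?thesis by (rule classifiedI)
  next
    case 3
    have "alg4 0 (m *s ee 3) (m *s ee 4) (ee 3) (- ee 4) (k *s ee 2) \<cong>\<^sub>a companion 0 (-1) 0"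
      unfolding companion_def
      by (rule alg4_iso'[where u = "ee 2" and v = "ee 1 + ee 3 + ee 4" and w = "ee 3 - ee 4" and z = "ee 3 + ee 4"])
        (use 3 in \<open>auto simp: alg4_compute\<close>)
    then show ?thesis by (rule classified_iso[OF _ companion_classified])
  qed
  then show ?thesis by (rule classified_iso[OF iso])
qed

subsection \<open>Classification of the Lie algebras\<close>

lemma iso_lie:
  assumes "is_algebra \<mu>" "is_algebra \<nu>" "\<mu> \<cong>\<^sub>a \<nu>" "lie \<mu>" shows "lie \<nu>"
  using lie_closed[OF assms(1) iso_degenerates[OF assms(1-3)] assms(4)] .

lemma comb_ee:
  "comb u v w z (ee 1) = u" "comb u v w z (ee 2) = v" "comb u v w z (ee 3) = w"
  "comb u v w z (ee 4) = z"
  by (simp_all add: comb_def)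

section \<open>Linear forms and their kernels\<close>

definition lf :: "complex ^ 4 \<Rightarrow> complex ^ 4 \<Rightarrow> complex" where
  "lf \<phi> v = \<phi> $ 1 * v $ 1 + \<phi> $ 2 * v $ 2 + \<phi> $ 3 * v $ 3 + \<phi> $ 4 * v $ 4"

lemma lf_simps:
  "lf \<phi> (v + w) = lf \<phi> v + lf \<phi> w" "lf \<phi> (v - w) = lf \<phi> v - lf \<phi> w" "lf \<phi> (c *s v) = c * lf \<phi> v"
  "lf \<phi> 0 = 0" "lf \<phi> (- v) = - lf \<phi> v"
  by (simp_all add: lf_def algebra_simps)

lemma basis4_change:
  assumes "basis4 a b c d" "\<And>x. comb a' b' c' d' x = comb a b c d (X x)" "\<And>x. X x = 0 \<Longrightarrow> x = 0"
  shows "basis4 a' b' c' d'"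
  using assms(1,3) unfolding basis4_def assms(2) by blast

lemma kernel_basis:
  assumes "\<phi> \<noteq> 0"
  shows "\<exists>x u v w. basis4 x u v w \<and> lf \<phi> x = 1 \<and> lf \<phi> u = 0 \<and> lf \<phi> v = 0 \<and> lf \<phi> w = 0"
proof -
  consider "\<phi> $ 1 \<noteq> 0" | "\<phi> $ 2 \<noteq> 0" | "\<phi> $ 3 \<noteq> 0" | "\<phi> $ 4 \<noteq> 0"
    using assms by (auto simp: vec4_eq_iff)
  then show ?thesis
  proof cases
    case 1
    then show ?thesis
      by (intro exI[of _ "(1 / \<phi> $ 1) *s ee 1"] exI[of _ "ee 2 - (\<phi> $ 2 / \<phi> $ 1) *s ee 1"]
          exI[of _ "ee 3 - (\<phi> $ 3 / \<phi> $ 1) *s ee 1"] exI[of _ "ee 4 - (\<phi> $ 4 / \<phi> $ 1) *s ee 1"])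
        (auto simp: lf_def basis4_def comb_def vec4_eq_iff)
  next
    case 2
    then show ?thesis
      by (intro exI[of _ "(1 / \<phi> $ 2) *s ee 2"] exI[of _ "ee 1 - (\<phi> $ 1 / \<phi> $ 2) *s ee 2"]
          exI[of _ "ee 3 - (\<phi> $ 3 / \<phi> $ 2) *s ee 2"] exI[of _ "ee 4 - (\<phi> $ 4 / \<phi> $ 2) *s ee 2"])
        (auto simp: lf_def basis4_def comb_def vec4_eq_iff)
  next
    case 3
    then show ?thesis
      by (intro exI[of _ "(1 / \<phi> $ 3) *s ee 3"] exI[of _ "ee 1 - (\<phi> $ 1 / \<phi> $ 3) *s ee 3"]
          exI[of _ "ee 2 - (\<phi> $ 2 / \<phi> $ 3) *s ee 3"] exI[of _ "ee 4 - (\<phi> $ 4 / \<phi> $ 3) *s ee 3"])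
        (auto simp: lf_def basis4_def comb_def vec4_eq_iff)
  next
    case 4
    then show ?thesis
      by (intro exI[of _ "(1 / \<phi> $ 4) *s ee 4"] exI[of _ "ee 1 - (\<phi> $ 1 / \<phi> $ 4) *s ee 4"]
          exI[of _ "ee 2 - (\<phi> $ 2 / \<phi> $ 4) *s ee 4"] exI[of _ "ee 3 - (\<phi> $ 3 / \<phi> $ 4) *s ee 4"])
        (auto simp: lf_def basis4_def comb_def vec4_eq_iff)
  qed
qed

lemma functional_exists:
  "\<exists>\<phi>. \<phi> \<noteq> 0 \<and> lf \<phi> a = 0 \<and> lf \<phi> b = 0 \<and> lf \<phi> c = 0"
proof -
  define M :: "complex ^ 4 ^ 4" where
    "M = (\<chi> i. if i = 1 then a else if i = 2 then b else if i = 3 then c else 0)"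
  have "row 4 M = 0"
    by (simp add: row_def M_def vec_eq_iff)
  then have "det M = 0"
    by (rule det_zero_row)
  then have "\<not> (\<forall>x. M *v x = 0 \<longrightarrow> x = 0)"
    using invertible_det_nz[of M] invertible_left_inverse[of M] matrix_left_invertible_ker[of M]
    by blast
  then obtain x where x: "M *v x = 0" "x \<noteq> 0" by blast
  have "lf x a = (M *v x) $ 1" "lf x b = (M *v x) $ 2" "lf x c = (M *v x) $ 3"
    by (simp_all add: M_def lf_def matrix_vector_mult_def sum_4 mult.commute)
  then show ?thesis
    using x by auto
qed

context
  fixes \<mu> :: "4 mult"
  assumes alg: "is_algebra \<mu>" and lie: "lie \<mu>"
begin

lemma lie_self: "\<mu> x x = 0" and lie_jacobian: "jacobian \<mu> x y z = 0"
  using lie by (simp_all add: lie_def)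

lemma lie_derivation: "\<mu> (\<mu> x y) z = \<mu> x (\<mu> y z) - \<mu> y (\<mu> x z)"
proof -
  have "\<mu> (\<mu> y z) x = - \<mu> x (\<mu> y z)" "\<mu> (\<mu> z x) y = \<mu> y (\<mu> x z)"
    using anticomm[OF alg lie_self, of "\<mu> y z" x] anticomm[OF alg lie_self, of "\<mu> z x" y]
      anticomm[OF alg lie_self, of z x] by (simp_all add: alg_minus_right[OF alg])
  then show ?thesis
    using lie_jacobian[of x y z] by (simp add: jacobian_def algebra_simps)
qed

lemma tr1_product: "tr1 \<mu> (\<mu> x y) = 0"
proof -
  have lin: "lin (\<mu> x)" for x
    by (simp add: lin_iff alg_simps[OF alg])
  have "tr1 \<mu> (\<mu> x y) = tr (\<mu> x \<circ> \<mu> y) - tr (\<mu> y \<circ> \<mu> x)"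
    by (simp add: tr1_def tr_def lie_derivation sum_subtractf)
  also have "\<dots> = trace (matrix (\<mu> x) ** matrix (\<mu> y)) - trace (matrix (\<mu> y) ** matrix (\<mu> x))"
    using lin by (simp add: tr_trace matrix_compose_gen)
  also have "\<dots> = 0"
    using trace_mul_sym[of "matrix (\<mu> x)" "matrix (\<mu> y)"] by simp
  finally show ?thesis .
qed

lemma tr1_lf: "tr1 \<mu> x = lf (\<chi> i. tr1 \<mu> (ee i)) x"
proof -
  have "x = x $ 1 *s ee 1 + x $ 2 *s ee 2 + x $ 3 *s ee 3 + x $ 4 *s ee 4"
    by (simp add: vec4_eq_iff)
  then have "\<mu> x y = x $ 1 *s \<mu> (ee 1) y + x $ 2 *s \<mu> (ee 2) y + x $ 3 *s \<mu> (ee 3) y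
      + x $ 4 *s \<mu> (ee 4) y" for y
    by (metis alg_add_left[OF alg] alg_scale_left[OF alg])
  then show ?thesis
    by (simp add: tr1_def tr_def lf_def sum_4 algebra_simps)
qed

text \<open>A form that kills all products has an ideal as its kernel. In a basis whose last three
  vectors span this kernel, no product has a first coordinate.\<close>

lemma ideal_form:
  assumes "\<phi> \<noteq> 0" "\<And>x y. lf \<phi> (\<mu> x y) = 0" "\<And>k. lf \<phi> k = 0 \<Longrightarrow> tr1 \<mu> k = 0"
  shows "\<exists>a b c d e f. \<mu> \<cong>\<^sub>a alg4 a b c d e f \<and> a $ 1 = 0 \<and> b $ 1 = 0 \<and> c $ 1 = 0 \<and> d $ 1 = 0 \<and>
    e $ 1 = 0 \<and> f $ 1 = 0 \<and> tr1 (alg4 a b c d e f) (ee 2) = 0 \<and>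
    tr1 (alg4 a b c d e f) (ee 3) = 0 \<and> tr1 (alg4 a b c d e f) (ee 4) = 0"
proof -
  obtain x u v w where basis: "basis4 x u v w"
    and \<phi>: "lf \<phi> x = 1" "lf \<phi> u = 0" "lf \<phi> v = 0" "lf \<phi> w = 0"
    using kernel_basis[OF assms(1)] by blast
  have first: "p $ 1 = 0" if "\<mu> y z = comb x u v w p" for p y z
    using assms(2)[of y z] \<phi> unfolding that comb_def by (simp add: lf_simps)
  obtain a b c d e f where iso: "\<mu> \<cong>\<^sub>a alg4 a b c d e f"
    and p: "\<mu> x u = comb x u v w a" "\<mu> x v = comb x u v w b" "\<mu> x w = comb x u v w c"
      "\<mu> u v = comb x u v w d" "\<mu> u w = comb x u v w e" "\<mu> v w = comb x u v w f"
    by (rule iso_alg4[OF alg lie_self basis])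
  have tr: "tr1 (alg4 a b c d e f) y = tr1 \<mu> (comb x u v w y)" for y
    by (rule tr_hom[OF alg lin_comb basis4_bij[OF basis]]) (rule alg4_hom[OF alg lie_self p])
  show ?thesis
    using iso first[OF p(1)] first[OF p(2)] first[OF p(3)] first[OF p(4)] first[OF p(5)] first[OF p(6)]
      tr[of "ee 2"] tr[of "ee 3"] tr[of "ee 4"] assms(3) \<phi> unfolding comb_ee by metis
qed

lemma lf_products:
  assumes "basis4 u v w z" "lf \<phi> (\<mu> u v) = 0" "lf \<phi> (\<mu> u w) = 0" "lf \<phi> (\<mu> u z) = 0"
    "lf \<phi> (\<mu> v w) = 0" "lf \<phi> (\<mu> v z) = 0" "lf \<phi> (\<mu> w z) = 0"
  shows "lf \<phi> (\<mu> x y) = 0"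
proof -
  obtain p where p: "x = comb u v w z p" using comb_surj[OF assms(1)] by blast
  obtain q where q: "y = comb u v w z q" using comb_surj[OF assms(1)] by blast
  show ?thesis
    unfolding p q alg_comb[OF alg lie_self] by (simp add: lf_simps assms(2-))
qed

end

text \<open>For a unimodular Lie algebra with structure forms \<open>d\<alpha>\<close>, every \<open>d\<alpha> \<and> d\<gamma> = d (\<alpha> \<and> d\<gamma>)\<close> vanishes,
  because \<open>d\<close> is zero on 3-forms. This is that identity with \<open>\<gamma>\<close> left out.\<close>

lemma unimodular_identity_alg4:
  assumes lie: "lie (alg4 a b c d e f)" and tr: "\<And>x. tr1 (alg4 a b c d e f) x = 0"
  shows "lf \<alpha> a *s f + lf \<alpha> f *s a - lf \<alpha> b *s e - lf \<alpha> e *s b + lf \<alpha> c *s d + lf \<alpha> d *s c = 0"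
proof -
  let ?J = "jacobian (alg4 a b c d e f)"
  let ?T = "\<lambda>i. a $ i *s f + f $ i *s a - b $ i *s e - e $ i *s b + c $ i *s d + d $ i *s c"
  have "tr1 (alg4 a b c d e f) (ee 1) = a $ 2 + b $ 3 + c $ 4"
    "tr1 (alg4 a b c d e f) (ee 2) = d $ 3 + e $ 4 - a $ 1"
    "tr1 (alg4 a b c d e f) (ee 3) = f $ 4 - d $ 2 - b $ 1"
    "tr1 (alg4 a b c d e f) (ee 4) = - e $ 2 - f $ 3 - c $ 1"
    by (simp_all add: tr1_def tr_def sum_4 alg4_apply)
  then have t: "a $ 1 = d $ 3 + e $ 4" "b $ 1 = f $ 4 - d $ 2" "c $ 1 = - e $ 2 - f $ 3"
    "a $ 2 = - b $ 3 - c $ 4"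
    using tr by (simp_all add: algebra_simps) (simp_all add: add_eq_0_iff2)
  have "?T 1 = ?J (ee 2) (ee 3) (ee 4)" "?T 2 = - ?J (ee 1) (ee 3) (ee 4)"
    "?T 3 = ?J (ee 1) (ee 2) (ee 4)" "?T 4 = - ?J (ee 1) (ee 2) (ee 3)"
    by (simp_all add: jacobian_def alg4_apply vec4_eq_iff t algebra_simps)
  then have T: "?T 1 = 0" "?T 2 = 0" "?T 3 = 0" "?T 4 = 0"
    using lie by (simp_all add: lie_def)
  have "lf \<alpha> a *s f + lf \<alpha> f *s a - lf \<alpha> b *s e - lf \<alpha> e *s b + lf \<alpha> c *s d + lf \<alpha> d *s c
      = \<alpha> $ 1 *s ?T 1 + \<alpha> $ 2 *s ?T 2 + \<alpha> $ 3 *s ?T 3 + \<alpha> $ 4 *s ?T 4"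
    by (simp add: lf_def vec4_eq_iff algebra_simps)
  then show ?thesis
    by (simp only: T) simp
qed

section \<open>Unimodular Lie algebras\<close>

context
  fixes \<mu> :: "4 mult"
  assumes alg: "is_algebra \<mu>" and lie: "lie \<mu>" and unimodular: "\<And>x. tr1 \<mu> x = 0"
begin

lemma unimodular_identity:
  assumes "basis4 u v w z"
  shows "lf \<alpha> (\<mu> u v) *s \<mu> w z + lf \<alpha> (\<mu> w z) *s \<mu> u v - lf \<alpha> (\<mu> u w) *s \<mu> v z
    - lf \<alpha> (\<mu> v z) *s \<mu> u w + lf \<alpha> (\<mu> u z) *s \<mu> v w + lf \<alpha> (\<mu> v w) *s \<mu> u z = 0"
proof -
  note self = lie_self[OF alg lie]
  obtain a b c d e f where iso: "\<mu> \<cong>\<^sub>a alg4 a b c d e f"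
    and p: "\<mu> u v = comb u v w z a" "\<mu> u w = comb u v w z b" "\<mu> u z = comb u v w z c"
      "\<mu> v w = comb u v w z d" "\<mu> v z = comb u v w z e" "\<mu> w z = comb u v w z f"
    by (rule iso_alg4[OF alg self assms])
  have "tr1 (alg4 a b c d e f) y = tr1 \<mu> (comb u v w z y)" for y
    by (rule tr_hom[OF alg lin_comb basis4_bij[OF assms]]) (rule alg4_hom[OF alg self p])
  then have tr: "tr1 (alg4 a b c d e f) y = 0" for y
    by (simp add: unimodular)
  define \<beta> :: "complex ^ 4" where "\<beta> = lf \<alpha> u *s ee 1 + lf \<alpha> v *s ee 2 + lf \<alpha> w *s ee 3 + lf \<alpha> z *s ee 4"
  have \<beta>: "lf \<alpha> (comb u v w z x) = lf \<beta> x" for x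
    by (simp add: comb_def lf_simps) (simp add: \<beta>_def lf_def)
  have "comb u v w z (lf \<beta> a *s f + lf \<beta> f *s a - lf \<beta> b *s e - lf \<beta> e *s b + lf \<beta> c *s d
      + lf \<beta> d *s c) = 0"
    using unimodular_identity_alg4[OF iso_lie[OF alg alg4_algebra iso lie] tr]
    by (simp add: comb_def)
  then show ?thesis
    unfolding p \<beta> by (simp add: comb_def vec4_eq_iff algebra_simps)
qed

text \<open>In a perfect algebra no nonzero form kills all six products of basis vectors, but one
  can always be chosen to kill three of them. The quadratic identity then produces more and more
  elements commuting with a fixed x, until x is central; but then three products span the derived
  algebra.\<close>

lemma unimodular_not_perfect: "\<exists>\<phi>. \<phi> \<noteq> 0 \<and> (\<forall>x y. lf \<phi> (\<mu> x y) = 0)"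
proof (rule ccontr)
  assume "\<not> ?thesis"
  then have no: "False" if "\<alpha> \<noteq> 0" "basis4 u v w z" "lf \<alpha> (\<mu> u v) = 0" "lf \<alpha> (\<mu> u w) = 0"
    "lf \<alpha> (\<mu> u z) = 0" "lf \<alpha> (\<mu> v w) = 0" "lf \<alpha> (\<mu> v z) = 0" "lf \<alpha> (\<mu> w z) = 0" for \<alpha> u v w z
    using lf_products[OF alg lie that(2-)] that(1) by blast
  have step1: "\<exists>y p q. basis4 (ee 1) y p q \<and> \<mu> (ee 1) y = 0"
  proof -
    obtain \<alpha> where \<alpha>: "\<alpha> \<noteq> 0" "lf \<alpha> (\<mu> (ee 1) (ee 2)) = 0" "lf \<alpha> (\<mu> (ee 1) (ee 3)) = 0"
      "lf \<alpha> (\<mu> (ee 1) (ee 4)) = 0"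
      using functional_exists by blast
    have basis: "basis4 (ee 1) (ee 2) (ee 3) (ee 4)"
      by (simp add: basis4_def comb_def vec4_eq_iff)
    define r s t where "r = lf \<alpha> (\<mu> (ee 3) (ee 4))" and "s = - lf \<alpha> (\<mu> (ee 2) (ee 4))"
      and "t = lf \<alpha> (\<mu> (ee 2) (ee 3))"
    \<comment> \<open>With \<alpha> zero on the products by e1, the identity reads e1 y = 0.
      Perfectness makes some coefficient of y nonzero.\<close>
    define y where "y = r *s ee 2 + s *s ee 3 + t *s ee 4"
    have "r \<noteq> 0 \<or> s \<noteq> 0 \<or> t \<noteq> 0"
      using no[OF \<alpha>(1) basis] \<alpha> unfolding r_def s_def t_def by auto
    moreover have "\<mu> (ee 1) y = 0"
      using unimodular_identity[OF basis, of \<alpha>] \<alpha>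
      by (simp add: y_def r_def s_def t_def alg_simps[OF alg])
    moreover have "basis4 (ee 1) y (ee 3) (ee 4)" if "r \<noteq> 0"
      using that by (auto simp: y_def basis4_def comb_def vec4_eq_iff)
    moreover have "basis4 (ee 1) y (ee 2) (ee 4)" if "s \<noteq> 0"
      using that by (auto simp: y_def basis4_def comb_def vec4_eq_iff)
    moreover have "basis4 (ee 1) y (ee 2) (ee 3)" if "t \<noteq> 0"
      using that by (auto simp: y_def basis4_def comb_def vec4_eq_iff)
    ultimately show ?thesis by blast
  qed
  have step2: "\<exists>x y u v. basis4 x y u v \<and> \<mu> x y = 0 \<and> \<mu> x v = 0"
  proof -
    obtain y p q where basis: "basis4 (ee 1) y p q" and xy: "\<mu> (ee 1) y = 0"
      using step1 by blast
    obtain \<alpha> where \<alpha>: "\<alpha> \<noteq> 0" "lf \<alpha> (\<mu> (ee 1) p) = 0" "lf \<alpha> (\<mu> (ee 1) q) = 0"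
      "lf \<alpha> (\<mu> p q) = 0"
      using functional_exists by blast
    define s t where "s = - lf \<alpha> (\<mu> y q)" and "t = lf \<alpha> (\<mu> y p)"
    define v where "v = s *s p + t *s q"
    have "s \<noteq> 0 \<or> t \<noteq> 0"
      using no[OF \<alpha>(1) basis] \<alpha> xy unfolding s_def t_def by (auto simp: lf_simps)
    moreover have "\<mu> (ee 1) v = 0"
      using unimodular_identity[OF basis, of \<alpha>] \<alpha> xy
      by (simp add: v_def s_def t_def alg_simps[OF alg] lf_simps)
    moreover have "basis4 (ee 1) y q v" if "s \<noteq> 0"
      by (rule basis4_change[OF basis, where X = "\<lambda>x. x $ 1 *s ee 1 + x $ 2 *s ee 2 +
            (s * x $ 4) *s ee 3 + (x $ 3 + t * x $ 4) *s ee 4"])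
        (use that in \<open>auto simp: comb_def v_def vec4_eq_iff algebra_simps\<close>)
    moreover have "basis4 (ee 1) y p v" if "t \<noteq> 0"
      by (rule basis4_change[OF basis, where X = "\<lambda>x. x $ 1 *s ee 1 + x $ 2 *s ee 2 +
            (x $ 3 + s * x $ 4) *s ee 3 + (t * x $ 4) *s ee 4"])
        (use that in \<open>auto simp: comb_def v_def vec4_eq_iff algebra_simps\<close>)
    ultimately show ?thesis using xy by blast
  qed
  then obtain x y u v where basis: "basis4 x y u v" and zero: "\<mu> x y = 0" "\<mu> x v = 0"
    by blast
  \<comment> \<open>When x commutes with y and v, killing the products xu, yu and uv leaves the
    single term \<alpha>(yv) xu of the identity.\<close>
  have xu: "\<mu> x u = 0"
  proof -
    obtain \<alpha> where \<alpha>: "\<alpha> \<noteq> 0" "lf \<alpha> (\<mu> x u) = 0" "lf \<alpha> (\<mu> y u) = 0" "lf \<alpha> (\<mu> u v) = 0"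
      using functional_exists by blast
    have "lf \<alpha> (\<mu> y v) \<noteq> 0"
      using no[OF \<alpha>(1) basis] \<alpha> zero by (auto simp: lf_simps)
    moreover have "lf \<alpha> (\<mu> y v) *s \<mu> x u = 0"
      using unimodular_identity[OF basis, of \<alpha>] \<alpha> zero by (simp add: lf_simps)
    ultimately show ?thesis by simp
  qed
  obtain \<alpha> where "\<alpha> \<noteq> 0" "lf \<alpha> (\<mu> y u) = 0" "lf \<alpha> (\<mu> y v) = 0" "lf \<alpha> (\<mu> u v) = 0"
    using functional_exists by blast
  then show False
    using no[OF _ basis] zero xu by (auto simp: lf_simps)
qed

end

lemma lie_ideal_form:
  assumes "is_algebra \<mu>" "lie \<mu>"
  shows "\<exists>a b c d e f. \<mu> \<cong>\<^sub>a alg4 a b c d e f \<and> a $ 1 = 0 \<and> b $ 1 = 0 \<and> c $ 1 = 0 \<and> d $ 1 = 0 \<and>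
    e $ 1 = 0 \<and> f $ 1 = 0 \<and> tr1 (alg4 a b c d e f) (ee 2) = 0 \<and>
    tr1 (alg4 a b c d e f) (ee 3) = 0 \<and> tr1 (alg4 a b c d e f) (ee 4) = 0"
proof (cases "\<forall>x. tr1 \<mu> x = 0")
  case True
  then obtain \<phi> where "\<phi> \<noteq> 0" "\<And>x y. lf \<phi> (\<mu> x y) = 0"
    using unimodular_not_perfect[OF assms] by blast
  then show ?thesis
    using True by (intro ideal_form[OF assms]) auto
next
  case False
  define \<phi> where "\<phi> = (\<chi> i. tr1 \<mu> (ee i))"
  have \<phi>: "tr1 \<mu> x = lf \<phi> x" for x
    unfolding \<phi>_def by (rule tr1_lf[OF assms])
  have "\<phi> \<noteq> 0"
    using False \<phi> by (auto simp: lf_def)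
  then show ?thesis
    using tr1_product[OF assms] by (intro ideal_form[OF assms, of \<phi>]) (simp_all add: \<phi>)
qed

section \<open>Lie algebras with a traceless ideal of codimension one\<close>

context
  fixes a b c d e f :: "complex ^ 4" and \<mu> :: "4 mult"
  defines "\<mu> \<equiv> alg4 a b c d e f"
  assumes K: "a $ 1 = 0" "b $ 1 = 0" "c $ 1 = 0" "d $ 1 = 0" "e $ 1 = 0" "f $ 1 = 0"
begin

lemma product_in_ideal: "\<mu> x y $ 1 = 0"
  by (simp add: \<mu>_def alg4_apply K)

lemma ideal_basis:
  assumes "u $ 1 = 0" "v $ 1 = 0" "w $ 1 = 0" "basis4 (ee 1) u v w"
    and "\<mu> u v = comb (ee 1) u v w d'" "\<mu> u w = comb (ee 1) u v w e'" "\<mu> v w = comb (ee 1) u v w f'"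
  shows "\<exists>a' b' c'. a' $ 1 = 0 \<and> b' $ 1 = 0 \<and> c' $ 1 = 0 \<and> \<mu> \<cong>\<^sub>a alg4 a' b' c' d' e' f'"
proof -
  have first: "p $ 1 = 0" if "\<mu> (ee 1) y = comb (ee 1) u v w p" for p y
    using product_in_ideal[of "ee 1" y] assms(1-3) unfolding that by (simp add: comb_def)
  obtain a' where a': "\<mu> (ee 1) u = comb (ee 1) u v w a'" using comb_surj[OF assms(4)] by blast
  obtain b' where b': "\<mu> (ee 1) v = comb (ee 1) u v w b'" using comb_surj[OF assms(4)] by blast
  obtain c' where c': "\<mu> (ee 1) w = comb (ee 1) u v w c'" using comb_surj[OF assms(4)] by blast
  have "\<mu> \<cong>\<^sub>a alg4 a' b' c' d' e' f'"
    by (rule alg4_iso[OF _ _ assms(4) a' b' c' assms(5-7)]) (simp_all add: \<mu>_def alg4_algebra alg4_self)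
  then show ?thesis
    using first[OF a'] first[OF b'] first[OF c'] by blast
qed

context
  assumes lie: "lie \<mu>" and tr: "tr1 \<mu> (ee 2) = 0" "tr1 \<mu> (ee 3) = 0" "tr1 \<mu> (ee 4) = 0"
begin

text \<open>Tracelessness says that the matrix with rows e3 e4, e4 e2, e2 e3, in the coordinates 2,
  3, 4, is symmetric.\<close>

lemma symmetric: "e $ 4 = - d $ 3" "f $ 4 = d $ 2" "f $ 3 = - e $ 2"
proof -
  have "tr1 \<mu> (ee 2) = d $ 3 + e $ 4" "tr1 \<mu> (ee 3) = f $ 4 - d $ 2" "tr1 \<mu> (ee 4) = - e $ 2 - f $ 3"
    by (simp_all add: \<mu>_def tr1_def tr_def sum_4 alg4_apply K)
  then show "e $ 4 = - d $ 3" "f $ 4 = d $ 2" "f $ 3 = - e $ 2"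
    using tr by (simp_all add: add_eq_0_iff)
qed

text \<open>The Cayley--Hamilton identity for the traceless, singular action of \<open>h\<close> on the ideal.\<close>

lemma cubic_action:
  assumes "h $ 1 = 0" "v $ 1 = 0"
  shows "\<mu> h (\<mu> h (\<mu> h v)) = (tr2 \<mu> h / 2) *s \<mu> h v"
proof -
  have "2 *s \<mu> h (\<mu> h (\<mu> h v)) = tr2 \<mu> h *s \<mu> h v"
    unfolding tr2_def tr_def sum_4 \<mu>_def
    by (simp add: alg4_apply vec4_eq_iff assms K symmetric algebra_simps)
  then show ?thesis
    by (simp add: vec4_eq_iff field_simps)
qed

text \<open>An h with nonzero \<open>tr2\<close> thus satisfies neither L^2 = L nor L^2 = - L on the
  ideal, for L its left multiplication. This provides the eigenvectors for 1 and -1.\<close>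

lemma tr_ideal:
  assumes "h $ 1 = 0" "\<And>v. v $ 1 = 0 \<Longrightarrow> \<mu> h (\<mu> h v) = k *s \<mu> h v"
  shows "tr2 \<mu> h = 0"
proof -
  have "tr2 \<mu> h = k * tr1 \<mu> h"
    using assms(2)[of "ee 2"] assms(2)[of "ee 3"] assms(2)[of "ee 4"]
    by (simp add: tr2_def tr1_def tr_def sum_4 product_in_ideal algebra_simps)
  also have "tr1 \<mu> h = 0"
    using tr1_lf[of \<mu> h] lie tr assms(1) by (simp add: \<mu>_def alg4_algebra lf_def)
  finally show ?thesis by simp
qed

lemma semisimple_case:
  assumes "h $ 1 = 0" "tr2 \<mu> h = 2"
  shows "classified \<mu>"
proof -
  have alg: "is_algebra \<mu>" by (simp add: \<mu>_def alg4_algebra)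
  note self = lie_self[OF alg lie]
  have cubic: "\<mu> h (\<mu> h (\<mu> h v)) = \<mu> h v" if "v $ 1 = 0" for v
    using cubic_action[OF assms(1) that] assms(2) by simp
  have "\<exists>v. v $ 1 = 0 \<and> \<mu> h (\<mu> h v) \<noteq> (- 1) *s \<mu> h v"
    using tr_ideal[OF assms(1), of "-1"] assms(2) by auto
  then obtain v where v: "v $ 1 = 0" "\<mu> h (\<mu> h v) \<noteq> (- 1) *s \<mu> h v" by blast
  \<comment> \<open>Since L^3 = L on the ideal, L^2 v + L v is fixed by L; likewise L^2 w - L w is
    negated by L.\<close>
  define p where "p = \<mu> h (\<mu> h v) + \<mu> h v"
  have p: "p \<noteq> 0" "\<mu> h p = p" "p $ 1 = 0"
    using v cubic[OF v(1)]
    by (auto simp: p_def alg_simps[OF alg] product_in_ideal eq_neg_iff_add_eq_0 add.commute)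
  have "\<exists>v. v $ 1 = 0 \<and> \<mu> h (\<mu> h v) \<noteq> 1 *s \<mu> h v"
    using tr_ideal[OF assms(1), of 1] assms(2) by auto
  then obtain w where w: "w $ 1 = 0" "\<mu> h (\<mu> h w) \<noteq> 1 *s \<mu> h w" by blast
  define q where "q = \<mu> h (\<mu> h w) - \<mu> h w"
  have q: "q \<noteq> 0" "\<mu> h q = - q" "q $ 1 = 0"
    using w cubic[OF w(1)]
    by (auto simp: q_def alg_simps[OF alg] product_in_ideal)
  have "h \<noteq> 0"
    using assms(2) by (auto simp: tr2_def tr_def alg_simps[OF alg])
  have coeffs: "r = 0 \<and> s = 0 \<and> t = 0" if "r *s h + s *s p + t *s q = 0" for r s t
  proof -
    have 1: "s *s p - t *s q = 0"
      using arg_cong[OF that, of "\<mu> h"] by (simp add: alg_simps[OF alg] self p q)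
    have 2: "s *s p + t *s q = 0"
      using arg_cong[OF 1, of "\<mu> h"] by (simp add: alg_simps[OF alg] self p q)
    have "(2 * s) *s p = (s *s p - t *s q) + (s *s p + t *s q)"
      "(2 * t) *s q = (s *s p + t *s q) - (s *s p - t *s q)"
      by (simp_all add: vec4_eq_iff algebra_simps)
    then have "s = 0" "t = 0" using p q unfolding 1 2 by auto
    then show ?thesis using that \<open>h \<noteq> 0\<close> by simp
  qed
  have basis: "basis4 (ee 1) h p q"
    unfolding basis4_def
  proof (intro allI impI)
    fix x assume x: "comb (ee 1) h p q x = 0"
    have "comb (ee 1) h p q x $ 1 = x $ 1"
      by (simp add: comb_def assms(1) p q)
    then have x1: "x $ 1 = 0" using x by simp
    then have "x $ 2 *s h + x $ 3 *s p + x $ 4 *s q = 0"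
      using x by (simp add: comb_def)
    from coeffs[OF this] show "x = 0"
      using x1 by (simp add: vec4_eq_iff)
  qed
  obtain y where y: "\<mu> p q = comb (ee 1) h p q y"
    using comb_surj[OF basis] by blast
  have "comb (ee 1) h p q y $ 1 = y $ 1"
    by (simp add: comb_def assms(1) p q)
  then have y1: "y $ 1 = 0"
    using product_in_ideal[of p q] by (simp add: y)
  \<comment> \<open>As a derivation, h acts on pq by the sum 1 - 1 of the eigenvalues, and its
    kernel in the ideal is the line of h.\<close>
  have "\<mu> h (\<mu> p q) = 0"
    using lie_derivation[OF alg lie, of h p q] p(2) q(2) by (simp add: alg_minus_right[OF alg])
  then have "0 *s h + y $ 3 *s p + (- y $ 4) *s q = 0"
    unfolding y using y1 by (simp add: comb_def alg_simps[OF alg] self p q)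
  from coeffs[OF this] have "y $ 3 = 0" "y $ 4 = 0"
    by simp_all
  define k where "k = y $ 2"
  have y': "y = k *s ee 2"
    using y1 \<open>y $ 3 = 0\<close> \<open>y $ 4 = 0\<close> k_def by (simp add: vec4_eq_iff)
  obtain a' b' c' where abc: "a' $ 1 = 0" "b' $ 1 = 0" "c' $ 1 = 0"
    "\<mu> \<cong>\<^sub>a alg4 a' b' c' (ee 3) (- ee 4) (k *s ee 2)"
    using ideal_basis[OF assms(1) p(3) q(3) basis, of "ee 3" "- ee 4" "k *s ee 2"]
      y[unfolded y'] p(2) q(2) by (auto simp: comb_def)
  show ?thesis
    by (rule classified_iso[OF abc(4) semisimple_classified[OF abc(1-3) iso_lie[OF alg alg4_algebra abc(4) lie]]])
qed

lemma heisenberg_case: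
  assumes "u $ 1 = 0" "v $ 1 = 0" "w $ 1 = 0" "det3 u v w \<noteq> 0" "\<mu> u v = w" "\<mu> u w = 0" "\<mu> v w = 0"
  shows "classified \<mu>"
proof -
  have alg: "is_algebra \<mu>" by (simp add: \<mu>_def alg4_algebra)
  obtain a' b' c' where abc: "a' $ 1 = 0" "b' $ 1 = 0" "c' $ 1 = 0"
    "\<mu> \<cong>\<^sub>a alg4 a' b' c' (ee 4) 0 0"
    using ideal_basis[OF assms(1-3) basis4_det3[OF assms(1-4)], of "ee 4" 0 0] assms(5-7)
    by (auto simp: comb_def)
  show ?thesis
    by (rule classified_iso[OF abc(4) heisenberg_classified[OF abc(1-3) iso_lie[OF alg alg4_algebra abc(4) lie]]])
qed

text \<open>If \<open>tr2\<close> is not zero on the ideal, some h acts with eigenvalues 0, 1, -1.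
  If it is zero, then all 2 by 2 minors of the symmetric product matrix vanish. So the matrix has
  rank at most one, and the ideal is abelian or Heisenberg.\<close>

lemma ideal_classified: "classified \<mu>"
proof (cases "\<exists>h. h $ 1 = 0 \<and> tr2 \<mu> h \<noteq> 0")
  case True
  then obtain h where h: "h $ 1 = 0" "tr2 \<mu> h \<noteq> 0" by blast
  \<comment> \<open>This scaling makes \<open>tr2\<close> equal to 2 = 1^2 + (-1)^2, and the cubic
    relation becomes L^3 = L.\<close>
  define r where "r = csqrt (2 / tr2 \<mu> h)"
  have alg: "is_algebra \<mu>" by (simp add: \<mu>_def alg4_algebra)
  have "tr2 \<mu> (r *s h) = r ^ 2 * tr2 \<mu> h"
    by (simp add: tr2_def tr_def alg_simps[OF alg] sum_distrib_left power2_eq_square mult.assoc)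
  then have "tr2 \<mu> (r *s h) = 2"
    using h by (simp add: r_def)
  then show ?thesis
    using semisimple_case[of "r *s h"] h by simp
next
  case False
  then have z: "tr2 \<mu> h = 0" if "h $ 1 = 0" for h using that by blast
  note sym = symmetric
  have N: "d $ 3 ^ 2 = - (e $ 3 * d $ 4)" "d $ 2 ^ 2 = f $ 2 * d $ 4" "e $ 2 ^ 2 = - (f $ 2 * e $ 3)"
    "d $ 2 * d $ 3 = - (e $ 2 * d $ 4)" "e $ 3 * d $ 2 = e $ 2 * d $ 3" "f $ 2 * d $ 3 = - (e $ 2 * d $ 2)"
  proof -
    have t: "tr2 \<mu> h = 2 * (h $ 2 ^ 2 * (d $ 3 ^ 2 + e $ 3 * d $ 4) + h $ 3 ^ 2 * (d $ 2 ^ 2 - f $ 2 * d $ 4)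
       + h $ 4 ^ 2 * (e $ 2 ^ 2 + f $ 2 * e $ 3)
       - 2 * h $ 2 * h $ 3 * (d $ 2 * d $ 3 + e $ 2 * d $ 4)
       - 2 * h $ 2 * h $ 4 * (e $ 3 * d $ 2 - e $ 2 * d $ 3)
       + 2 * h $ 3 * h $ 4 * (f $ 2 * d $ 3 + e $ 2 * d $ 2))" if "h $ 1 = 0" for h
      unfolding tr2_def tr_def sum_4 \<mu>_def
      by (simp add: alg4_apply that K sym algebra_simps power2_eq_square)
    have 1: "d $ 3 ^ 2 + e $ 3 * d $ 4 = 0" "d $ 2 ^ 2 - f $ 2 * d $ 4 = 0" "e $ 2 ^ 2 + f $ 2 * e $ 3 = 0"
      using t[of "ee 2"] t[of "ee 3"] t[of "ee 4"] z[of "ee 2"] z[of "ee 3"] z[of "ee 4"]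
      by (simp_all del: distrib_left_numeral right_diff_distrib_numeral)
    have 2: "d $ 2 * d $ 3 + e $ 2 * d $ 4 = 0" "e $ 3 * d $ 2 - e $ 2 * d $ 3 = 0"
      "f $ 2 * d $ 3 + e $ 2 * d $ 2 = 0"
      using t[of "ee 2 + ee 3"] t[of "ee 2 + ee 4"] t[of "ee 3 + ee 4"]
        z[of "ee 2 + ee 3"] z[of "ee 2 + ee 4"] z[of "ee 3 + ee 4"] 
      by (simp_all add: 1 del: distrib_left_numeral right_diff_distrib_numeral)
    show "d $ 3 ^ 2 = - (e $ 3 * d $ 4)" "d $ 2 ^ 2 = f $ 2 * d $ 4" "e $ 2 ^ 2 = - (f $ 2 * e $ 3)"
      "d $ 2 * d $ 3 = - (e $ 2 * d $ 4)" "e $ 3 * d $ 2 = e $ 2 * d $ 3" "f $ 2 * d $ 3 = - (e $ 2 * d $ 2)"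
      using 1 2 by (simp_all only: eq_neg_iff_add_eq_0 right_minus_eq)
  qed
  \<comment> \<open>A symmetric matrix of rank one has a nonzero diagonal entry; here the diagonal
    is f2, - e3, d4. If it is zero, the minors kill the remaining entries.\<close>
  consider "f $ 2 \<noteq> 0" | "e $ 3 \<noteq> 0" | "d $ 4 \<noteq> 0" | "f $ 2 = 0" "e $ 3 = 0" "d $ 4 = 0" by blast
  then show ?thesis
  proof cases
    case 1
    show ?thesis
      by (rule heisenberg_case[where u = "ee 3" and v = "ee 4" and w = f])
        (use 1 N in \<open>auto simp: det3_def \<mu>_def alg4_apply vec4_eq_iff K sym power2_eq_square algebra_simps\<close>)
  next
    case 2
    show ?thesis
      by (rule heisenberg_case[where u = "ee 4" and v = "ee 2" and w = "- e"])
        (use 2 N in \<open>auto simp: det3_def \<mu>_def alg4_apply vec4_eq_iff K sym power2_eq_square algebra_simps\<close>)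
  next
    case 3
    show ?thesis
      by (rule heisenberg_case[where u = "ee 2" and v = "ee 3" and w = d])
        (use 3 N in \<open>auto simp: det3_def \<mu>_def alg4_apply vec4_eq_iff K sym power2_eq_square algebra_simps\<close>)
  next
    case 4
    then have "d = 0" "e = 0" "f = 0"
      using N K sym by (simp_all add: vec4_eq_iff)
    then show ?thesis
      using abelian_classified[OF K(1-3)] by (simp add: \<mu>_def)
  qed
qed

end

end

lemma lie_classified:
  assumes "is_algebra \<mu>" "lie \<mu>"
  shows "classified \<mu>"
proof -
  obtain a b c d e f where iso: "\<mu> \<cong>\<^sub>a alg4 a b c d e f" and
    K: "a $ 1 = 0" "b $ 1 = 0" "c $ 1 = 0" "d $ 1 = 0" "e $ 1 = 0" "f $ 1 = 0" and
    tr: "tr1 (alg4 a b c d e f) (ee 2) = 0" "tr1 (alg4 a b c d e f) (ee 3) = 0"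
      "tr1 (alg4 a b c d e f) (ee 4) = 0"
    using lie_ideal_form[OF assms] by blast
  show ?thesis
    by (rule classified_iso[OF iso ideal_classified[OF K iso_lie[OF assms(1) alg4_algebra iso assms(2)] tr]])
qed

subsection \<open>Classification of the binary Lie algebras that are not Lie algebras\<close>

text \<open>The basic 3-form in the coordinates i, j, k. The Jacobian of an anticommutative algebra
  is alternating, hence a combination of the four such forms with vector coefficients.\<close>

definition minor3 :: "4 \<Rightarrow> 4 \<Rightarrow> 4 \<Rightarrow> complex ^ 4 \<Rightarrow> complex ^ 4 \<Rightarrow> complex ^ 4 \<Rightarrow> complex" where
  "minor3 i j k x y z = x $ i * (y $ j * z $ k - y $ k * z $ j) - x $ j * (y $ i * z $ k - y $ k * z $ i)
     + x $ k * (y $ i * z $ j - y $ j * z $ i)"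

context
  fixes \<mu> :: "4 mult"
  assumes alg: "is_algebra \<mu>" and self: "\<And>x. \<mu> x x = 0"
begin

lemma jacobian_comb:
  "jacobian \<mu> (comb u v w z p) (comb u v w z q) (comb u v w z r) =
     minor3 1 2 3 p q r *s jacobian \<mu> u v w + minor3 1 2 4 p q r *s jacobian \<mu> u v z +
     minor3 1 3 4 p q r *s jacobian \<mu> u w z + minor3 2 3 4 p q r *s jacobian \<mu> v w z"
proof -
  note ac = anticomm[OF alg self, of w u] anticomm[OF alg self, of z u] anticomm[OF alg self, of z v]
  show ?thesis
    unfolding jacobian_def alg_comb[OF alg self] minor3_def
    unfolding comb_def ac
    by (simp add: alg_simps[OF alg] vec4_eq_iff algebra_simps)
qed

lemma jacobian_expand:
  "jacobian \<mu> x y z =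
     minor3 1 2 3 x y z *s jacobian \<mu> (ee 1) (ee 2) (ee 3) +
     minor3 1 2 4 x y z *s jacobian \<mu> (ee 1) (ee 2) (ee 4) +
     minor3 1 3 4 x y z *s jacobian \<mu> (ee 1) (ee 3) (ee 4) +
     minor3 2 3 4 x y z *s jacobian \<mu> (ee 2) (ee 3) (ee 4)"
proof -
  have "comb (ee 1) (ee 2) (ee 3) (ee 4) v = v" for v
    by (simp add: comb_def vec4_eq_iff)
  then show ?thesis
    using jacobian_comb[of "ee 1" "ee 2" "ee 3" "ee 4" x y z] by simp
qed

text \<open>A nonzero component \<open>\<psi>\<close> of the Jacobian is a 3-form on a 4-dimensional space, so it has a
  kernel vector \<open>w\<close>. As \<open>\<psi>(x, y, xy) = 0\<close>, the vectors \<open>x, y, xy, w\<close> are always dependent.\<close>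

lemma nonlie_kernel:
  assumes bl: "\<And>x y. jacobian \<mu> x y (\<mu> x y) = 0" and "\<not> lie \<mu>"
  shows "\<exists>a b c d e f. \<mu> \<cong>\<^sub>a alg4 a b c d e f \<and>
    (\<forall>x y. minor3 1 2 3 x y (alg4 a b c d e f x y) = 0)"
proof -
  obtain x0 y0 z0 where "jacobian \<mu> x0 y0 z0 \<noteq> 0"
    using assms(2) self by (auto simp: lie_def)
  then obtain k where k: "jacobian \<mu> x0 y0 z0 $ k \<noteq> 0"
    by (auto simp: vec_eq_iff)
  define \<psi> where "\<psi> x y z = jacobian \<mu> x y z $ k" for x y z
  \<comment> \<open>The signed components of a 3-form in dimension four are the coordinates of a
    vector contracting it to zero.\<close>
  define w where "w = - \<psi> (ee 2) (ee 3) (ee 4) *s ee 1 + \<psi> (ee 1) (ee 3) (ee 4) *s ee 2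
    - \<psi> (ee 1) (ee 2) (ee 4) *s ee 3 + \<psi> (ee 1) (ee 2) (ee 3) *s ee 4"
  have \<psi>: "\<psi> x y z = - (minor3 2 3 4 x y z * w $ 1) + minor3 1 3 4 x y z * w $ 2
      - minor3 1 2 4 x y z * w $ 3 + minor3 1 2 3 x y z * w $ 4" for x y z
    unfolding \<psi>_def by (subst jacobian_expand) (simp add: w_def \<psi>_def)
  have \<psi>w: "\<psi> x y w = 0" for x y
    unfolding \<psi> minor3_def by (simp add: algebra_simps)
  have "w \<noteq> 0"
    using k \<psi>[of x0 y0 z0] by (auto simp: \<psi>_def)
  then consider "w $ 1 \<noteq> 0" | "w $ 2 \<noteq> 0" | "w $ 3 \<noteq> 0" | "w $ 4 \<noteq> 0"
    by (auto simp: vec4_eq_iff)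
  then have "\<exists>u v t. basis4 u v t w"
  proof cases
    case 1
    then show ?thesis
      by (intro exI[of _ "ee 2"] exI[of _ "ee 3"] exI[of _ "ee 4"])
        (auto simp: basis4_def comb_def vec4_eq_iff)
  next
    case 2
    then show ?thesis
      by (intro exI[of _ "ee 1"] exI[of _ "ee 3"] exI[of _ "ee 4"])
        (auto simp: basis4_def comb_def vec4_eq_iff)
  next
    case 3
    then show ?thesis
      by (intro exI[of _ "ee 1"] exI[of _ "ee 2"] exI[of _ "ee 4"])
        (auto simp: basis4_def comb_def vec4_eq_iff)
  next
    case 4
    then show ?thesis
      by (intro exI[of _ "ee 1"] exI[of _ "ee 2"] exI[of _ "ee 3"])
        (auto simp: basis4_def comb_def vec4_eq_iff)
  qed
  then obtain u v t where basis: "basis4 u v t w" by blast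
  have \<psi>_comb: "\<psi> (comb u v t w p) (comb u v t w q) (comb u v t w r) = minor3 1 2 3 p q r * \<psi> u v t"
    for p q r
    unfolding \<psi>_def jacobian_comb using \<psi>w by (simp add: \<psi>_def)
  obtain p0 where p0: "x0 = comb u v t w p0" using comb_surj[OF basis] by blast
  obtain q0 where q0: "y0 = comb u v t w q0" using comb_surj[OF basis] by blast
  obtain r0 where r0: "z0 = comb u v t w r0" using comb_surj[OF basis] by blast
  have nz: "\<psi> u v t \<noteq> 0"
    using k \<psi>_comb[of p0 q0 r0] unfolding p0 q0 r0 \<psi>_def[symmetric] by auto
  obtain a b c d e f where iso: "\<mu> \<cong>\<^sub>a alg4 a b c d e f"
    and p: "\<mu> u v = comb u v t w a" "\<mu> u t = comb u v t w b" "\<mu> u w = comb u v t w c"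
      "\<mu> v t = comb u v t w d" "\<mu> v w = comb u v t w e" "\<mu> t w = comb u v t w f"
    by (rule iso_alg4[OF alg self basis])
  have "minor3 1 2 3 x y (alg4 a b c d e f x y) * \<psi> u v t = 0" for x y
    unfolding \<psi>_comb[symmetric] alg4_hom[OF alg self p] by (simp add: \<psi>_def bl)
  then show ?thesis
    using iso nz by (metis mult_eq_0_iff)
qed

end

text \<open>The product \<open>xy = \<lambda>(x) y - \<lambda>(y) x + \<Omega>(x, y) e\<^sub>4\<close> for a linear form \<open>\<lambda>\<close> and an alternating form \<open>\<Omega>\<close>.\<close>

definition two_form_algebra :: "complex \<Rightarrow> complex \<Rightarrow> complex \<Rightarrow> complex \<Rightarrow>
    complex \<Rightarrow> complex \<Rightarrow> complex \<Rightarrow> complex \<Rightarrow> complex \<Rightarrow> complex \<Rightarrow> 4 mult" where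
  "two_form_algebra l1 l2 l3 l4 o12 o13 o14 o23 o24 o34 =
     alg4 (l1 *s ee 2 - l2 *s ee 1 + o12 *s ee 4) (l1 *s ee 3 - l3 *s ee 1 + o13 *s ee 4)
       (l1 *s ee 4 - l4 *s ee 1 + o14 *s ee 4) (l2 *s ee 3 - l3 *s ee 2 + o23 *s ee 4)
       (l2 *s ee 4 - l4 *s ee 2 + o24 *s ee 4) (l3 *s ee 4 - l4 *s ee 3 + o34 *s ee 4)"

text \<open>The hypothesis puts xy, modulo e4, into the span of x and y whenever x and y are
  independent modulo e4. Polarising over sums of basis vectors makes the coefficients a single
  linear form \<lambda>.\<close>

lemma minor_two_form_algebra:
  assumes m: "\<And>x y. minor3 1 2 3 x y (alg4 a b c d e f x y) = 0"
  shows "\<exists>l1 l2 l3 l4 o12 o13 o14 o23 o24 o34.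
    alg4 a b c d e f = two_form_algebra l1 l2 l3 l4 o12 o13 o14 o23 o24 o34"
proof -
  note m' = m[unfolded minor3_def alg4_apply]
  have 1: "a $ 3 = 0" "b $ 2 = 0" "d $ 1 = 0"
    using m'[of "ee 1" "ee 2"] m'[of "ee 1" "ee 3"] m'[of "ee 2" "ee 3"] by simp_all
  have 2: "e $ 3 = 0" "f $ 2 = 0" "f $ 1 = 0" "c $ 3 = 0" "c $ 2 = 0" "e $ 1 = 0"
    using m'[of "ee 1 + ee 4" "ee 2"] m'[of "ee 1 + ee 4" "ee 3"] m'[of "ee 2 + ee 4" "ee 3"]
      m'[of "ee 2 + ee 4" "ee 1"] m'[of "ee 3 + ee 4" "ee 1"] m'[of "ee 3 + ee 4" "ee 2"]
    by (simp_all add: 1)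
  have 3: "d $ 2 = b $ 1" "a $ 1 = - d $ 3" "b $ 3 = a $ 2"
    using m'[of "ee 3" "ee 1 + ee 2"] m'[of "ee 2" "ee 1 + ee 3"] m'[of "ee 1" "ee 2 + ee 3"]
    by (simp_all add: 1 2)
  have 4: "e $ 2 = c $ 1" "f $ 3 = c $ 1"
    using m'[of "ee 3 + ee 4" "ee 1 + ee 2"] m'[of "ee 2 + ee 4" "ee 1 + ee 3"]
    by (simp_all add: 1 2 3)
  \<comment> \<open>In the products by e4 the term \<lambda>(x) y already contributes to the fourth
    coordinate, whence the differences \<open>c $ 4 - l1\<close> and so on.\<close>
  define l1 l2 l3 l4 where "l1 = a $ 2" and "l2 = d $ 3" and "l3 = - b $ 1" and "l4 = - c $ 1"
  have "l1 *s ee 2 - l2 *s ee 1 + a $ 4 *s ee 4 = a" "l1 *s ee 3 - l3 *s ee 1 + b $ 4 *s ee 4 = b"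
    "l1 *s ee 4 - l4 *s ee 1 + (c $ 4 - l1) *s ee 4 = c" "l2 *s ee 3 - l3 *s ee 2 + d $ 4 *s ee 4 = d"
    "l2 *s ee 4 - l4 *s ee 2 + (e $ 4 - l2) *s ee 4 = e" "l3 *s ee 4 - l4 *s ee 3 + (f $ 4 - l3) *s ee 4 = f"
    by (simp_all add: l1_def l2_def l3_def l4_def vec4_eq_iff 1 2 3 4)
  then have "alg4 a b c d e f =
      two_form_algebra l1 l2 l3 l4 (a $ 4) (b $ 4) (c $ 4 - l1) (d $ 4) (e $ 4 - l2) (f $ 4 - l3)"
    by (simp only: two_form_algebra_def)
  then show ?thesis by blast
qed

text \<open>Polynomials have no zero divisors. Taking the constant coefficient of one factor and the
  leading coefficient of the other decouples the two ends of a pencil of vectors.\<close>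

lemma mult_zero_quadratic:
  fixes a0 a1 a2 b0 b1 b2 :: complex
  assumes "\<And>t. (a0 + t * a1 + t ^ 2 * a2) * (b0 + t * b1 + t ^ 2 * b2) = 0"
  shows "a0 = 0 \<or> b2 = 0"
proof -
  have "poly ([:a0, a1, a2:] * [:b0, b1, b2:]) t = 0" for t
    using assms[of t] by (simp add: algebra_simps power2_eq_square)
  then have "[:a0, a1, a2:] * [:b0, b1, b2:] = 0"
    by (simp add: poly_all_0_iff_0[symmetric])
  then show ?thesis by auto
qed

text \<open>With \<lambda> = 0 the product is \<Omega>(x, y) e4, and P is the Pfaffian of \<Omega>.
  The vectors u and v are orthogonal to e3 and e4 and satisfy \<Omega>(u, v) = 1: the new basis is
  symplectic up to order.\<close>

lemma g6_form:
  assumes "o34 \<noteq> 0" "o12 * o34 - o13 * o24 + o14 * o23 \<noteq> 0"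
  shows "classified (two_form_algebra 0 0 0 0 o12 o13 o14 o23 o24 o34)"
proof -
  define P where "P = o12 * o34 - o13 * o24 + o14 * o23"
  have "P \<noteq> 0" using assms by (simp add: P_def)
  have "two_form_algebra 0 0 0 0 o12 o13 o14 o23 o24 o34 \<cong>\<^sub>a rep G6'"
    unfolding two_form_algebra_def rep.simps types_alg4
    by (rule alg4_iso'[where
          u = "(o34 / P) *s ee 1 - (o14 / P) *s ee 3 + (o13 / P) *s ee 4"
          and v = "ee 2 - (o24 / o34) *s ee 3 + (o23 / o34) *s ee 4" and w = "ee 4"
          and z = "- (1 / o34) *s ee 3"])
      (use assms(1) \<open>P \<noteq> 0\<close> in \<open>auto simp: alg4_compute field_simps\<close>, auto simp: P_def algebra_simps)
  then show ?thesis by (rule classifiedI)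
qed

text \<open>The two equations make \<Omega>(x, e4) a multiple of \<lambda>(x). The kernel of
  \<lambda> is spanned by e2 - m e1, e3 - n e1 and e4, and P is the value of \<Omega> on the first
  two, so P \<noteq> 0 makes it a Heisenberg ideal.\<close>

lemma g3_form:
  assumes "l1 \<noteq> 0" "l1 * o24 = l2 * o14" "l1 * o34 = l3 * o14"
    and "(l1 - o14) * o23 - (l2 - o24) * o13 + (l3 - o34) * o12 \<noteq> 0"
  shows "classified (two_form_algebra l1 l2 l3 0 o12 o13 o14 o23 o24 o34)"
proof -
  define m n where "m = l2 / l1" and "n = l3 / l1"
  define P p q r where "P = o23 + n * o12 - m * o13" and "p = o12 / l1" and "q = o13 / l1"
    and "r = 1 + o14 / l1"
  have l: "l2 = m * l1" "l3 = n * l1" "o24 = m * o14" "o34 = n * o14"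
    using assms(1-3) by (simp_all add: m_def n_def field_simps)
  have "(l1 - o14) * P \<noteq> 0"
    using assms(4) by (simp add: l P_def algebra_simps)
  then have P: "P \<noteq> 0" by simp
  have 1: "two_form_algebra l1 l2 l3 0 o12 o13 o14 o23 o24 o34 \<cong>\<^sub>a
      alg4 (ee 2 + p *s ee 4) (ee 3 + q *s ee 4) (r *s ee 4) (P *s ee 4) 0 0"
    unfolding two_form_algebra_def
    by (rule alg4_iso'[where u = "(1 / l1) *s ee 1" and v = "ee 2 - m *s ee 1" and w = "ee 3 - n *s ee 1"
          and z = "ee 4"])
      (use assms(1) in \<open>auto simp: alg4_compute l P_def p_def q_def r_def field_simps\<close>)
  have 2: "alg4 (ee 2 + p *s ee 4) (ee 3 + q *s ee 4) (r *s ee 4) (P *s ee 4) 0 0 \<cong>\<^sub>a rep (G3' r)"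
    unfolding rep.simps types_alg4
    by (rule alg4_iso'[where u = "ee 1 - (q / P) *s ee 2 + (p / P) *s ee 3" and v = "ee 2" and w = "ee 3"
          and z = "P *s ee 4"])
      (use P in \<open>auto simp: alg4_compute field_simps\<close>)
  show ?thesis
    by (rule classifiedI[OF iso_trans[OF 1 2]])
qed

lemma two_form_algebra_rotate:
  "two_form_algebra l1 l2 l3 0 o12 o13 o14 o23 o24 o34 \<cong>\<^sub>a
   two_form_algebra l2 l3 l1 0 o23 (- o12) o24 (- o13) o34 o14"
  unfolding two_form_algebra_def
  by (rule alg4_iso'[where u = "ee 2" and v = "ee 3" and w = "ee 1" and z = "ee 4"])
    (auto simp: alg4_compute)

text \<open>The conditions \<open>par\<close> express that the Jacobian vanishes when one argument
  is e4, and Q is its value on e1, e2, e3. For \<lambda> = 0, Q is minus the Pfaffian of \<Omega>.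
  Cyclic rotation of e1, e2, e3 moves a nonzero coefficient to where the normal forms want
  it.\<close>

lemma two_form_algebra_classified:
  defines "Q \<equiv> \<lambda>l1 l2 l3 o12 o13 o14 o23 o24 o34 :: complex.
    (l1 - o14) * o23 - (l2 - o24) * o13 + (l3 - o34) * o12"
  assumes par: "l1 * o24 = l2 * o14" "l1 * o34 = l3 * o14" "l2 * o34 = l3 * o24"
    and Q: "Q l1 l2 l3 o12 o13 o14 o23 o24 o34 \<noteq> 0"
  shows "classified (two_form_algebra l1 l2 l3 0 o12 o13 o14 o23 o24 o34)"
proof -
  note rot = two_form_algebra_rotate[of l1 l2 l3 o12 o13 o14 o23 o24 o34]
    iso_trans[OF two_form_algebra_rotate[of l1 l2 l3 o12 o13 o14 o23 o24 o34] two_form_algebra_rotate]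
  consider "l1 \<noteq> 0" | "l2 \<noteq> 0" | "l3 \<noteq> 0" | "l1 = 0" "l2 = 0" "l3 = 0" by blast
  then show ?thesis
  proof cases
    case 1
    then show ?thesis using par Q by (intro g3_form) (auto simp: Q_def)
  next
    case 2
    then show ?thesis using par Q
      by (intro classified_iso[OF rot(1) g3_form]) (auto simp: Q_def algebra_simps)
  next
    case 3
    then show ?thesis using par Q
      by (intro classified_iso[OF rot(2) g3_form]) (auto simp: Q_def algebra_simps)
  next
    case 4
    then have Q': "o12 * o34 - o13 * o24 + o14 * o23 \<noteq> 0"
      using Q by (auto simp: Q_def algebra_simps)
    then consider "o34 \<noteq> 0" | "o14 \<noteq> 0" | "o24 \<noteq> 0" by fastforce
    then show ?thesis
    proof cases
      case 1
      then show ?thesis using Q' 4 by (simp add: g6_form)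
    next
      case 2
      then show ?thesis using Q' unfolding 4
        by (intro classified_iso[OF rot(1)[unfolded 4] g6_form]) (auto simp: algebra_simps)
    next
      case 3
      then show ?thesis using Q' unfolding 4
        by (intro classified_iso[OF rot(2)[unfolded 4] g6_form]) (auto simp: algebra_simps)
    qed
  qed
qed

lemma nonlie_classified:
  assumes alg: "is_algebra \<mu>" and bl: "binary_lie_id \<mu>" and "\<not> lie \<mu>"
  shows "classified \<mu>"
proof -
  have self: "\<mu> x x = 0" and jac: "jacobian \<mu> x y (\<mu> x y) = 0" for x y
    using bl by (simp_all add: binary_lie_id_def)
  obtain a b c d e f where iso0: "\<mu> \<cong>\<^sub>a alg4 a b c d e f"
    and m: "\<And>x y. minor3 1 2 3 x y (alg4 a b c d e f x y) = 0"
    using nonlie_kernel[OF alg self jac assms(3)] by blast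
  obtain l1 l2 l3 l4 o12 o13 o14 o23 o24 o34
    where eq: "alg4 a b c d e f = two_form_algebra l1 l2 l3 l4 o12 o13 o14 o23 o24 o34"
    using minor_two_form_algebra[OF m] by blast
  define \<nu> where "\<nu> = two_form_algebra l1 l2 l3 l4 o12 o13 o14 o23 o24 o34"
  have iso: "\<mu> \<cong>\<^sub>a \<nu>" using iso0 by (simp add: eq \<nu>_def)
  have alg\<nu>: "is_algebra \<nu>" by (simp add: \<nu>_def two_form_algebra_def alg4_algebra)
  have bl\<nu>: "binary_lie_id \<nu>"
    by (rule binary_lie_id_closed[OF alg iso_degenerates[OF alg alg\<nu> iso] bl])
  have nonlie: "\<not> lie \<nu>"
    using iso_lie[OF alg\<nu> alg iso_sym[OF iso]] assms(3) by blast
  have self\<nu>: "\<nu> x x = 0" and jac\<nu>: "jacobian \<nu> x y (\<nu> x y) = 0" for x y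
    using bl\<nu> by (simp_all add: binary_lie_id_def)
  define \<Omega> where "\<Omega> x y = (x $ 1 * y $ 2 - x $ 2 * y $ 1) * o12 + (x $ 1 * y $ 3 - x $ 3 * y $ 1) * o13 +
     (x $ 1 * y $ 4 - x $ 4 * y $ 1) * o14 + (x $ 2 * y $ 3 - x $ 3 * y $ 2) * o23 +
     (x $ 2 * y $ 4 - x $ 4 * y $ 2) * o24 + (x $ 3 * y $ 4 - x $ 4 * y $ 3) * o34" for x y :: "complex ^ 4"
  define \<Lambda> where "\<Lambda> x = l1 * x $ 1 + l2 * x $ 2 + l3 * x $ 3 + l4 * x $ 4" for x :: "complex ^ 4"
  have \<nu>: "\<nu> x y = \<Lambda> x *s y - \<Lambda> y *s x + \<Omega> x y *s ee 4" for x y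
    by (simp add: \<nu>_def two_form_algebra_def alg4_apply \<Omega>_def \<Lambda>_def vec4_eq_iff algebra_simps)
  have jac_third: "jacobian \<nu> x y (r *s y - s *s x + t *s z) = t *s jacobian \<nu> x y z" for x y z r s t
  proof -
    have ac: "\<nu> y x = - \<nu> x y" "\<nu> (\<nu> x y) y = - \<nu> y (\<nu> x y)" "\<nu> (\<nu> x y) x = - \<nu> x (\<nu> x y)"
      by (rule anticomm[OF alg\<nu> self\<nu>])+
    show ?thesis
      by (simp add: jacobian_def alg_simps[OF alg\<nu>] self\<nu> ac vec4_eq_iff algebra_simps)
  qed
  \<comment> \<open>The Jacobian is alternating, so only the summand \<Omega>(x, y) e4 of xy
    contributes to J(x, y, xy).\<close>
  have prod: "\<Omega> x y *s jacobian \<nu> x y (ee 4) = 0" for x y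
    using jac\<nu>[of x y] unfolding \<nu>[of x y] jac_third .
  have \<Omega>_quad: "\<Omega> (p + t *s r) (q + t *s s) = \<Omega> p q + t * (\<Omega> p s + \<Omega> r q) + t ^ 2 * \<Omega> r s"
    for p q r s t
    by (simp add: \<Omega>_def algebra_simps power2_eq_square)
  have J_quad: "jacobian \<nu> (p + t *s r) (q + t *s s) (ee 4) $ k = jacobian \<nu> p q (ee 4) $ k
     + t * (jacobian \<nu> p s (ee 4) $ k + jacobian \<nu> r q (ee 4) $ k) + t ^ 2 * jacobian \<nu> r s (ee 4) $ k"
    for p q r s t k
    by (simp add: jacobian_def alg_simps[OF alg\<nu>] algebra_simps power2_eq_square)
  have alternative: "\<Omega> p q = 0 \<or> jacobian \<nu> r s (ee 4) $ k = 0" for p q r s k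
  proof (rule mult_zero_quadratic)
    fix t
    have "\<Omega> (p + t *s r) (q + t *s s) * jacobian \<nu> (p + t *s r) (q + t *s s) (ee 4) $ k = 0"
      using prod[of "p + t *s r" "q + t *s s"] by auto
    then show "(\<Omega> p q + t * (\<Omega> p s + \<Omega> r q) + t ^ 2 * \<Omega> r s) * (jacobian \<nu> p q (ee 4) $ k
       + t * (jacobian \<nu> p s (ee 4) $ k + jacobian \<nu> r q (ee 4) $ k) + t ^ 2 * jacobian \<nu> r s (ee 4) $ k) = 0"
      unfolding \<Omega>_quad J_quad .
  qed
  \<comment> \<open>With \<Omega> = 0 the product \<lambda>(x) y - \<lambda>(y) x would satisfy the
    Jacobi identity.\<close>
  have not_zero: "\<not> (o12 = 0 \<and> o13 = 0 \<and> o14 = 0 \<and> o23 = 0 \<and> o24 = 0 \<and> o34 = 0)"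
  proof
    assume "o12 = 0 \<and> o13 = 0 \<and> o14 = 0 \<and> o23 = 0 \<and> o24 = 0 \<and> o34 = 0"
    then have "jacobian \<nu> x y z = 0" for x y z
      by (subst jacobian_expand[OF alg\<nu> self\<nu>])
        (simp add: jacobian_def \<nu>_def two_form_algebra_def alg4_apply vec4_eq_iff algebra_simps)
    then show False using nonlie self\<nu> by (auto simp: lie_def)
  qed
  have "\<exists>p q. \<Omega> p q \<noteq> 0"
  proof (rule ccontr)
    assume "\<not> ?thesis"
    then have "\<Omega> p q = 0" for p q by blast
    from this[of "ee 1" "ee 2"] this[of "ee 1" "ee 3"] this[of "ee 1" "ee 4"] this[of "ee 2" "ee 3"]
      this[of "ee 2" "ee 4"] this[of "ee 3" "ee 4"]
    show False using not_zero by (simp add: \<Omega>_def)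
  qed
  then have J4: "jacobian \<nu> r s (ee 4) = 0" for r s
    using alternative by (simp add: vec_eq_iff) blast
  note J4' = J4[unfolded jacobian_def \<nu>_def two_form_algebra_def alg4_apply vec4_eq_iff]
  have l4: "l4 = 0"
  proof (rule ccontr)
    assume "l4 \<noteq> 0"
    then have "o24 = 0" "o14 = 0" "o34 = 0"
      using J4'[of "ee 1" "ee 2"] J4'[of "ee 1" "ee 3"] by (simp_all add: algebra_simps)
    then have "o12 = 0 \<and> o13 = 0 \<and> o23 = 0"
      using J4'[of "ee 1" "ee 2"] J4'[of "ee 1" "ee 3"] J4'[of "ee 2" "ee 3"] \<open>l4 \<noteq> 0\<close>
      by (simp add: algebra_simps)
    with \<open>o24 = 0\<close> \<open>o14 = 0\<close> \<open>o34 = 0\<close> show False using not_zero by simp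
  qed
  have par: "l1 * o24 = l2 * o14" "l1 * o34 = l3 * o14" "l2 * o34 = l3 * o24"
    using J4'[of "ee 1" "ee 2"] J4'[of "ee 1" "ee 3"] J4'[of "ee 2" "ee 3"]
    by (simp_all add: l4 algebra_simps)
  have "(l1 - o14) * o23 - (l2 - o24) * o13 + (l3 - o34) * o12 \<noteq> 0"
  proof
    assume Q: "(l1 - o14) * o23 - (l2 - o24) * o13 + (l3 - o34) * o12 = 0"
    have "jacobian \<nu> (ee 1) (ee 2) (ee 3) =
        ((l1 - o14) * o23 - (l2 - o24) * o13 + (l3 - o34) * o12) *s ee 4"
      by (simp add: jacobian_def \<nu>_def two_form_algebra_def alg4_apply vec4_eq_iff l4 algebra_simps)
    then have "jacobian \<nu> x y z = 0" for x y z
      by (subst jacobian_expand[OF alg\<nu> self\<nu>]) (simp add: J4 Q)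
    then show False using nonlie self\<nu> by (auto simp: lie_def)
  qed
  then have "classified \<nu>"
    unfolding \<nu>_def l4 by (intro two_form_algebra_classified par)
  then show ?thesis by (rule classified_iso[OF iso])
qed

theorem binary_lie_classified:
  assumes "is_algebra \<mu>" "binary_lie_id \<mu>"
  shows "classified \<mu>"
  using lie_classified nonlie_classified assms by blast

subsection \<open>The listed algebras are binary Lie\<close>

lemma binary_lie_imp_id:
  assumes "binary_lie \<mu>" shows "is_algebra \<mu>" "binary_lie_id \<mu>"
proof -
  have lie: "lie_on \<mu> (subalgebra \<mu> hull {x, y})" for x y
    using assms by (simp add: binary_lie_def)
  have x: "x \<in> subalgebra \<mu> hull {x, y}" and y: "y \<in> subalgebra \<mu> hull {x, y}" for x y
    using hull_subset[of "{x, y}" "subalgebra \<mu>"] by auto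
  have "\<mu> x y \<in> subalgebra \<mu> hull {x, y}" for x y
    by (auto simp: hull_def subalgebra_def)
  then show "binary_lie_id \<mu>"
    using lie x y unfolding binary_lie_id_def lie_on_def by blast
  show "is_algebra \<mu>"
    using assms by (simp add: binary_lie_def)
qed

lemma lie_imp_binary_lie: "is_algebra \<mu> \<Longrightarrow> lie \<mu> \<Longrightarrow> binary_lie \<mu>"
  by (simp add: binary_lie_def lie_def lie_on_def)

text \<open>One vector z, independent of x and y, is enough to close the span of x, y, z under the
  product. The generated subalgebra lies in this span, where the Jacobian is checked.\<close>

lemma binary_lieI:
  assumes "is_algebra \<mu>" "\<And>x. \<mu> x x = 0"
    and "\<And>x y a b c a' b' c'. \<exists>p q r. \<mu> (a *s x + b *s y + c *s z) (a' *s x + b' *s y + c' *s z)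
      = p *s x + q *s y + r *s z"
    and "\<And>x y a b c a' b' c' a'' b'' c''. jacobian \<mu> (a *s x + b *s y + c *s z)
      (a' *s x + b' *s y + c' *s z) (a'' *s x + b'' *s y + c'' *s z) = 0"
  shows "binary_lie \<mu>"
proof -
  have "lie_on \<mu> (subalgebra \<mu> hull {x, y})" for x y
  proof -
    define U where "U = {v. \<exists>a b c. v = a *s x + b *s y + c *s z}"
    have UI: "a *s x + b *s y + c *s z \<in> U" for a b c
      unfolding U_def by blast
    have "vec.subspace U"
    proof (rule vec.subspaceI)
      show "0 \<in> U" using UI[of 0 0 0] by simp
    next
      fix u v assume "u \<in> U" "v \<in> U"
      then obtain a b c a' b' c' where "u = a *s x + b *s y + c *s z" "v = a' *s x + b' *s y + c' *s z"
        unfolding U_def by blast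
      then have "u + v = (a + a') *s x + (b + b') *s y + (c + c') *s z"
        by (simp add: vec_eq_iff algebra_simps)
      then show "u + v \<in> U" by (simp only: UI)
    next
      fix k u assume "u \<in> U"
      then obtain a b c where "u = a *s x + b *s y + c *s z"
        unfolding U_def by blast
      then have "k *s u = (k * a) *s x + (k * b) *s y + (k * c) *s z"
        by (simp add: vec_eq_iff algebra_simps)
      then show "k *s u \<in> U" by (simp only: UI)
    qed
    moreover have "\<mu> u v \<in> U" if "u \<in> U" "v \<in> U" for u v
      using that assms(3) unfolding U_def by blast
    ultimately have "subalgebra \<mu> U"
      by (simp add: subalgebra_def)
    moreover have "x \<in> U" "y \<in> U"
      using UI[of 1 0 0] UI[of 0 1 0] by simp_all
    ultimately have sub: "subalgebra \<mu> hull {x, y} \<subseteq> U"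
      by (intro hull_minimal) auto
    have "jacobian \<mu> u v w = 0" if "u \<in> U" "v \<in> U" "w \<in> U" for u v w
      using that assms(4) unfolding U_def by blast
    then show ?thesis
      using sub assms(2) unfolding lie_on_def by blast
  qed
  then show ?thesis
    using assms(1) by (simp add: binary_lie_def)
qed

text \<open>In the coordinates i, j, k the three arguments are combinations of the two projections
  of x and y, because z projects to 0.\<close>

lemma minor3_span:
  assumes "z $ i = 0" "z $ j = 0" "z $ k = 0"
  shows "minor3 i j k (a *s x + b *s y + c *s z) (a' *s x + b' *s y + c' *s z)
    (a'' *s x + b'' *s y + c'' *s z) = 0"
  by (simp add: minor3_def assms algebra_simps)

lemma g3_binary_lie: "binary_lie (g3 k)"
proof (rule binary_lieI[where z = "ee 4"])
  fix x y :: "complex ^ 4" and a b c a' b' c' a'' b'' c'' :: complex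
  let ?D = "a * b' - b * a'"
  \<comment> \<open>Modulo e4 the product of x and y is \<open>x $ 1 *s y - y $ 1 *s x\<close>, and
    passing to combinations of x, y, e4 multiplies it by the determinant \<open>?D\<close>.\<close>
  have "g3 k (a *s x + b *s y + c *s ee 4) (a' *s x + b' *s y + c' *s ee 4)
      = (- ?D * y $ 1) *s x + (?D * x $ 1) *s y + (g3 k (a *s x + b *s y + c *s ee 4)
        (a' *s x + b' *s y + c' *s ee 4) $ 4 + ?D * y $ 1 * x $ 4 - ?D * x $ 1 * y $ 4) *s ee 4"
    by (simp add: types_alg4 alg4_apply vec4_eq_iff algebra_simps)
  then show "\<exists>p q r. g3 k (a *s x + b *s y + c *s ee 4) (a' *s x + b' *s y + c' *s ee 4)
      = p *s x + q *s y + r *s ee 4" by blast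
  have "jacobian (g3 k) u v w = ((2 - k) * minor3 1 2 3 u v w) *s ee 4" for u v w
    by (simp add: jacobian_def types_alg4 alg4_apply vec4_eq_iff minor3_def algebra_simps)
  then show "jacobian (g3 k) (a *s x + b *s y + c *s ee 4) (a' *s x + b' *s y + c' *s ee 4)
      (a'' *s x + b'' *s y + c'' *s ee 4) = 0"
    by (simp only: minor3_span[where z = "ee 4"] ee_nth) simp
qed (simp_all only: types_alg4 alg4_algebra alg4_self)

lemma g6_binary_lie: "binary_lie g6"
proof (rule binary_lieI[where z = "ee 3"])
  fix x y :: "complex ^ 4" and a b c a' b' c' a'' b'' c'' :: complex
  have "g6 u v = 0 *s x + 0 *s y + (g6 u v $ 3) *s ee 3" for u v
    by (simp add: types_alg4 alg4_apply vec4_eq_iff)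
  then show "\<exists>p q r. g6 (a *s x + b *s y + c *s ee 3) (a' *s x + b' *s y + c' *s ee 3)
      = p *s x + q *s y + r *s ee 3" by blast
  have "jacobian g6 u v w = (minor3 1 2 4 u v w) *s ee 3" for u v w
    by (simp add: jacobian_def types_alg4 alg4_apply vec4_eq_iff minor3_def algebra_simps)
  then show "jacobian g6 (a *s x + b *s y + c *s ee 3) (a' *s x + b' *s y + c' *s ee 3)
      (a'' *s x + b'' *s y + c'' *s ee 3) = 0"
    by (simp only: minor3_span[where z = "ee 3"] ee_nth) simp
qed (simp_all only: types_alg4 alg4_algebra alg4_self)

lemma rep_binary_lie: "binary_lie (rep t)"
proof (cases "(\<exists>b. t = G3' b) \<or> t = G6'")
  case True
  then show ?thesis using g3_binary_lie g6_binary_lie by auto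
next
  case False
  then show ?thesis
    by (intro lie_imp_binary_lie rep_algebra rep_lie) auto
qed

subsection \<open>The degeneration graph\<close>

text \<open>The length of a longest path from the type down to \<open>C4'\<close>.\<close>

fun level :: "kind \<Rightarrow> nat" where
  "level C4' = 0" | "level N3' = 1" | "level G1' = 1" | "level N4' = 2" | "level R2' = 2"
| "level (G2' b) = 2" | "level (G3' b) = 3" | "level (G4' a b) = 3" | "level G6' = 3"
| "level (G5' a) = 4" | "level RR' = 5" | "level SL' = 5"

definition reach :: "kind \<Rightarrow> kind \<Rightarrow> bool" where
  "reach s t \<longleftrightarrow> (iso_class (rep s), iso_class (rep t)) \<in> listed_edges\<^sup>*"

lemma reach_trans [trans]: "reach s t \<Longrightarrow> reach t u \<Longrightarrow> reach s u"
  unfolding reach_def by (rule rtrancl_trans)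

lemma reach_refl: "reach s s"
  by (simp add: reach_def)

lemma reach_iso: "rep s \<cong>\<^sub>a rep t \<Longrightarrow> reach s t"
  using iso_class_eq_iff[OF rep_algebra rep_algebra, of s t] by (simp add: reach_def)

lemma reach_listed: "listed (rep s) (rep t) \<Longrightarrow> reach s t"
  unfolding reach_def listed_edges_def by blast

lemma reach_edge:
  "reach RR' (G5' 0)" "reach RR' (G4' a 0)" "reach SL' (G5' (-1))" "reach (G5' a) (G4' a (a + 1))"
  "reach (G5' 1) (G3' 2)" "reach (G4' a b) N4'" "reach (G4' 0 0) R2'" "reach (G4' 1 b) (G2' b)"
  "reach G6' R2'" "reach N4' N3'" "reach (G3' b) (G2' b)" "reach R2' N3'" "reach (G2' b) N3'"
  "reach (G2' 1) G1'" "reach N3' C4'" "reach G1' C4'"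
  by (rule reach_listed; simp only: rep.simps; rule listed.intros)+

lemma reach_below:
  "reach N4' C4'" "reach R2' C4'" "reach (G2' b) C4'" "reach (G4' a b) N3'" "reach (G4' a b) C4'"
  "reach (G5' a) N4'" "reach (G5' a) N3'" "reach (G5' a) C4'" "reach G6' N3'" "reach G6' C4'"
  "reach (G3' b) N3'" "reach (G3' b) C4'" "reach (G3' 1) G1'"
  "reach RR' N4'" "reach RR' N3'" "reach RR' C4'" "reach RR' R2'" "reach RR' (G2' 0)"
  "reach SL' N4'" "reach SL' N3'" "reach SL' C4'"
  by (meson reach_edge reach_trans)+

lemma below_g4_reach:
  assumes "below_g4 a b t"
  shows "reach (G4' a b) t" "(level t = 3 \<and> g4 a b \<cong>\<^sub>a rep t) \<or> level t < 3"
proof -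
  have iso: "reach (G4' a b) (G4' c d)" if "proportional a b c d" for c d
    using proportional_g4[OF that] by (intro reach_iso) simp
  have "reach (G4' a b) (G2' c)" if "proportional a b 1 c" for c
    using iso[OF that] reach_edge(8) by (rule reach_trans)
  moreover have "reach (G4' a b) R2'" if "proportional a b 0 0"
    using iso[OF that] reach_edge(7) by (rule reach_trans)
  ultimately show "reach (G4' a b) t"
    using assms iso reach_below reach_edge reach_trans[OF _ reach_edge(14)] unfolding below_g4_def
    by (cases t) auto
  show "(level t = 3 \<and> g4 a b \<cong>\<^sub>a rep t) \<or> level t < 3"
    using assms proportional_g4 unfolding below_g4_def by (cases t) auto
qed

text \<open>The candidates of each type are matched with paths one by one. Candidates of equal level
  differ at most by parameters in the same proportion, hence are isomorphic.\<close>

lemma degenerates_cases: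
  assumes "rep s \<leadsto> rep t"
  shows "reach s t \<and> ((level s = level t \<and> rep s \<cong>\<^sub>a rep t) \<or> level t < level s)"
proof (cases s)
  case C4'
  then show ?thesis using deg_from_C4[of t] assms by (simp add: reach_refl iso_refl)
next
  case N3'
  then show ?thesis using deg_from_n3_C[of t] assms by (auto simp: reach_refl iso_refl reach_edge)
next
  case N4'
  then show ?thesis
    using deg_from_n4[of t] assms by (auto simp: reach_refl iso_refl reach_edge reach_below)
next
  case R2'
  then show ?thesis
    using deg_from_r2_C2[of t] assms by (auto simp: reach_refl iso_refl reach_edge reach_below)
next
  case G1'
  then show ?thesis using deg_from_g1[of t] assms by (auto simp: reach_refl iso_refl reach_edge)
next
  case (G2' b)
  then show ?thesis
    using deg_from_g2[of b t] assms by (auto simp: reach_refl iso_refl reach_edge reach_below)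
next
  case (G3' b)
  then show ?thesis
    using deg_from_g3[of b t] assms by (auto simp: reach_refl iso_refl reach_edge reach_below)
next
  case (G4' a b)
  then show ?thesis
    using deg_from_g4[of a b t] assms below_g4_reach[of a b t] by auto
next
  case (G5' a)
  then consider c where "t = G5' c" "proportional a (a + 1) c (c + 1)" | "t = G3' 2" "a = 1"
    | "below_g4 a (a + 1) t"
    using deg_from_g5[of a t] assms by auto
  then show ?thesis
  proof cases
    case 1
    then have "rep s \<cong>\<^sub>a rep t" using proportional_g5 G5' by simp
    then show ?thesis using reach_iso 1 G5' by simp
  next
    case 2
    then show ?thesis using G5' by (simp add: reach_edge)
  next
    case 3
    then show ?thesis
      using below_g4_reach[of a "a + 1" t] reach_trans[OF reach_edge(4)[of a]] G5' by auto
  qed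
next
  case G6'
  then show ?thesis
    using deg_from_g6[of t] assms by (auto simp: reach_refl iso_refl reach_edge reach_below)
next
  case RR'
  have "reach RR' (G4' a b)" if "a * b = 0" for a b
    using that reach_edge(2) reach_trans[OF reach_edge(2)[of b] reach_iso[of "G4' b 0" "G4' 0 b"]]
      g4_swap[of b 0] by auto
  then show ?thesis
    using deg_from_r2_r2[of t] assms RR'
    by (cases t) (auto simp: reach_refl iso_refl reach_edge reach_below)
next
  case SL'
  have "reach SL' (G4' a b)" if "1 + a + b = 0" "a * b = 0" for a b
  proof -
    have 1: "reach SL' (G4' (-1) 0)"
      using reach_trans[OF reach_edge(3) reach_edge(4)] by simp
    have 2: "reach (G4' (-1) 0) (G4' 0 (-1))"
      by (rule reach_iso) (simp add: g4_swap)
    have "(a = -1 \<and> b = 0) \<or> (a = 0 \<and> b = -1)"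
      using that by (auto simp: add_eq_0_iff)
    then show ?thesis
      using 1 reach_trans[OF 1 2] by auto
  qed
  then show ?thesis
    using deg_from_sl2_C[of t] assms SL'
    by (cases t) (auto simp: reach_refl iso_refl reach_edge reach_below)
qed

lemma level_iso:
  assumes "rep s \<cong>\<^sub>a rep t" shows "level s = level t"
  using degenerates_cases[OF iso_degenerates[OF rep_algebra rep_algebra assms]]
    degenerates_cases[OF iso_degenerates[OF rep_algebra rep_algebra iso_sym[OF assms]]] by auto

lemma listed_degenerates: "listed A B \<Longrightarrow> A \<leadsto> B"
  by (induction rule: listed.induct)
    (simp_all add: deg_r2_r2_g5 deg_r2_r2_g4 deg_sl2_C_g5 deg_g5_g4 deg_g5_g3 deg_g4_n4 deg_g4_r2_C2
      deg_g4_g2 deg_g6_r2_C2 deg_n4_n3_C deg_g3_g2 deg_r2_C2_n3_C deg_g2_n3_C deg_g2_g1 deg_n3_C_C4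
      deg_g1_C4)

lemma listed_rep:
  assumes "listed A B"
  shows "\<exists>s t. A = rep s \<and> B = rep t \<and>
    (level s = Suc (level t) \<or> (\<exists>a. s = RR' \<and> t = G4' a 0))"
  using assms
proof cases
  case 1 then show ?thesis by (intro exI[of _ RR'] exI[of _ "G5' 0"]) simp
next
  case (2 a) then show ?thesis by (intro exI[of _ RR'] exI[of _ "G4' a 0"]) simp
next
  case 3 then show ?thesis by (intro exI[of _ SL'] exI[of _ "G5' (-1)"]) simp
next
  case (4 a) then show ?thesis by (intro exI[of _ "G5' a"] exI[of _ "G4' a (a + 1)"]) simp
next
  case 5 then show ?thesis by (intro exI[of _ "G5' 1"] exI[of _ "G3' 2"]) simp
next
  case (6 a b) then show ?thesis by (intro exI[of _ "G4' a b"] exI[of _ N4']) simp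
next
  case 7 then show ?thesis by (intro exI[of _ "G4' 0 0"] exI[of _ R2']) simp
next
  case (8 b) then show ?thesis by (intro exI[of _ "G4' 1 b"] exI[of _ "G2' b"]) simp
next
  case 9 then show ?thesis by (intro exI[of _ G6'] exI[of _ R2']) simp
next
  case 10 then show ?thesis by (intro exI[of _ N4'] exI[of _ N3']) simp
next
  case (11 b) then show ?thesis by (intro exI[of _ "G3' b"] exI[of _ "G2' b"]) simp
next
  case 12 then show ?thesis by (intro exI[of _ R2'] exI[of _ N3']) simp
next
  case (13 b) then show ?thesis by (intro exI[of _ "G2' b"] exI[of _ N3']) simp
next
  case 14 then show ?thesis by (intro exI[of _ "G2' 1"] exI[of _ G1']) simp
next
  case 15 then show ?thesis by (intro exI[of _ N3'] exI[of _ C4']) simp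
next
  case 16 then show ?thesis by (intro exI[of _ G1'] exI[of _ C4']) simp
qed

lemma listed_algebra: "listed A B \<Longrightarrow> is_algebra A \<and> is_algebra B"
  using listed_rep rep_algebra by blast

lemma listed_not_iso:
  assumes "listed A B" shows "\<not> A \<cong>\<^sub>a B"
proof
  assume "A \<cong>\<^sub>a B"
  obtain s t where st: "A = rep s" "B = rep t" and "level s \<noteq> level t"
    using listed_rep[OF assms] by fastforce
  then show False
    using level_iso[of s t] \<open>A \<cong>\<^sub>a B\<close> by simp
qed

lemma path_degenerates:
  assumes "(X, Y) \<in> listed_edges\<^sup>*"
  shows "X = iso_class A \<Longrightarrow> Y = iso_class B \<Longrightarrow> is_algebra A \<Longrightarrow> is_algebra B \<Longrightarrow> A \<leadsto> B"
  using assms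
proof (induction arbitrary: B rule: rtrancl_induct)
  case base
  then show ?case using iso_class_eq_iff iso_degenerates by metis
next
  case (step Y Z)
  then obtain A' B' where l: "Y = iso_class A'" "Z = iso_class B'" "listed A' B'"
    by (auto simp: listed_edges_def)
  have alg: "is_algebra A'" "is_algebra B'"
    using listed_algebra[OF l(3)] by blast+
  have "A \<leadsto> A'"
    by (rule step.IH) (use step.prems l alg in auto)
  moreover have "B' \<cong>\<^sub>a B"
    using step.prems l alg iso_class_eq_iff by metis
  ultimately show ?case
    using listed_degenerates[OF l(3)] degenerates_trans degenerates_iso step.prems alg by blast
qed

section \<open>From the types to arbitrary binary Lie algebras\<close>

lemma binary_lie_rep:
  assumes "is_algebra A" "binary_lie_id A"
  shows "\<exists>s. A \<cong>\<^sub>a rep s"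
  using binary_lie_classified[OF assms] by (simp add: classified_def)

lemma degenerates_rep:
  assumes "is_algebra A" "is_algebra B" "A \<leadsto> B" "A \<cong>\<^sub>a rep s" "B \<cong>\<^sub>a rep t"
  shows "rep s \<leadsto> rep t"
proof -
  have "rep s \<leadsto> B"
    by (rule iso_degenerates_trans[OF rep_algebra assms(1) iso_sym[OF assms(4)] assms(3)])
  then show ?thesis
    by (rule degenerates_iso[OF rep_algebra rep_algebra _ assms(5)])
qed

lemma degenerates_iff_path:
  assumes "binary_lie A" "binary_lie B"
  shows "A \<leadsto> B \<longleftrightarrow> (iso_class A, iso_class B) \<in> listed_edges\<^sup>*"
proof
  note A = binary_lie_imp_id[OF assms(1)] and B = binary_lie_imp_id[OF assms(2)]
  show "A \<leadsto> B" if "(iso_class A, iso_class B) \<in> listed_edges\<^sup>*"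
    by (rule path_degenerates[OF that refl refl A(1) B(1)])
  assume "A \<leadsto> B"
  obtain s where s: "A \<cong>\<^sub>a rep s" using binary_lie_rep[OF A] by blast
  obtain t where t: "B \<cong>\<^sub>a rep t" using binary_lie_rep[OF B] by blast
  have "rep s \<leadsto> rep t"
    by (rule degenerates_rep[OF A(1) B(1) \<open>A \<leadsto> B\<close> s t])
  then have "reach s t"
    using degenerates_cases by blast
  moreover have "iso_class A = iso_class (rep s)" "iso_class B = iso_class (rep t)"
    using s t iso_class_eq_iff rep_algebra A B by blast+
  ultimately show "(iso_class A, iso_class B) \<in> listed_edges\<^sup>*"
    by (simp add: reach_def)
qed

text \<open>A proper intermediate algebra would have a level strictly between those of A and B,
  while a listed edge drops by one level unless it leads from \<open>r2_r2\<close> to some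
  \<open>g4 a 0\<close>.\<close>

lemma primary_listed:
  assumes "listed A B" "(iso_class A, iso_class B) \<noteq> (iso_class r2_r2, iso_class (g4 1 0))"
  shows "primary_degeneration A B"
  unfolding primary_degeneration_def
proof (intro conjI notI)
  show "A \<leadsto> B" by (rule listed_degenerates[OF assms(1)])
  show "A \<cong>\<^sub>a B \<Longrightarrow> False" using listed_not_iso[OF assms(1)] by blast
  assume "\<exists>C. is_algebra C \<and> \<not> C \<cong>\<^sub>a A \<and> \<not> C \<cong>\<^sub>a B \<and> A \<leadsto> C \<and> C \<leadsto> B"
  then obtain C where C: "is_algebra C" "\<not> C \<cong>\<^sub>a A" "\<not> C \<cong>\<^sub>a B" "A \<leadsto> C" "C \<leadsto> B" by blast
  obtain s t where st: "A = rep s" "B = rep t"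
    and level: "level s = Suc (level t) \<or> (\<exists>a. s = RR' \<and> t = G4' a 0)"
    using listed_rep[OF assms(1)] by blast
  have "binary_lie_id C"
    using binary_lie_id_closed[OF rep_algebra] C(4) binary_lie_imp_id[OF rep_binary_lie] st by blast
  then obtain u where u: "C \<cong>\<^sub>a rep u" using binary_lie_rep[OF C(1)] by blast
  have su: "rep s \<leadsto> rep u"
    using degenerates_rep[OF rep_algebra C(1) _ iso_refl u] C(4) st by blast
  have ut: "rep u \<leadsto> rep t"
    using degenerates_rep[OF C(1) rep_algebra _ u iso_refl] C(5) st by blast
  have "\<not> rep s \<cong>\<^sub>a rep u" "\<not> rep u \<cong>\<^sub>a rep t"
    using C(2,3) u st iso_trans iso_sym by blast+
  then have less: "level u < level s" "level t < level u"
    using degenerates_cases[OF su] degenerates_cases[OF ut] by blast+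
  with level obtain a where a: "s = RR'" "t = G4' a 0" by auto
  \<comment> \<open>Level 4 means some \<open>g5 c\<close>, and the two-dimensional derived algebra
    of \<open>r2_r2\<close> forces c = 0. Below \<open>g5 0\<close> only the proportion 1 : 0 : 1
    occurs among the \<open>g4\<close>, which is the pair excluded by hypothesis.\<close>
  then have "level u = 4" using less by simp
  then obtain c where c: "u = G5' c" by (cases u) auto
  have "c = 0"
    using deg_from_r2_r2[of u] su a c by simp
  then have "below_g4 0 (0 + 1) (G4' a 0)"
    using deg_from_g5[of 0 t] ut a c by simp
  then have "g4 0 1 \<cong>\<^sub>a g4 a 0"
    using below_g4_reach(2) by fastforce
  then have "g4 a 0 \<cong>\<^sub>a g4 1 0"
    using iso_trans[OF iso_sym g4_swap] by blast
  then have "iso_class (g4 a 0) = iso_class (g4 1 0)"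
    using iso_class_eq_iff types_algebra by blast
  then show False
    using assms(2) st a by simp
qed

lemma primary_graph_eq:
  "primary_graph = listed_edges - {(iso_class r2_r2, iso_class (g4 1 0))}"
proof (intro equalityI subsetI)
  fix p assume "p \<in> primary_graph"
  then obtain A B where p: "p = (iso_class A, iso_class B)" and bl: "binary_lie A" "binary_lie B"
    and deg: "A \<leadsto> B" "\<not> A \<cong>\<^sub>a B"
    and prim: "\<And>C. is_algebra C \<Longrightarrow> A \<leadsto> C \<Longrightarrow> C \<leadsto> B \<Longrightarrow> C \<cong>\<^sub>a A \<or> C \<cong>\<^sub>a B"
    unfolding primary_graph_def primary_degeneration_def by blast
  have alg: "is_algebra A" "is_algebra B"
    using bl binary_lie_imp_id by blast+
  have "(iso_class A, iso_class B) \<in> listed_edges\<^sup>*"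
    using degenerates_iff_path[OF bl] deg by blast
  moreover have "iso_class A \<noteq> iso_class B"
    using iso_class_eq_iff[OF alg] deg by blast
  \<comment> \<open>The first edge of a path from A to B already ends in a proper degeneration of A
    above B; by primality this end is isomorphic to B.\<close>
  ultimately obtain Y where Y: "(iso_class A, Y) \<in> listed_edges" "(Y, iso_class B) \<in> listed_edges\<^sup>*"
    by (metis converse_rtranclE)
  then obtain A' C where C: "iso_class A = iso_class A'" "Y = iso_class C" "listed A' C"
    by (auto simp: listed_edges_def)
  have algC: "is_algebra A'" "is_algebra C"
    using listed_algebra[OF C(3)] by blast+
  have AA': "A \<cong>\<^sub>a A'"
    using C(1) iso_class_eq_iff[OF alg(1) algC(1)] by blast
  have "A \<leadsto> C"
    by (rule iso_degenerates_trans[OF alg(1) algC(1) AA' listed_degenerates[OF C(3)]])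
  moreover have "C \<leadsto> B"
    by (rule path_degenerates[OF Y(2) C(2) refl algC(2) alg(2)])
  moreover have "\<not> C \<cong>\<^sub>a A"
    using listed_not_iso[OF C(3)] AA' iso_trans iso_sym by blast
  ultimately have "C \<cong>\<^sub>a B"
    using prim algC by blast
  then have "p \<in> listed_edges"
    using Y(1) C(2) iso_class_eq_iff[OF algC(2) alg(2)] p by simp
  moreover have "p \<noteq> (iso_class r2_r2, iso_class (g4 1 0))"
  proof
    assume "p = (iso_class r2_r2, iso_class (g4 1 0))"
    then have iso: "A \<cong>\<^sub>a rep RR'" "B \<cong>\<^sub>a rep (G4' 1 0)"
      using p iso_class_eq_iff[OF alg(1) types_algebra(5)] iso_class_eq_iff[OF alg(2) types_algebra(10)]
      by simp_all
    have "A \<leadsto> g5 0"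
      using iso_degenerates_trans[OF alg(1) rep_algebra iso(1)] deg_r2_r2_g5 by simp
    moreover have "g5 0 \<leadsto> B"
    proof (rule degenerates_iso[OF types_algebra(11) alg(2)])
      show "g5 0 \<leadsto> g4 0 1" using deg_g5_g4[of 0] by simp
      show "g4 0 1 \<cong>\<^sub>a B" using iso_trans[OF g4_swap iso_sym[OF iso(2)[unfolded rep.simps]]] .
    qed
    ultimately have "g5 0 \<cong>\<^sub>a A \<or> g5 0 \<cong>\<^sub>a B"
      using prim types_algebra(11) by blast
    then have "rep (G5' 0) \<cong>\<^sub>a rep RR' \<or> rep (G5' 0) \<cong>\<^sub>a rep (G4' 1 0)"
      using iso iso_trans by auto
    then show False
      using level_iso[of "G5' 0" RR'] level_iso[of "G5' 0" "G4' 1 0"] by auto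
  qed
  ultimately show "p \<in> listed_edges - {(iso_class r2_r2, iso_class (g4 1 0))}" by blast
next
  fix p assume "p \<in> listed_edges - {(iso_class r2_r2, iso_class (g4 1 0))}"
  then obtain A B where p: "p = (iso_class A, iso_class B)" and l: "listed A B"
    and ne: "(iso_class A, iso_class B) \<noteq> (iso_class r2_r2, iso_class (g4 1 0))"
    by (auto simp: listed_edges_def)
  have "binary_lie A" "binary_lie B"
    using listed_rep[OF l] rep_binary_lie by blast+
  then show "p \<in> primary_graph"
    using primary_listed[OF l ne] p unfolding primary_graph_def by blast
qed

theorem theorem3:
  "primary_graph = listed_edges - {(iso_class r2_r2, iso_class (g4 1 0))} \<and>
   (\<forall>A B :: 4 mult. binary_lie A \<and> binary_lie B \<longrightarrow>
      (A \<leadsto> B \<longleftrightarrow> (iso_class A, iso_class B) \<in> listed_edges\<^sup>*))"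
proof (intro conjI allI impI)
  show "primary_graph = listed_edges - {(iso_class r2_r2, iso_class (g4 1 0))}"
    by (rule primary_graph_eq)
qed (rule degenerates_iff_path; simp)

end
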